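(* Let $(M,\omega)$ be a compact Chern-Kähler-like (CKL) Hermitian manifold of complex dimension $n$. (1) If $\mathrm{HSC}(\omega)>0$, then $\Gamma^p_q(M)=0$ when $q\gg p$; that is, there is a constant $C>0$ depending only on $(M,\omega)$ such that $\Gamma^p_q(M)=0$ for all integers $p,q\geq 0$ with $q>Cp$. In particular, $\Gamma^0_q(M)=0$ for all $q\geq 1$, and consequently the Hodge numbers satisfy $h^{q,0}(M)=0$ for $1\leq q\leq n$. (2) If $\mathrm{HSC}(\omega)<0$, then $\Gamma^p_q(M)=0$ when $p\gg q$; that is, there is a constant $C>0$ depending only on $(M,\omega)$ such that $\Gamma^p_q(M)=0$ for all integers $p,q\geq 0$ with $p>Cq$. In particular, $\Gamma^p_0(M)=0$ for all $p\geq 1$.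
   Context: $M$ is a compact connected complex manifold of complex dimension $n\geq 2$ with a Hermitian metric $\langle\cdot,\cdot\rangle$ on its holomorphic tangent bundle $TM$; the metric is identified with its associated positive $(1,1)$-form $\omega$. $T^*M$ is the holomorphic cotangent bundle. For integers $p,q\geq 0$, $\Gamma^p_q(M):=H^0\big(M,(TM)^{\otimes p}\otimes(T^*M)^{\otimes q}\big)$ is the space of holomorphic $(p,q)$-type tensor fields. $h^{q,0}(M)=\dim_{\mathbb{C}} H^0(M,\Lambda^q T^*M)$. $R$ denotes the curvature tensor of the Chern connection $\nabla$ of $(TM,\omega)$ (the unique connection compatible with both the metric and the holomorphic structure), with the convention $R=\nabla^2$ and $R(X,\overline{Y},Z,\overline{W})=\langle R_{X\overline{Y}}(Z),W\rangle$ for $(1,0)$-type tangent vectors $X,Y,Z,W$, where $R_{X\overline Y}$ is the endomorphism obtained by evaluating the $\mathrm{End}(TM)$-valued $(1,1)$-form $R$ on $(X,\overline Y)$, normalized so that $dz^i\wedge d\bar z^j$ evaluated on $(u,\bar v)$ is $u^i\overline{v^j}$. $\omega$ is called Chern-Kähler-like (CKL) if $R(X,\overline{Y},Z,\overline{W})=R(Z,\overline{Y},X,\overline{W})$ for all $(1,0)$-type tangent vectors $X,Y,Z,W$. For $x\in M$ and $v\in T_xM\setminus\{0\}$, the holomorphic sectional curvature is $H_x(v):=R(v,\bar v,v,\bar v)/|v|^4$. $\mathrm{HSC}(\omega)>0$ (resp. $<0$) means $H_x(v)>0$ (resp. $<0$) for all $x\in M$ and all $v\in T_xM\setminus\{0\}$.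 *)

theory Defs
  imports "HOL-Analysis.Analysis" "HOL-Library.Function_Algebras"
begin

section \<open>Smooth and holomorphic maps on open subsets of complex n-space\<close>

text \<open>Both notions are meant for open sets \<open>S\<close>. Smoothness is real smoothness: \<open>complex ^ 'n\<close> is
  regarded as a real normed space of dimension \<open>2 * CARD('n)\<close>.\<close>

primrec Ck_on :: "nat \<Rightarrow> ('v::real_normed_vector \<Rightarrow> 'w::real_normed_vector) \<Rightarrow> 'v set \<Rightarrow> bool" where
  "Ck_on 0 f S \<longleftrightarrow> continuous_on S f"
| "Ck_on (Suc k) f S \<longleftrightarrow>
     (\<forall>x\<in>S. f differentiable (at x)) \<and> (\<forall>v. Ck_on k (\<lambda>x. frechet_derivative f (at x) v) S)"

definition smooth_on :: "('v::real_normed_vector \<Rightarrow> 'w::real_normed_vector) \<Rightarrow> 'v set \<Rightarrow> bool" where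
  "smooth_on f S \<longleftrightarrow> (\<forall>k. Ck_on k f S)"

definition mv_holomorphic_on :: "(complex ^ 'n \<Rightarrow> complex) \<Rightarrow> (complex ^ 'n) set \<Rightarrow> bool" where
  "mv_holomorphic_on f S \<longleftrightarrow>
     (\<forall>z\<in>S. \<exists>f'. (f has_derivative f') (at z) \<and> (\<forall>a v. f' (a *s v) = a * f' v))"


section \<open>Complex manifolds\<close>

text \<open>A chart is a pair of an open set \<open>U\<close> of the manifold and a coordinate map, of which only the
  values on \<open>U\<close> matter. The dimension is \<open>CARD('n)\<close>.\<close>

type_synonym ('a, 'n) chart = "'a set \<times> ('a \<Rightarrow> complex ^ 'n)"

definition coord_dom :: "('a, 'n) chart \<Rightarrow> (complex ^ 'n) set" where
  "coord_dom c = snd c ` fst c"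

definition overlap :: "('a, 'n) chart \<Rightarrow> ('a, 'n) chart \<Rightarrow> (complex ^ 'n) set" where
  "overlap c d = snd c ` (fst c \<inter> fst d)"

text \<open>The coordinate change from \<open>c\<close> to \<open>d\<close>, to be used on \<open>overlap c d\<close>.\<close>

definition transition ::
    "('a, 'n) chart \<Rightarrow> ('a, 'n) chart \<Rightarrow> complex ^ 'n \<Rightarrow> complex ^ 'n" where
  "transition c d z = snd d (the_inv_into (fst c) (snd c) z)"

definition complex_manifold :: "'a topology \<Rightarrow> ('a, 'n::finite) chart set \<Rightarrow> bool" where
  "complex_manifold X A \<longleftrightarrow>
     Hausdorff_space X \<and> second_countable X \<and>
     (\<forall>c\<in>A. openin X (fst c) \<and> open (coord_dom c) \<and>
        homeomorphic_map (subtopology X (fst c)) (top_of_set (coord_dom c)) (snd c)) \<and>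
     (\<Union>c\<in>A. fst c) = topspace X \<and>
     (\<forall>c\<in>A. \<forall>d\<in>A. \<forall>i. mv_holomorphic_on (\<lambda>z. transition c d z $ i) (overlap c d))"

text \<open>The holomorphic Jacobian matrix of a coordinate change; these matrices are the transition
  functions of \<open>TM\<close>.\<close>

definition jac ::
    "('a, 'n::finite) chart \<Rightarrow> ('a, 'n) chart \<Rightarrow> complex ^ 'n \<Rightarrow> complex ^ 'n ^ 'n" where
  "jac c d z = (\<chi> i j. frechet_derivative (transition c d) (at z) (axis j 1) $ i)"


section \<open>Holomorphic tensor fields\<close>

text \<open>Sections of bundles are families of local sections over the coordinate domains, related by the
  transition functions of the bundle. For a \<open>(p,q)\<close>-type tensor field, \<open>T c z I K\<close> is the
  coefficient, in the chart \<open>c\<close> at the point with coordinates \<open>z\<close>, of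
  \<open>\<partial>_{I_1} \<otimes> \<dots> \<otimes> \<partial>_{I_p} \<otimes> dz^{K_1} \<otimes> \<dots> \<otimes> dz^{K_q}\<close>.
  Irrelevant arguments are sent to \<open>0\<close>, so that equality of fields is equality of functions.\<close>

type_synonym ('a, 'n) tensor_field =
  "('a, 'n) chart \<Rightarrow> complex ^ 'n \<Rightarrow> 'n list \<Rightarrow> 'n list \<Rightarrow> complex"

definition holo_tensors ::
    "('a, 'n::finite) chart set \<Rightarrow> nat \<Rightarrow> nat \<Rightarrow> ('a, 'n) tensor_field set" where
  "holo_tensors A p q = {T.
     (\<forall>c z I K. \<not> (c \<in> A \<and> z \<in> coord_dom c \<and> length I = p \<and> length K = q) \<longrightarrow> T c z I K = 0) \<and>
     (\<forall>c\<in>A. \<forall>I K. mv_holomorphic_on (\<lambda>z. T c z I K) (coord_dom c)) \<and>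
     (\<forall>c\<in>A. \<forall>d\<in>A. \<forall>z\<in>overlap c d. \<forall>I K. length I = p \<longrightarrow> length K = q \<longrightarrow>
        T d (transition c d z) I K =
          (\<Sum>I'\<in>{I'. length I' = p}. \<Sum>K'\<in>{K'. length K' = q}.
             (\<Prod>a<p. jac c d z $ (I ! a) $ (I' ! a)) *
             (\<Prod>b<q. jac d c (transition c d z) $ (K' ! b) $ (K ! b)) * T c z I' K'))}"

text \<open>Sections of \<open>\<Lambda>\<^sup>q T\<^sup>*M\<close>, realised as the alternating sections of the \<open>q\<close>-th tensor power.\<close>

definition holo_forms :: "('a, 'n::finite) chart set \<Rightarrow> nat \<Rightarrow> ('a, 'n) tensor_field set" where
  "holo_forms A q = {T \<in> holo_tensors A 0 q.
     \<forall>c z K \<sigma>. length K = q \<longrightarrow> \<sigma> permutes {..<q} \<longrightarrow>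
       T c z [] (permute_list \<sigma> K) = of_int (sign \<sigma>) * T c z [] K}"

definition tensor_scale :: "complex \<Rightarrow> ('a, 'n) tensor_field \<Rightarrow> ('a, 'n) tensor_field" where
  "tensor_scale a T = (\<lambda>c z I K. a * T c z I K)"

lemma vector_space_tensor_scale: "vector_space tensor_scale"
  by unfold_locales (auto simp: tensor_scale_def fun_eq_iff algebra_simps)

text \<open>The library's dimension is \<open>0\<close> for infinite-dimensional spaces, but on a compact manifold
  \<open>holo_forms A q\<close> is finite-dimensional.\<close>

definition hodge_q0 :: "('a, 'n::finite) chart set \<Rightarrow> nat \<Rightarrow> nat" where
  "hodge_q0 A q = vector_space.dim tensor_scale (holo_forms A q)"


section \<open>Hermitian metrics\<close>

text \<open>Complex linear in the first argument, conjugate linear in the second.\<close>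

definition herm :: "complex ^ 'n ^ 'n \<Rightarrow> complex ^ 'n \<Rightarrow> complex ^ 'n \<Rightarrow> complex" where
  "herm G s t = (\<Sum>k\<in>UNIV. \<Sum>l\<in>UNIV. G $ k $ l * s $ k * cnj (t $ l))"

text \<open>\<open>H c z $ k $ l\<close> is \<open>\<langle>\<partial>_k, \<partial>_l\<rangle>\<close> in the chart \<open>c\<close>.\<close>

type_synonym ('a, 'n) metric = "('a, 'n) chart \<Rightarrow> complex ^ 'n \<Rightarrow> complex ^ 'n ^ 'n"

definition hermitian_metric :: "('a, 'n::finite) chart set \<Rightarrow> ('a, 'n) metric \<Rightarrow> bool" where
  "hermitian_metric A H \<longleftrightarrow>
     (\<forall>c\<in>A. smooth_on (H c) (coord_dom c)) \<and>
     (\<forall>c\<in>A. \<forall>z\<in>coord_dom c.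
        (\<forall>v w. herm (H c z) w v = cnj (herm (H c z) v w)) \<and>
        (\<forall>v. v \<noteq> 0 \<longrightarrow> Re (herm (H c z) v v) > 0)) \<and>
     (\<forall>c\<in>A. \<forall>d\<in>A. \<forall>z\<in>overlap c d. \<forall>v w.
        herm (H d (transition c d z)) (jac c d z *v v) (jac c d z *v w) = herm (H c z) v w)"


section \<open>The Chern connection and its curvature\<close>

text \<open>A connection on \<open>TM\<close> is given by its matrices of 1-forms in the coordinate frames:
  \<open>\<theta> c z u\<close> is the value on the real tangent vector \<open>u\<close>. A real tangent vector is written as an
  element of \<open>complex ^ 'n\<close>, namely as the derivative of the coordinates along it.\<close>

type_synonym ('a, 'n) connection =
  "('a, 'n) chart \<Rightarrow> complex ^ 'n \<Rightarrow> complex ^ 'n \<Rightarrow> complex ^ 'n ^ 'n"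

text \<open>The covariant derivative \<open>\<nabla>_u s\<close> at \<open>z\<close> of a local section \<open>s\<close> of \<open>TM\<close>, with \<open>D = \<theta> c\<close>.\<close>

definition cov_deriv ::
    "(complex ^ 'n \<Rightarrow> complex ^ 'n \<Rightarrow> complex ^ 'n ^ 'n) \<Rightarrow>
     (complex ^ 'n \<Rightarrow> complex ^ 'n) \<Rightarrow> complex ^ 'n \<Rightarrow> complex ^ 'n \<Rightarrow> complex ^ 'n" where
  "cov_deriv D s z u = frechet_derivative s (at z) u + D z u *v s z"

text \<open>The transformation law says that \<open>cov_deriv\<close> maps local representatives \<open>s\<close>, \<open>J s\<close> of the
  same section to local representatives of the same section.\<close>

definition connection :: "('a, 'n::finite) chart set \<Rightarrow> ('a, 'n) connection \<Rightarrow> bool" where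
  "connection A \<theta> \<longleftrightarrow>
     (\<forall>c\<in>A. \<forall>u. smooth_on (\<lambda>z. \<theta> c z u) (coord_dom c)) \<and>
     (\<forall>c\<in>A. \<forall>z\<in>coord_dom c. linear (\<theta> c z)) \<and>
     (\<forall>c\<in>A. \<forall>d\<in>A. \<forall>z\<in>overlap c d. \<forall>u.
        \<theta> d (transition c d z) (jac c d z *v u) ** jac c d z =
          jac c d z ** \<theta> c z u - frechet_derivative (jac c d) (at z) u)"

text \<open>For a real linear \<open>L\<close>, the values of its complex linear extension on
  \<open>X = \<Sum>_i v^i \<partial>/\<partial>z^i\<close> and on the conjugate vector. Since \<open>v\<close> as a real tangent
  vector is \<open>X + \<bar>X\<close>, one has \<open>X = (v - \<i> J v)/2\<close>, where \<open>J\<close> is multiplication by \<open>\<i>\<close> on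
  coordinates.\<close>

definition at_10 :: "(complex ^ 'n \<Rightarrow> complex ^ 'n) \<Rightarrow> complex ^ 'n \<Rightarrow> complex ^ 'n" where
  "at_10 L v = (1/2) *s (L v - \<i> *s L (\<i> *s v))"

definition at_01 :: "(complex ^ 'n \<Rightarrow> complex ^ 'n) \<Rightarrow> complex ^ 'n \<Rightarrow> complex ^ 'n" where
  "at_01 L v = (1/2) *s (L v + \<i> *s L (\<i> *s v))"

text \<open>Compatibility with the holomorphic structure is \<open>\<nabla>\<^sup>0\<^sup>,\<^sup>1 = \<partial>bar\<close>, compatibility with the metric
  is \<open>d\<langle>s,t\<rangle> = \<langle>\<nabla>s,t\<rangle> + \<langle>s,\<nabla>t\<rangle>\<close>.\<close>

definition chern_connection ::
    "('a, 'n::finite) chart set \<Rightarrow> ('a, 'n) metric \<Rightarrow> ('a, 'n) connection \<Rightarrow> bool" where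
  "chern_connection A H \<theta> \<longleftrightarrow> connection A \<theta> \<and>
     (\<forall>c\<in>A. \<forall>s. smooth_on s (coord_dom c) \<longrightarrow> (\<forall>z\<in>coord_dom c. \<forall>v.
        at_01 (cov_deriv (\<theta> c) s z) v = at_01 (frechet_derivative s (at z)) v)) \<and>
     (\<forall>c\<in>A. \<forall>s t. smooth_on s (coord_dom c) \<longrightarrow> smooth_on t (coord_dom c) \<longrightarrow>
        (\<forall>z\<in>coord_dom c. \<forall>u.
          frechet_derivative (\<lambda>y. herm (H c y) (s y) (t y)) (at z) u =
            herm (H c z) (cov_deriv (\<theta> c) s z u) (t z) +
            herm (H c z) (s z) (cov_deriv (\<theta> c) t z u)))"

text \<open>\<open>R = \<nabla>\<^sup>2\<close> on real tangent vectors: \<open>R(u,w) e = \<nabla>_u \<nabla>_w e - \<nabla>_w \<nabla>_u e\<close>, where \<open>u\<close>, \<open>w\<close>, \<open>e\<close> are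
  extended with constant coefficients, so that there is no bracket term. This is
  \<open>d\<theta> + \<theta> \<and> \<theta>\<close> with \<open>(\<alpha> \<and> \<beta>)(u,w) = \<alpha>(u) \<beta>(w) - \<alpha>(w) \<beta>(u)\<close>.\<close>

definition curv_real ::
    "(complex ^ 'n \<Rightarrow> complex ^ 'n \<Rightarrow> complex ^ 'n ^ 'n) \<Rightarrow> complex ^ 'n \<Rightarrow>
     complex ^ 'n \<Rightarrow> complex ^ 'n \<Rightarrow> complex ^ 'n \<Rightarrow> complex ^ 'n" where
  "curv_real D z u w e =
     cov_deriv D (\<lambda>y. cov_deriv D (\<lambda>_. e) y w) z u - cov_deriv D (\<lambda>y. cov_deriv D (\<lambda>_. e) y u) z w"

text \<open>The endomorphism \<open>R_{X,\<bar>Y}\<close> applied to \<open>e\<close>.\<close>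

definition curv_op ::
    "(complex ^ 'n \<Rightarrow> complex ^ 'n \<Rightarrow> complex ^ 'n ^ 'n) \<Rightarrow> complex ^ 'n \<Rightarrow>
     complex ^ 'n \<Rightarrow> complex ^ 'n \<Rightarrow> complex ^ 'n \<Rightarrow> complex ^ 'n" where
  "curv_op D z x y e = at_10 (\<lambda>u. at_01 (\<lambda>w. curv_real D z u w e) y) x"

text \<open>The normalisation: \<open>dz^i \<and> d\<bar>z^j\<close> has the value \<open>x^i cnj (y^j)\<close> on \<open>(X, \<bar>Y)\<close>.\<close>

lemma eval_11_normalisation:
  "at_10 (\<lambda>u. at_01 (\<lambda>w. (u $ i * cnj (w $ j) - w $ i * cnj (u $ j)) *s e) y) x
     = (x $ i * cnj (y $ j)) *s e"
  unfolding at_10_def at_01_def vec_eq_iff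
  by (simp add: field_simps)

text \<open>\<open>R(X, \<bar>Y, Z, \<bar>W)\<close> in the chart \<open>c\<close> at the point with coordinates \<open>z\<close>; (1,0)-type tangent vectors
  are given by their components in the frame \<open>\<partial>/\<partial>z^i\<close>.\<close>

definition curv_tensor ::
    "('a, 'n) metric \<Rightarrow> ('a, 'n) connection \<Rightarrow> ('a, 'n) chart \<Rightarrow> complex ^ 'n \<Rightarrow>
     complex ^ 'n \<Rightarrow> complex ^ 'n \<Rightarrow> complex ^ 'n \<Rightarrow> complex ^ 'n \<Rightarrow> complex" where
  "curv_tensor H \<theta> c z x y v w = herm (H c z) (curv_op (\<theta> c) z x y v) w"

definition chern_kahler_like ::
    "('a, 'n::finite) chart set \<Rightarrow> ('a, 'n) metric \<Rightarrow> ('a, 'n) connection \<Rightarrow> bool" where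
  "chern_kahler_like A H \<theta> \<longleftrightarrow>
     (\<forall>c\<in>A. \<forall>z\<in>coord_dom c. \<forall>x y v w.
        curv_tensor H \<theta> c z x y v w = curv_tensor H \<theta> c z v y x w)"

definition herm_norm :: "complex ^ 'n ^ 'n \<Rightarrow> complex ^ 'n \<Rightarrow> real" where
  "herm_norm G v = sqrt (Re (herm G v v))"

text \<open>For the Chern connection \<open>R(v, \<bar>v, v, \<bar>v)\<close> is real, so taking real parts loses nothing.\<close>

definition hol_sect_curv ::
    "('a, 'n) metric \<Rightarrow> ('a, 'n) connection \<Rightarrow> ('a, 'n) chart \<Rightarrow> complex ^ 'n \<Rightarrow>
     complex ^ 'n \<Rightarrow> real" where
  "hol_sect_curv H \<theta> c z v = Re (curv_tensor H \<theta> c z v v v v) / herm_norm (H c z) v ^ 4"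

definition HSC_pos ::
    "('a, 'n::finite) chart set \<Rightarrow> ('a, 'n) metric \<Rightarrow> ('a, 'n) connection \<Rightarrow> bool" where
  "HSC_pos A H \<theta> \<longleftrightarrow> (\<forall>c\<in>A. \<forall>z\<in>coord_dom c. \<forall>v. v \<noteq> 0 \<longrightarrow> hol_sect_curv H \<theta> c z v > 0)"

definition HSC_neg ::
    "('a, 'n::finite) chart set \<Rightarrow> ('a, 'n) metric \<Rightarrow> ('a, 'n) connection \<Rightarrow> bool" where
  "HSC_neg A H \<theta> \<longleftrightarrow> (\<forall>c\<in>A. \<forall>z\<in>coord_dom c. \<forall>v. v \<noteq> 0 \<longrightarrow> hol_sect_curv H \<theta> c z v < 0)"

end

theory Submission
  imports Defs "HOL-Complex_Analysis.Conformal_Mappings"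
begin

text \<open>
  The proof is a maximum principle for a norm of tensors that is adapted to the metric.

  \<^item> \<^emph>\<open>Curvature.\<close> The Chern-Kaehler-like condition, together with the hermitian symmetry that every
    Chern curvature has (\<open>chern_chart.R_hermitian\<close>), gives \<open>R\<close> at each point all the symmetries of a
    Kaehler curvature tensor. Hence if \<open>v\<close> is a unit vector at which the holomorphic sectional curvature of that
    point is minimal, with value \<open>\<mu> > 0\<close>, then \<open>R(v, \<bar>v, w, \<bar>w) \<ge> \<mu>/2 |w|\<^sup>2\<close> for all \<open>w\<close>
    (\<open>extremal_direction_pinching\<close>). For negative curvature the same applies to \<open>-R\<close>. Compactness
    bounds the ratio of the largest and the smallest value of \<open>R(v, \<bar>v, w, \<bar>w)\<close> on unit vectors
    \<open>w\<close> uniformly on \<open>M\<close> (\<open>uniform_pinching\<close>); this bound is the constant of the theorem.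

  \<^item> \<^emph>\<open>Norm.\<close> For a holomorphic \<open>(p,q)\<close>-tensor field \<open>T\<close> let \<open>N(x)\<close> be the supremum of
    \<open>|T(\<alpha>_1, \<dots>, \<alpha>_p, w_1, \<dots>, w_q)|\<close> over covectors and vectors of length at most one
    (\<open>tensor_norm\<close>). It is independent of the chart and upper semicontinuous, so it has a maximum,
    attained at some \<open>x_0\<close>.

  \<^item> \<^emph>\<open>Maximum principle.\<close> On the complex line \<open>z_0 + t v\<close> through \<open>x_0\<close> there is a holomorphic
    frame in which the metric is \<open>\<langle>y,y'\<rangle> - |t|\<^sup>2 R(v, \<bar>v, y, \<bar>y') + o(|t|\<^sup>2)\<close>
    (\<open>normal_frame\<close>). If \<open>lo |w|\<^sup>2 \<le> R(v, \<bar>v, w, \<bar>w) \<le> hi |w|\<^sup>2\<close>, then along the line a vector with constant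
    coefficients in this frame shrinks at least like \<open>1 - lo |t|\<^sup>2 / 2\<close>, and a covector with constant coefficients grows
    at most like \<open>1 + hi |t|\<^sup>2 / 2\<close>. Inserting such arguments into \<open>T\<close> gives a holomorphic function
    of \<open>t\<close> that is bounded on \<open>|t| = r\<close> by about \<open>(1 - (q lo - p hi) r\<^sup>2 / 2) N(x_0)\<close>, hence by
    the maximum modulus principle also at \<open>t = 0\<close>. When \<open>q lo > p hi\<close> this forces \<open>N(x_0) = 0\<close>
    (\<open>no_interior_maximum\<close>), and \<open>T = 0\<close> (\<open>holo_tensors_vanish\<close>).

  For positive curvature, \<open>q lo > p hi\<close> reads \<open>q > (hi/lo) p\<close>. For negative curvature both bounds are negative, and it
  reads \<open>p > (lo/hi) q\<close>, where \<open>lo/hi \<ge> 1\<close> is again the ratio of the absolute values.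
\<close>


section \<open>Calculus of smooth maps\<close>

lemma frechet_derivative_eqI:
  assumes "(f has_derivative f') (at x)"
  shows "frechet_derivative f (at x) = f'"
  using frechet_derivative_at[OF assms] by simp

lemma differentiable_has_frechet:
  "f differentiable (at x) \<Longrightarrow> (f has_derivative frechet_derivative f (at x)) (at x)"
  by (simp add: frechet_derivative_works)

lemma has_derivative_cong_open:
  assumes "open S" "x \<in> S" "\<And>y. y \<in> S \<Longrightarrow> f y = g y" "(f has_derivative D) (at x)"
  shows "(g has_derivative D) (at x)"
  using assms(4) has_derivative_transform_within_open[OF assms(4) assms(1,2)] assms(3) by blast

lemma frechet_derivative_cong_open:
  assumes "open S" "x \<in> S" "\<And>y. y \<in> S \<Longrightarrow> f y = g y"
  shows "frechet_derivative f (at x) = frechet_derivative g (at x)"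
proof -
  have "(f has_derivative D) (at x) \<longleftrightarrow> (g has_derivative D) (at x)" for D
    using has_derivative_cong_open[OF assms(1,2)] assms(3) by metis
  then show ?thesis unfolding frechet_derivative_def by simp
qed

lemma Ck_on_cong:
  assumes "open S" "\<And>x. x \<in> S \<Longrightarrow> f x = g x" "Ck_on k f S"
  shows "Ck_on k g S"
  using assms(2,3)
proof (induction k arbitrary: f g)
  case 0
  then show ?case by (auto cong: continuous_on_cong)
next
  case (Suc k)
  have "g differentiable (at x)" if "x \<in> S" for x
    using Suc.prems(1) Suc.prems(2)[unfolded Ck_on.simps] that has_derivative_cong_open[OF assms(1) that, of f g]
    unfolding differentiable_def by meson
  moreover have "Ck_on k (\<lambda>x. frechet_derivative g (at x) v) S" for v
    by (rule Suc.IH[of "\<lambda>x. frechet_derivative f (at x) v"])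
      (use Suc.prems frechet_derivative_cong_open[OF assms(1), of _ f g] in auto)
  ultimately show ?case by simp
qed

lemma Ck_on_SucD: "Ck_on (Suc k) f S \<Longrightarrow> Ck_on k f S"
proof (induction k arbitrary: f)
  case 0
  then show ?case
    by (auto intro!: differentiable_imp_continuous_on differentiable_at_imp_differentiable_on)
qed auto

lemma smooth_on_differentiable: "smooth_on f S \<Longrightarrow> x \<in> S \<Longrightarrow> f differentiable (at x)"
  unfolding smooth_on_def by (metis Ck_on.simps(2))

lemma smooth_on_has_frechet:
  "smooth_on f S \<Longrightarrow> x \<in> S \<Longrightarrow> (f has_derivative frechet_derivative f (at x)) (at x)"
  by (rule differentiable_has_frechet[OF smooth_on_differentiable])

lemma smooth_on_frechet: "smooth_on f S \<Longrightarrow> smooth_on (\<lambda>x. frechet_derivative f (at x) v) S"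
  unfolding smooth_on_def by (metis Ck_on.simps(2))

lemma smooth_on_continuous: "smooth_on f S \<Longrightarrow> continuous_on S f"
  unfolding smooth_on_def by (metis Ck_on.simps(1))

lemma Ck_on_const: "Ck_on k (\<lambda>_. c) S"
  by (induction k arbitrary: c) auto

lemma Ck_on_add:
  assumes "open S" "Ck_on k f S" "Ck_on k g S"
  shows "Ck_on k (\<lambda>x. f x + g x) S"
  using assms(2,3)
proof (induction k arbitrary: f g)
  case 0
  then show ?case by (auto intro: continuous_intros)
next
  case (Suc k)
  have eq: "frechet_derivative (\<lambda>x. f x + g x) (at x) v =
      frechet_derivative f (at x) v + frechet_derivative g (at x) v" if "x \<in> S" for x v
    using Suc.prems that
    by (intro fun_cong[OF frechet_derivative_eqI, THEN trans])
      (auto intro!: has_derivative_add differentiable_has_frechet)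
  have "Ck_on k (\<lambda>x. frechet_derivative (\<lambda>x. f x + g x) (at x) v) S" for v
    by (rule Ck_on_cong[OF assms(1) _ Suc.IH[of "\<lambda>x. frechet_derivative f (at x) v"
          "\<lambda>x. frechet_derivative g (at x) v"]])
      (use Suc.prems eq in auto)
  then show ?case using Suc.prems by (auto intro: differentiable_add)
qed

lemma Ck_on_bilinear:
  assumes "bounded_bilinear b" "open S" "Ck_on k f S" "Ck_on k g S"
  shows "Ck_on k (\<lambda>x. b (f x) (g x)) S"
  using assms(3,4)
proof (induction k arbitrary: f g)
  case 0
  then show ?case by (auto intro: bounded_bilinear.continuous_on[OF assms(1)])
next
  case (Suc k)
  have D: "((\<lambda>x. b (f x) (g x)) has_derivative
      (\<lambda>v. b (f x) (frechet_derivative g (at x) v) + b (frechet_derivative f (at x) v) (g x))) (at x)"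
    if "x \<in> S" for x
    using Suc.prems that
    by (intro bounded_bilinear.FDERIV[OF assms(1)] differentiable_has_frechet) auto
  have "Ck_on k (\<lambda>x. frechet_derivative (\<lambda>x. b (f x) (g x)) (at x) v) S" for v
  proof (rule Ck_on_cong[OF assms(2)])
    show "Ck_on k (\<lambda>x. b (f x) (frechet_derivative g (at x) v) +
        b (frechet_derivative f (at x) v) (g x)) S"
      by (intro Ck_on_add[OF assms(2)] Suc.IH)
        (use Suc.prems Ck_on_SucD[OF Suc.prems(1)] Ck_on_SucD[OF Suc.prems(2)] in auto)
  qed (use frechet_derivative_eqI[OF D] in auto)
  then show ?case using D unfolding Ck_on.simps differentiable_def by blast
qed

lemma smooth_on_const: "smooth_on (\<lambda>_. c) S"
  by (simp add: smooth_on_def Ck_on_const)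

lemma smooth_on_add:
  "open S \<Longrightarrow> smooth_on f S \<Longrightarrow> smooth_on g S \<Longrightarrow> smooth_on (\<lambda>x. f x + g x) S"
  by (simp add: smooth_on_def Ck_on_add)

lemma smooth_on_bilinear:
  "bounded_bilinear b \<Longrightarrow> open S \<Longrightarrow> smooth_on f S \<Longrightarrow> smooth_on g S \<Longrightarrow>
    smooth_on (\<lambda>x. b (f x) (g x)) S"
  by (simp add: smooth_on_def Ck_on_bilinear)

lemma smooth_on_bounded_linear:
  assumes "bounded_linear L"
  shows "smooth_on L S"
proof -
  have L: "(L has_derivative L) (at x)" for x
    by (rule bounded_linear_imp_has_derivative[OF assms])
  have "Ck_on k L S" for k
  proof (cases k)
    case 0
    then show ?thesis by (simp add: linear_continuous_on assms)
  next
    case (Suc j)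
    then show ?thesis
      using L by (auto simp: differentiable_def frechet_derivative_eqI[OF L] Ck_on_const)
  qed
  then show ?thesis by (simp add: smooth_on_def)
qed

lemma smooth_on_cong:
  "open S \<Longrightarrow> (\<And>x. x \<in> S \<Longrightarrow> f x = g x) \<Longrightarrow> smooth_on f S \<Longrightarrow> smooth_on g S"
  unfolding smooth_on_def using Ck_on_cong by blast

lemma mean_value_bound_01:
  fixes g :: "real \<Rightarrow> 'w::real_normed_vector"
  assumes "\<And>s. 0 \<le> s \<Longrightarrow> s \<le> 1 \<Longrightarrow> (g has_vector_derivative g' s) (at s)"
    and "\<And>s. 0 \<le> s \<Longrightarrow> s \<le> 1 \<Longrightarrow> norm (g' s) \<le> B"
  shows "norm (g 1 - g 0) \<le> B"
proof -
  have "norm (g 1 - g 0) \<le> B * norm (1 - 0 :: real)"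
  proof (rule differentiable_bound[where S = "{0..1}" and f' = "\<lambda>s h. h *\<^sub>R g' s"])
    fix s :: real assume s: "s \<in> {0..1}"
    show "(g has_derivative (\<lambda>h. h *\<^sub>R g' s)) (at s within {0..1})"
      using assms(1)[of s] s unfolding has_vector_derivative_def
      by (auto intro: has_derivative_at_withinI)
    show "onorm (\<lambda>h. h *\<^sub>R g' s) \<le> B"
      by (rule onorm_le) (use assms(2)[of s] s in \<open>auto simp: mult.commute[of B] intro: mult_left_mono\<close>)
  qed auto
  then show ?thesis by simp
qed

lemma has_vector_derivative_along_segment:
  assumes "(f has_derivative f') (at (a + s *\<^sub>R h))"
  shows "((\<lambda>s. f (a + s *\<^sub>R h)) has_vector_derivative f' h) (at s)"
proof -
  have "((\<lambda>s. a + s *\<^sub>R h) has_derivative (\<lambda>r. r *\<^sub>R h)) (at s)"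
    by (auto intro!: derivative_eq_intros)
  from has_derivative_compose[OF this assms]
  have "((\<lambda>s. f (a + s *\<^sub>R h)) has_derivative (\<lambda>r. f' (r *\<^sub>R h))) (at s)" .
  moreover have "f' (r *\<^sub>R h) = r *\<^sub>R f' h" for r
    using assms by (simp add: has_derivative_def bounded_linear.linear linear_cmul)
  ultimately show ?thesis by (simp add: has_vector_derivative_def)
qed

lemma has_derivative_small_remainder:
  fixes f :: "'v::real_normed_vector \<Rightarrow> 'w::real_normed_vector"
  assumes "(f has_derivative f') (at x)" "\<epsilon> > 0"
  shows "\<exists>\<delta>>0. \<forall>y. norm y < \<delta> \<longrightarrow> norm (f (x + y) - f x - f' y) \<le> \<epsilon> * norm y"
proof -
  from assms obtain d where "d > 0" and
    d: "\<And>y. norm (y - x) < d \<Longrightarrow> norm (f y - f x - f' (y - x)) \<le> \<epsilon> * norm (y - x)"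
    unfolding has_derivative_at_alt by metis
  have "\<forall>y. norm y < d \<longrightarrow> norm (f (x + y) - f x - f' y) \<le> \<epsilon> * norm y"
    using d by (metis add_diff_cancel_left')
  with \<open>d > 0\<close> show ?thesis by blast
qed

text \<open>The symmetric second difference quotient of \<open>f\<close> converges to the mixed derivative: the mean value
  inequality is applied to \<open>\<tau> \<mapsto> f(z + s u + \<tau> s w) - f(z + \<tau> s w)\<close>, whose derivative is
  \<open>s\<close> times an increment of \<open>\<partial>_w f\<close>.\<close>
lemma second_difference:
  fixes f :: "'v::real_normed_vector \<Rightarrow> 'w::real_normed_vector"
  assumes S: "open S" "z \<in> S"
    and f: "\<And>x. x \<in> S \<Longrightarrow> f differentiable (at x)"
    and fw: "((\<lambda>x. frechet_derivative f (at x) w) has_derivative F) (at z)"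
    and \<epsilon>: "\<epsilon> > 0"
  shows "\<exists>\<delta>>0. \<forall>s. 0 < s \<longrightarrow> s < \<delta> \<longrightarrow>
    norm (f (z + s *\<^sub>R u + s *\<^sub>R w) - f (z + s *\<^sub>R u) - f (z + s *\<^sub>R w) + f z - (s * s) *\<^sub>R F u) \<le> \<epsilon> * (s * s)"
proof -
  \<comment> \<open>The two points at which the derivative is compared have distances from \<open>z\<close> adding up to at most
    \<open>s K\<close>.\<close>
  define K where "K = norm u + 2 * norm w + 1"
  have K: "K > 0" unfolding K_def by (simp add: add_nonneg_pos)
  obtain d1 where d1: "d1 > 0" "\<And>y. norm y < d1 \<Longrightarrow>
      norm (frechet_derivative f (at (z + y)) w - frechet_derivative f (at z) w - F y) \<le> (\<epsilon> / K) * norm y"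
    using has_derivative_small_remainder[OF fw, of "\<epsilon> / K"] \<epsilon> K by auto
  obtain d2 where d2: "d2 > 0" "\<And>y. norm y < d2 \<Longrightarrow> z + y \<in> S"
    using S by (metis add_diff_cancel_left' dist_norm openE mem_ball subsetD norm_minus_commute)
  define \<delta> where "\<delta> = min d1 d2 / K"
  have \<delta>: "\<delta> > 0" using d1 d2 K by (simp add: \<delta>_def)
  have linF: "linear F" using fw has_derivative_linear by blast
  show ?thesis
  proof (intro exI[of _ \<delta>] conjI allI impI \<delta>)
    fix s :: real assume s: "0 < s" "s < \<delta>"
    have sK: "s * K < d1" "s * K < d2"
      using s K by (auto simp: \<delta>_def pos_less_divide_eq)
    define P where "P x = frechet_derivative f (at x) w" for x
    define g where "g t = f ((z + s *\<^sub>R u) + t *\<^sub>R (s *\<^sub>R w)) - f (z + t *\<^sub>R (s *\<^sub>R w)) - t *\<^sub>R ((s * s) *\<^sub>R F u)" for t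
    define g' where "g' t = s *\<^sub>R P ((z + s *\<^sub>R u) + t *\<^sub>R (s *\<^sub>R w)) - s *\<^sub>R P (z + t *\<^sub>R (s *\<^sub>R w)) - (s * s) *\<^sub>R F u" for t
    have bd: "norm (s *\<^sub>R u + t *\<^sub>R (s *\<^sub>R w)) \<le> s * (norm u + norm w)"
      "norm (t *\<^sub>R (s *\<^sub>R w)) \<le> s * norm w" if "0 \<le> t" "t \<le> 1" for t
    proof -
      show *: "norm (t *\<^sub>R (s *\<^sub>R w)) \<le> s * norm w"
        using that s by (simp add: mult_left_le_one_le)
      show "norm (s *\<^sub>R u + t *\<^sub>R (s *\<^sub>R w)) \<le> s * (norm u + norm w)"
        using norm_triangle_ineq[of "s *\<^sub>R u" "t *\<^sub>R (s *\<^sub>R w)"] * s by (simp add: algebra_simps)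
    qed
    have lt: "s * (norm u + norm w) < s * K" "s * norm w < s * K"
      using s unfolding K_def by (auto intro!: mult_strict_left_mono add_nonneg_pos)
    have "norm (g 1 - g 0) \<le> \<epsilon> * (s * s)"
    proof (rule mean_value_bound_01)
      fix t :: real assume t: "0 \<le> t" "t \<le> 1"
      let ?a = "s *\<^sub>R u + t *\<^sub>R (s *\<^sub>R w)" and ?b = "t *\<^sub>R (s *\<^sub>R w)"
      have inS: "z + ?a \<in> S" "z + ?b \<in> S"
        using bd[OF t] lt sK by (auto intro!: d2(2))
      have eqP: "frechet_derivative f (at x) (s *\<^sub>R w) = s *\<^sub>R P x" if "x \<in> S" for x
        unfolding P_def using f[OF that] by (metis linear_cmul linear_frechet_derivative)
      have f1: "((\<lambda>t. f ((z + s *\<^sub>R u) + t *\<^sub>R (s *\<^sub>R w))) has_vector_derivative s *\<^sub>R P (z + ?a)) (at t)"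
        using has_vector_derivative_along_segment[of f _ "z + s *\<^sub>R u" t "s *\<^sub>R w",
            unfolded add.assoc, OF differentiable_has_frechet[OF f[OF inS(1)]]]
        unfolding eqP[OF inS(1)] by (simp add: add.assoc)
      have f2: "((\<lambda>t. f (z + t *\<^sub>R (s *\<^sub>R w))) has_vector_derivative s *\<^sub>R P (z + ?b)) (at t)"
        using has_vector_derivative_along_segment[OF differentiable_has_frechet[OF f[OF inS(2)]]]
          eqP[OF inS(2)] by simp
      show "(g has_vector_derivative g' t) (at t)"
        unfolding g_def g'_def
        using f1 f2 by (auto intro!: derivative_eq_intros simp: add.assoc)
      have n: "norm ?a < d1" "norm ?b < d1" using bd[OF t] lt sK by auto
      have Fl: "F ?a - F ?b = s *\<^sub>R F u" by (simp add: linF linear_add linear_cmul)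
      have "norm (P (z + ?a) - P (z + ?b) - s *\<^sub>R F u) =
          norm ((P (z + ?a) - P z - F ?a) - (P (z + ?b) - P z - F ?b))"
        unfolding Fl[symmetric] by (simp add: algebra_simps)
      also have "\<dots> \<le> (\<epsilon> / K) * norm ?a + (\<epsilon> / K) * norm ?b"
        unfolding P_def by (rule order_trans[OF norm_triangle_ineq4 add_mono[OF d1(2)[OF n(1)] d1(2)[OF n(2)]]])
      also have "\<dots> \<le> (\<epsilon> / K) * (s * (norm u + norm w)) + (\<epsilon> / K) * (s * norm w)"
        by (intro add_mono mult_left_mono bd[OF t]) (use \<epsilon> K in auto)
      also have "\<dots> = (\<epsilon> / K) * (s * (norm u + 2 * norm w))" by (simp add: algebra_simps)
      also have "\<dots> \<le> (\<epsilon> / K) * (s * K)"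
        by (intro mult_left_mono) (use \<epsilon> K s in \<open>auto simp: K_def\<close>)
      also have "\<dots> = \<epsilon> * s" using K by simp
      finally have *: "norm (P (z + ?a) - P (z + ?b) - s *\<^sub>R F u) \<le> \<epsilon> * s" .
      have "g' t = s *\<^sub>R (P (z + ?a) - P (z + ?b) - s *\<^sub>R F u)"
        unfolding g'_def by (simp add: algebra_simps)
      then show "norm (g' t) \<le> \<epsilon> * (s * s)"
        using * s by (simp add: mult.assoc mult.left_commute)
    qed
    then show "norm (f (z + s *\<^sub>R u + s *\<^sub>R w) - f (z + s *\<^sub>R u) - f (z + s *\<^sub>R w) + f z - (s * s) *\<^sub>R F u) \<le> \<epsilon> * (s * s)"
      unfolding g_def by (simp add: algebra_simps)
  qed
qed

text \<open>The second difference does not change when \<open>u\<close> and \<open>w\<close> are exchanged.\<close>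
lemma second_derivative_symmetric:
  fixes f :: "'v::real_normed_vector \<Rightarrow> 'w::real_normed_vector"
  assumes S: "open S" "z \<in> S" and f: "smooth_on f S"
  shows "frechet_derivative (\<lambda>x. frechet_derivative f (at x) w) (at z) u =
    frechet_derivative (\<lambda>x. frechet_derivative f (at x) u) (at z) w" (is "?a = ?b")
proof (rule ccontr)
  assume ne: "?a \<noteq> ?b"
  define \<epsilon> where "\<epsilon> = norm (?a - ?b) / 3"
  have \<epsilon>: "\<epsilon> > 0" using ne by (simp add: \<epsilon>_def)
  have d: "\<And>x. x \<in> S \<Longrightarrow> f differentiable (at x)" using smooth_on_differentiable[OF f] .
  have dd: "((\<lambda>x. frechet_derivative f (at x) v) has_derivative
      frechet_derivative (\<lambda>x. frechet_derivative f (at x) v) (at z)) (at z)" for v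
    using smooth_on_has_frechet[OF smooth_on_frechet[OF f] S(2)] .
  obtain d1 where d1: "d1 > 0" "\<And>s. 0 < s \<Longrightarrow> s < d1 \<Longrightarrow>
      norm (f (z + s *\<^sub>R u + s *\<^sub>R w) - f (z + s *\<^sub>R u) - f (z + s *\<^sub>R w) + f z - (s * s) *\<^sub>R ?a) \<le> \<epsilon> * (s * s)"
    using second_difference[OF S d dd \<epsilon>, where w = w and u = u] by blast
  obtain d2 where d2: "d2 > 0" "\<And>s. 0 < s \<Longrightarrow> s < d2 \<Longrightarrow>
      norm (f (z + s *\<^sub>R w + s *\<^sub>R u) - f (z + s *\<^sub>R w) - f (z + s *\<^sub>R u) + f z - (s * s) *\<^sub>R ?b) \<le> \<epsilon> * (s * s)"
    using second_difference[OF S d dd \<epsilon>, where w = u and u = w] by blast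
  define s where "s = min d1 d2 / 2"
  have s: "0 < s" "s < d1" "s < d2" using d1 d2 by (auto simp: s_def)
  let ?Q = "f (z + s *\<^sub>R u + s *\<^sub>R w) - f (z + s *\<^sub>R u) - f (z + s *\<^sub>R w) + f z"
  have 1: "norm (?Q - (s * s) *\<^sub>R ?a) \<le> \<epsilon> * (s * s)" using d1(2) s by blast
  have 2: "norm (?Q - (s * s) *\<^sub>R ?b) \<le> \<epsilon> * (s * s)"
    using d2(2)[OF s(1,3)] by (simp add: algebra_simps)
  have "(s * s) * norm (?a - ?b) = norm ((?Q - (s * s) *\<^sub>R ?b) - (?Q - (s * s) *\<^sub>R ?a))"
    using s by (simp add: scaleR_diff_right[symmetric])
  also have "\<dots> \<le> 2 * \<epsilon> * (s * s)"
    using norm_triangle_ineq4[of "?Q - (s * s) *\<^sub>R ?b" "?Q - (s * s) *\<^sub>R ?a"] 1 2 by linarith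
  finally have "norm (?a - ?b) \<le> 2 * \<epsilon>" using s by (simp add: mult.commute)
  then show False using \<epsilon> unfolding \<epsilon>_def by linarith
qed

lemma le_of_quadratic_perturbation:
  fixes a b c :: real
  assumes "\<And>s. s > 0 \<Longrightarrow> a \<le> b + s\<^sup>2 * c"
  shows "a \<le> b"
proof -
  have "((\<lambda>s. b + s\<^sup>2 * c) \<longlongrightarrow> b + 0\<^sup>2 * c) (at_right 0)" by (intro tendsto_intros)
  then show ?thesis
    by (intro tendsto_lowerbound[of _ b "at_right 0" a])
      (auto intro!: eventually_at_right_less[THEN eventually_mono] assms)
qed

section \<open>Sesquilinear forms\<close>

lemma herm_add_left: "herm G (s + s') t = herm G s t + herm G s' t"
  by (simp add: herm_def algebra_simps sum.distrib)

lemma herm_add_right: "herm G s (t + t') = herm G s t + herm G s t'"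
  by (simp add: herm_def algebra_simps sum.distrib)

lemma herm_scale_left: "herm G (a *s s) t = a * herm G s t"
  by (simp add: herm_def algebra_simps sum_distrib_left)

lemma herm_scale_right: "herm G s (a *s t) = cnj a * herm G s t"
  by (simp add: herm_def algebra_simps sum_distrib_left)

lemma herm_minus_left: "herm G (- s) t = - herm G s t"
  by (simp add: herm_def sum_negf)

lemma herm_minus_right: "herm G s (- t) = - herm G s t"
  by (simp add: herm_def sum_negf)

lemma herm_diff_left: "herm G (s - s') t = herm G s t - herm G s' t"
  by (simp add: herm_def algebra_simps sum_subtractf)

lemma herm_diff_right: "herm G s (t - t') = herm G s t - herm G s t'"
  by (simp add: herm_def algebra_simps sum_subtractf)

lemma herm_zero [simp]: "herm G 0 t = 0" "herm G s 0 = 0" "herm 0 s t = 0"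
  by (simp_all add: herm_def)

lemma herm_diff_mat: "herm (G - G') s t = herm G s t - herm G' s t"
  by (simp add: herm_def algebra_simps sum_subtractf)

lemmas herm_linear = herm_add_left herm_add_right herm_scale_left herm_scale_right
  herm_minus_left herm_minus_right herm_diff_left herm_diff_right

lemma vec_scaleR_eq: "r *\<^sub>R (v :: complex ^ 'n) = complex_of_real r *s v"
  by (simp add: vec_eq_iff scaleR_conv_of_real[where 'a = complex])

lemma matrix_vector_scale: "(M :: complex ^ 'n ^ 'm) *v (a *s v) = a *s (M *v v)"
  by (simp add: vec_eq_iff matrix_vector_mult_def sum_distrib_left algebra_simps)

lemma matrix_vector_scaleR_left: "(r *\<^sub>R (M :: complex ^ 'n ^ 'm)) *v v = complex_of_real r *s (M *v v)"
  by (simp add: vec_eq_iff matrix_vector_mult_def sum_distrib_left mult.assoc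
      scaleR_conv_of_real[where 'a = complex])

lemma bounded_bilinear_matrix_vector:
  "bounded_bilinear ((*v) :: complex ^ 'n::finite ^ 'm::finite \<Rightarrow> _)"
  unfolding bilinear_conv_bounded_bilinear[symmetric] bilinear_def
  by (auto intro!: linearI simp: matrix_vector_right_distrib matrix_vector_mult_add_rdistrib
      matrix_vector_scaleR_left matrix_vector_scale vec_scaleR_eq[where 'n = 'n] vec_scaleR_eq[where 'n = 'm])

lemma bounded_bilinear_scale:
  "bounded_bilinear ((*s) :: complex \<Rightarrow> complex ^ 'n::finite \<Rightarrow> _)"
  unfolding bilinear_conv_bounded_bilinear[symmetric] bilinear_def
  by (auto intro!: linearI simp: vec_eq_iff distrib_left distrib_right)

lemma smooth_on_herm:
  fixes h :: "'v::real_normed_vector \<Rightarrow> complex ^ 'n::finite ^ 'n"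
  assumes "open S" "smooth_on h S" "smooth_on s S" "smooth_on t S"
  shows "smooth_on (\<lambda>z. herm (h z) (s z) (t z)) S"
proof -
  define b1 :: "complex ^ 'n ^ 'n \<Rightarrow> complex ^ 'n \<Rightarrow> complex ^ 'n"
    where "b1 G s = (\<chi> l. \<Sum>k\<in>UNIV. G $ k $ l * s $ k)" for G s
  define b2 :: "complex ^ 'n \<Rightarrow> complex ^ 'n \<Rightarrow> complex"
    where "b2 r t = (\<Sum>l\<in>UNIV. r $ l * cnj (t $ l))" for r t
  have 1: "bounded_bilinear b1"
    unfolding bilinear_conv_bounded_bilinear[symmetric] bilinear_def
    by (auto intro!: linearI simp: b1_def vec_eq_iff distrib_left distrib_right sum.distrib scaleR_sum_right)
  have 2: "bounded_bilinear b2"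
    unfolding bilinear_conv_bounded_bilinear[symmetric] bilinear_def
    by (auto intro!: linearI simp: b2_def distrib_left distrib_right sum.distrib scaleR_sum_right)
  have "herm G s t = b2 (b1 G s) t" for G s t
    using sum.swap[of "\<lambda>k l. G $ k $ l * s $ k * cnj (t $ l)" UNIV UNIV]
    by (simp add: herm_def b2_def b1_def sum_distrib_right)
  then show ?thesis
    using smooth_on_bilinear[OF 2 assms(1) smooth_on_bilinear[OF 1 assms(1-3)] assms(4)] by presburger
qed

section \<open>The Chern connection in a chart\<close>

locale chern_chart =
  fixes S :: "(complex ^ 'n::finite) set"
    and h :: "complex ^ 'n \<Rightarrow> complex ^ 'n ^ 'n"
    and D :: "complex ^ 'n \<Rightarrow> complex ^ 'n \<Rightarrow> complex ^ 'n ^ 'n"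
  assumes open_S: "open S"
    and h_smooth: "smooth_on h S"
    and h_sym: "z \<in> S \<Longrightarrow> herm (h z) w v = cnj (herm (h z) v w)"
    and h_pos: "z \<in> S \<Longrightarrow> v \<noteq> 0 \<Longrightarrow> Re (herm (h z) v v) > 0"
    and D_smooth: "smooth_on (\<lambda>z. D z u) S"
    and D_lin: "z \<in> S \<Longrightarrow> linear (D z)"
    and D_01: "smooth_on s S \<Longrightarrow> z \<in> S \<Longrightarrow>
      at_01 (cov_deriv D s z) v = at_01 (frechet_derivative s (at z)) v"
    and D_metric: "smooth_on s S \<Longrightarrow> smooth_on t S \<Longrightarrow> z \<in> S \<Longrightarrow>
      frechet_derivative (\<lambda>y. herm (h y) (s y) (t y)) (at z) u =
        herm (h z) (cov_deriv D s z u) (t z) + herm (h z) (s z) (cov_deriv D t z u)"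
begin

abbreviation dD where "dD z x u \<equiv> frechet_derivative (\<lambda>y. D y x) (at z) u"

abbreviation R where "R z x y v w \<equiv> herm (h z) (curv_op D z x y v) w"

lemma smooth_D_apply: "smooth_on s S \<Longrightarrow> smooth_on (\<lambda>z. D z u *v s z) S"
  by (rule smooth_on_bilinear[OF bounded_bilinear_matrix_vector open_S D_smooth])

lemma smooth_cov_deriv: "smooth_on s S \<Longrightarrow> smooth_on (\<lambda>z. cov_deriv D s z u) S"
  unfolding cov_deriv_def
  by (rule smooth_on_add[OF open_S smooth_on_frechet smooth_D_apply])

lemma D_add: "z \<in> S \<Longrightarrow> D z (x + y) = D z x + D z y"
  using D_lin linear_add by blast

lemma D_scaleR: "z \<in> S \<Longrightarrow> D z (r *\<^sub>R x) = r *\<^sub>R D z x"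
  using D_lin linear_cmul by blast

text \<open>Constant sections are holomorphic, so compatibility with the holomorphic structure says that the connection
  matrix has no \<open>(0,1)\<close>-part. It is therefore complex linear in the tangent vector.\<close>
lemma D_imaginary:
  assumes "z \<in> S"
  shows "D z (\<i> *s v) *v e = \<i> *s (D z v *v e)"
proof -
  have "at_01 (\<lambda>u. D z u *v e) v = 0"
    using D_01[OF smooth_on_const assms, of e v]
    by (simp add: cov_deriv_def at_01_def)
  then have "2 *s ((1/2) *s (D z v *v e + \<i> *s (D z (\<i> *s v) *v e))) = 0"
    by (simp add: at_01_def)
  then have "D z v *v e + \<i> *s (D z (\<i> *s v) *v e) = 0"
    by (simp add: vector_ssub_ldistrib vector_smult_assoc del: vector_add_ldistrib)
  then have "\<i> *s (D z v *v e + \<i> *s (D z (\<i> *s v) *v e)) = 0" by simp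
  then show ?thesis by (simp add: vec_eq_iff algebra_simps)
qed

lemma complex_scale_split: "a *s (v :: complex ^ 'm) = Re a *\<^sub>R v + Im a *\<^sub>R (\<i> *s v)"
  by (simp add: vec_eq_iff vec_scaleR_eq complex_eq_iff algebra_simps)

lemma D_scale:
  assumes "z \<in> S" shows "D z (a *s v) *v e = a *s (D z v *v e)"
  unfolding complex_scale_split[of a] D_add[OF assms] D_scaleR[OF assms]
    matrix_vector_mult_add_rdistrib matrix_vector_scaleR_left D_imaginary[OF assms]
  unfolding vec_scaleR_eq ..

lemma dD_has_derivative: "z \<in> S \<Longrightarrow> ((\<lambda>y. D y x) has_derivative dD z x) (at z)"
  by (rule smooth_on_has_frechet[OF D_smooth])

lemma dD_apply_has_derivative:
  assumes "z \<in> S"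
  shows "((\<lambda>y. D y x *v e) has_derivative (\<lambda>u. dD z x u *v e)) (at z)"
  using bounded_bilinear.FDERIV[OF bounded_bilinear_matrix_vector dD_has_derivative[OF assms]
      has_derivative_const[of e]] by simp

lemma dD_add: "z \<in> S \<Longrightarrow> dD z x (u + u') = dD z x u + dD z x u'"
  using dD_has_derivative has_derivative_linear linear_add by blast

lemma dD_scaleR: "z \<in> S \<Longrightarrow> dD z x (r *\<^sub>R u) = r *\<^sub>R dD z x u"
  using dD_has_derivative has_derivative_linear linear_cmul by blast

lemma dD_add_form:
  assumes "z \<in> S"
  shows "dD z (x + x') u *v e = dD z x u *v e + dD z x' u *v e"
proof -
  have "((\<lambda>y. D y (x + x') *v e) has_derivative (\<lambda>u. dD z x u *v e + dD z x' u *v e)) (at z)"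
    by (rule has_derivative_cong_open[OF open_S assms _
        has_derivative_add[OF dD_apply_has_derivative[OF assms] dD_apply_has_derivative[OF assms]]])
      (simp add: D_add matrix_vector_mult_add_rdistrib)
  from fun_cong[OF has_derivative_unique[OF this dD_apply_has_derivative[OF assms]], of u]
  show ?thesis by simp
qed

lemma dD_scale_form:
  assumes "z \<in> S"
  shows "dD z (a *s x) u *v e = a *s (dD z x u *v e)"
proof -
  have "((\<lambda>y. a *s (D y x *v e)) has_derivative (\<lambda>u. a *s (dD z x u *v e))) (at z)"
    using bounded_bilinear.FDERIV[OF bounded_bilinear_scale has_derivative_const[of a]
      dD_apply_has_derivative[OF assms]] by simp
  from has_derivative_cong_open[OF open_S assms _ this]
  have "((\<lambda>y. D y (a *s x) *v e) has_derivative (\<lambda>u. a *s (dD z x u *v e))) (at z)"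
    by (simp add: D_scale)
  from fun_cong[OF has_derivative_unique[OF this dD_apply_has_derivative[OF assms]], of u]
  show ?thesis by simp
qed

lemma cov_deriv_const: "cov_deriv D (\<lambda>_. e) y w = D y w *v e"
  by (simp add: cov_deriv_def)

lemma cov_deriv_D_apply:
  "z \<in> S \<Longrightarrow> cov_deriv D (\<lambda>y. D y w *v e) z u = dD z w u *v e + D z u *v (D z w *v e)"
  by (simp add: cov_deriv_def frechet_derivative_eqI[OF dD_apply_has_derivative])

lemma curv_real_eq:
  "z \<in> S \<Longrightarrow> curv_real D z u w e = dD z w u *v e + D z u *v (D z w *v e)
    - (dD z u w *v e + D z w *v (D z u *v e))"
  unfolding curv_real_def cov_deriv_const by (simp add: cov_deriv_D_apply)

text \<open>In a holomorphic frame the curvature is \<open>\<partial>bar \<theta>\<close>: the connection form is of type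
  \<open>(1,0)\<close>, so the products of connection matrices do not contribute to the \<open>(1,1)\<close>-part.\<close>

lemma curv_op_eq:
  assumes "z \<in> S"
  shows "curv_op D z x y e = - ((1/2) *s (dD z x y *v e + \<i> *s (dD z x (\<i> *s y) *v e)))"
  unfolding curv_op_def at_10_def at_01_def curv_real_eq[OF assms]
  by (simp add: D_scale[OF assms] dD_scale_form[OF assms] matrix_vector_scale vec_eq_iff field_simps)

lemma curv_op_add1: "z \<in> S \<Longrightarrow> curv_op D z (x + x') y e = curv_op D z x y e + curv_op D z x' y e"
  by (simp add: curv_op_eq dD_add_form vec_eq_iff algebra_simps)

lemma curv_op_scale1: "z \<in> S \<Longrightarrow> curv_op D z (a *s x) y e = a *s curv_op D z x y e"
  by (simp add: curv_op_eq dD_scale_form vec_eq_iff algebra_simps)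

lemma curv_op_add2: "z \<in> S \<Longrightarrow> curv_op D z x (y + y') e = curv_op D z x y e + curv_op D z x y' e"
  by (simp add: curv_op_eq dD_add vec_eq_iff algebra_simps matrix_vector_mult_add_rdistrib)

lemma curv_op_scale2:
  assumes "z \<in> S" shows "curv_op D z x (a *s y) e = cnj a *s curv_op D z x y e"
proof -
  have i: "\<i> *s (a *s y) = Re a *\<^sub>R (\<i> *s y) + (- Im a) *\<^sub>R y"
    by (subst complex_scale_split[of a]) (simp add: vec_eq_iff vec_scaleR_eq algebra_simps)
  show ?thesis
    unfolding curv_op_eq[OF assms] i unfolding complex_scale_split[of a y]
    unfolding dD_add[OF assms] dD_scaleR[OF assms] matrix_vector_mult_add_rdistrib matrix_vector_scaleR_left
    by (simp add: vec_eq_iff complex_eq_iff field_simps)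
qed

lemma curv_op_add3: "z \<in> S \<Longrightarrow> curv_op D z x y (e + e') = curv_op D z x y e + curv_op D z x y e'"
  by (simp add: curv_op_eq vec_eq_iff algebra_simps)

lemma curv_op_scale3: "z \<in> S \<Longrightarrow> curv_op D z x y (a *s e) = a *s curv_op D z x y e"
  by (simp add: curv_op_eq matrix_vector_scale vec_eq_iff algebra_simps)

text \<open>The second derivatives of \<open>\<langle>e, e'\<rangle>\<close> commute, and metric compatibility expresses them by covariant
  derivatives; in their difference the terms with one derivative on each factor cancel.\<close>
lemma curv_real_skew:
  assumes "z \<in> S"
  shows "herm (h z) (curv_real D z u w e) e' = - herm (h z) e (curv_real D z u w e')"
proof -
  let ?f = "\<lambda>y. herm (h y) e e'"
  have sm: "smooth_on (\<lambda>y. D y w *v e) S" for w e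
    by (intro smooth_D_apply smooth_on_const)
  have f1: "frechet_derivative ?f (at y) w =
      herm (h y) (D y w *v e) e' + herm (h y) e (D y w *v e')" if "y \<in> S" for y w
    using D_metric[OF smooth_on_const smooth_on_const that] by (simp add: cov_deriv_const)
  have f2: "frechet_derivative (\<lambda>y. frechet_derivative ?f (at y) w) (at z) u =
      herm (h z) (dD z w u *v e + D z u *v (D z w *v e)) e' + herm (h z) (D z w *v e) (D z u *v e')
      + (herm (h z) (D z u *v e) (D z w *v e') +
         herm (h z) e (dD z w u *v e' + D z u *v (D z w *v e')))" for u w
  proof -
    let ?a = "\<lambda>y. herm (h y) (D y w *v e) e'" and ?b = "\<lambda>y. herm (h y) e (D y w *v e')"
    have "(?a has_derivative frechet_derivative ?a (at z)) (at z)"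
      by (intro smooth_on_has_frechet[OF _ assms] smooth_on_herm open_S h_smooth sm smooth_on_const)
    moreover have "(?b has_derivative frechet_derivative ?b (at z)) (at z)"
      by (intro smooth_on_has_frechet[OF _ assms] smooth_on_herm open_S h_smooth sm smooth_on_const)
    ultimately have "frechet_derivative (\<lambda>y. ?a y + ?b y) (at z) =
        (\<lambda>u. frechet_derivative ?a (at z) u + frechet_derivative ?b (at z) u)"
      by (intro frechet_derivative_eqI has_derivative_add)
    moreover have "frechet_derivative (\<lambda>y. frechet_derivative ?f (at y) w) (at z) =
        frechet_derivative (\<lambda>y. ?a y + ?b y) (at z)"
      by (rule frechet_derivative_cong_open[OF open_S assms f1])
    ultimately show ?thesis
      using D_metric[OF sm smooth_on_const assms] D_metric[OF smooth_on_const sm assms]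
      by (simp add: cov_deriv_const cov_deriv_D_apply[OF assms])
  qed
  have "smooth_on ?f S"
    by (intro smooth_on_herm open_S h_smooth smooth_on_const)
  from second_derivative_symmetric[OF open_S assms this, of w u]
  show ?thesis
    unfolding f2 curv_real_eq[OF assms] by (simp add: herm_linear algebra_simps)
qed

lemma curv_real_antisym: "curv_real D z u w e = - curv_real D z w u e"
  by (simp add: curv_real_def)

text \<open>This combines skew-hermitian values on real tangent vectors with the antisymmetry of the curvature 2-form.\<close>
lemma R_hermitian:
  assumes "z \<in> S"
  shows "R z x y v w = cnj (R z y x w v)"
proof -
  let ?K = "curv_real D z"
  have 1: "cnj (R z y x w v) = herm (h z) v (curv_op D z y x w)"
    using h_sym[OF assms] by metis
  have "R z x y v w = (1/4) * (herm (h z) (?K x y v) w + \<i> * herm (h z) (?K x (\<i> *s y) v) w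
      - \<i> * herm (h z) (?K (\<i> *s x) y v) w + herm (h z) (?K (\<i> *s x) (\<i> *s y) v) w)"
    unfolding curv_op_def at_10_def at_01_def by (simp add: herm_linear algebra_simps)
  also have "\<dots> = (1/4) * (- herm (h z) v (?K x y w) - \<i> * herm (h z) v (?K x (\<i> *s y) w)
      + \<i> * herm (h z) v (?K (\<i> *s x) y w) - herm (h z) v (?K (\<i> *s x) (\<i> *s y) w))"
    by (simp only: curv_real_skew[OF assms, of _ _ v w]) simp
  also have "\<dots> = (1/4) * (herm (h z) v (?K y x w) + \<i> * herm (h z) v (?K (\<i> *s y) x w)
      - \<i> * herm (h z) v (?K y (\<i> *s x) w) + herm (h z) v (?K (\<i> *s y) (\<i> *s x) w))"
    unfolding curv_real_antisym[of z x] curv_real_antisym[of z "\<i> *s x"] herm_minus_right by simp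
  also have "\<dots> = herm (h z) v (curv_op D z y x w)"
    unfolding curv_op_def at_10_def at_01_def by (simp add: herm_linear algebra_simps)
  finally show ?thesis using 1 by simp
qed

end

section \<open>A second order normal frame along a complex line\<close>

text \<open>The matrix \<open>I + t B + t\<^sup>2 C\<close> applied to \<open>y\<close>: a holomorphic frame along a complex line with parameter
  \<open>t\<close>. Degree two suffices to normalise the metric up to second order.\<close>
definition frame :: "complex ^ 'n ^ 'n \<Rightarrow> complex ^ 'n ^ 'n \<Rightarrow> complex \<Rightarrow> complex ^ 'n \<Rightarrow> complex ^ 'n" where
  "frame B C t y = y + t *s (B *v y) + t\<^sup>2 *s (C *v y)"

lemma open_imp_translate_ball:
  fixes S :: "'v::real_normed_vector set"
  assumes "open S" "z \<in> S"
  shows "\<exists>d>0. \<forall>x. norm x < d \<longrightarrow> z + x \<in> S"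
proof -
  obtain d where "d > 0" "ball z d \<subseteq> S" using openE[OF assms] .
  then show ?thesis
    by (intro exI[of _ d]) (auto simp: subset_iff mem_ball dist_norm)
qed

context chern_chart
begin

lemma D_complex_line:
  assumes "z \<in> S"
  shows "dD z v (t *s w) *v y = of_real (Re t) *s (dD z v w *v y) + of_real (Im t) *s (dD z v (\<i> *s w) *v y)"
  unfolding complex_scale_split[of t] dD_add[OF assms] dD_scaleR[OF assms]
  by (simp add: matrix_vector_mult_add_rdistrib matrix_vector_scaleR_left)

text \<open>The section \<open>s_y\<close> with constant coefficients \<open>y\<close> in the frame is chosen with \<open>\<nabla>_v s_y = 0\<close> and
  \<open>\<nabla>_v \<nabla>_v s_y = - R(v, \<bar>v) y\<close> at \<open>z\<close>; the curvature identity then gives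
  \<open>\<nabla>_u \<nabla>_v s_y = - \<bar>t R(v, \<bar>v) y\<close> for \<open>u = t v\<close> with complex \<open>t\<close>. So the first derivatives of
  \<open>\<langle>s_y, s_y'\<rangle> + |t|\<^sup>2 R(v, \<bar>v, y, \<bar>y')\<close> along the line are \<open>o(|t|)\<close>, and integrating along a ray gives
  the expansion. As there are no terms in \<open>t\<close> or \<open>t\<^sup>2\<close> alone, the metric is compared with its value
  at \<open>z\<close> in all directions of \<open>t\<close> at once; this is what dual norms require.\<close>
lemma normal_frame:
  assumes z: "z \<in> S" and v: "v \<noteq> 0"
  obtains B C where "\<And>y y'. ((\<lambda>t. (herm (h (z + t *s v)) (frame B C t y) (frame B C t y') - herm (h z) y y'
      + of_real ((norm t)\<^sup>2) * R z v v y y') / of_real ((norm t)\<^sup>2)) \<longlongrightarrow> 0) (at 0)"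
proof
  \<comment> \<open>\<open>B\<close> makes \<open>\<nabla>_v s_y\<close> vanish at \<open>z\<close>; \<open>C\<close> solves \<open>\<nabla>_v \<nabla>_v s_y = - R(v, \<bar>v) y\<close>.\<close>
  define B where "B = - D z v"
  define C where "C = (\<chi> k l. (1/4) * (\<i> * dD z v (\<i> *s v) $ k $ l - dD z v v $ k $ l) + (1/2) * (D z v ** D z v) $ k $ l)"
  have Bv: "B *v y = - (D z v *v y)" for y
    by (simp add: B_def matrix_vector_mult_def vec_eq_iff sum_negf)
  have Cv: "C *v y = (1/4) *s (\<i> *s (dD z v (\<i> *s v) *v y) - dD z v v *v y) + (1/2) *s (D z v *v (D z v *v y))" for y
    by (simp add: C_def matrix_vector_mul_assoc)
      (simp add: matrix_vector_mult_def vec_eq_iff algebra_simps sum.distrib sum_subtractf sum_distrib_left sum_divide_distrib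
        diff_divide_distrib)
  obtain i where i: "v $ i \<noteq> 0" using v by (auto simp: vec_eq_iff)
  \<comment> \<open>A complex linear functional with \<open>l v = 1\<close>: it extends the parameter \<open>t\<close> of the line, and with it the
    frame, to all of \<open>S\<close>, where covariant derivatives are defined.\<close>
  define l where "l x = x $ i / v $ i" for x :: "complex ^ 'n"
  have bl: "bounded_linear l"
    unfolding l_def by (intro bounded_linear_divide bounded_linear_compose[OF _ bounded_linear_vec_nth]
        bounded_linear_ident bounded_linear_vec_nth bounded_linear_mult_left[THEN bounded_linear_compose])

  have lv: "l (t *s v) = t" for t using i by (simp add: l_def)
  have l0: "l 0 = 0" by (simp add: l_def)
  define s where "s y x = frame B C (l (x - z)) y" for y x
  \<comment> \<open>\<open>\<sigma> y\<close> is \<open>\<nabla>_v s_y\<close>.\<close>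
  define \<sigma> where "\<sigma> y x = B *v y + (2 * l (x - z)) *s (C *v y) + D x v *v s y x" for y x
  have ls: "l (z + w - z) = l w" for w by simp
  have l_smooth: "smooth_on (\<lambda>x. l (x - z)) S"
  proof -
    have "smooth_on (\<lambda>x. l x + (- l z)) S"
      by (intro smooth_on_add open_S smooth_on_bounded_linear[OF bl] smooth_on_const)
    then show ?thesis by (simp add: linear_diff[OF bounded_linear.linear[OF bl]])
  qed
  have s_smooth: "smooth_on (s y) S" for y
    unfolding s_def frame_def power2_eq_square
    by (intro smooth_on_add open_S smooth_on_const smooth_on_bilinear[OF bounded_bilinear_scale]
        smooth_on_bilinear[OF bounded_bilinear_mult] l_smooth)
  have ld: "((\<lambda>x. l (x - z)) has_derivative l) (at x)" for x
    by (intro bounded_linear.has_derivative[OF bl, THEN has_derivative_eq_rhs])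
      (auto intro!: derivative_eq_intros)
  have s_deriv: "(s y has_derivative (\<lambda>u. l u *s (B *v y) + (2 * l (x - z) * l u) *s (C *v y))) (at x)" for y x
  proof -
    have q: "((\<lambda>x. (l (x - z))\<^sup>2) has_derivative (\<lambda>u. 2 * l (x - z) * l u)) (at x)"
      by (rule has_derivative_eq_rhs[OF has_derivative_power[OF ld]]) (simp add: mult_ac)
    have "((\<lambda>x. y + l (x - z) *s (B *v y) + (l (x - z))\<^sup>2 *s (C *v y)) has_derivative
       (\<lambda>u. 0 + l u *s (B *v y) + (2 * l (x - z) * l u) *s (C *v y))) (at x)"
      using bounded_bilinear.FDERIV[OF bounded_bilinear_scale ld has_derivative_const[of "B *v y"]]
        bounded_bilinear.FDERIV[OF bounded_bilinear_scale q has_derivative_const[of "C *v y"]]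
      by (intro has_derivative_add has_derivative_const) simp_all
    then show ?thesis unfolding s_def frame_def by simp
  qed
  have s_cov: "cov_deriv D (s y) x (t *s v) = t *s \<sigma> y x" if "x \<in> S" for y x t
    unfolding cov_deriv_def frechet_derivative_eqI[OF s_deriv] \<sigma>_def D_scale[OF that] lv
    by (simp add: vec_eq_iff algebra_simps)
  have \<sigma>_smooth: "smooth_on (\<sigma> y) S" for y
    by (rule smooth_on_cong[OF open_S _ smooth_cov_deriv[OF s_smooth[of y], of "1 *s v"]])
      (simp only: s_cov, simp)
  have sz: "s y z = y" for y by (simp add: s_def frame_def l0)
  have \<sigma>z: "\<sigma> y z = 0" for y by (simp add: \<sigma>_def l0 sz Bv)
  have \<sigma>_cov: "cov_deriv D (\<sigma> y) z (t *s v) = - (cnj t *s curv_op D z v v y)" for y t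
  proof -
    have 1: "((\<lambda>x. B *v y + (2 * l (x - z)) *s (C *v y)) has_derivative (\<lambda>u. 0 + (2 * l u) *s (C *v y))) (at z)"
      using bounded_bilinear.FDERIV[OF bounded_bilinear_scale has_derivative_mult_right[OF ld, of 2]
          has_derivative_const[of "C *v y"]]
      by (intro has_derivative_add has_derivative_const) simp
    have 2: "((\<lambda>x. D x v *v s y x) has_derivative (\<lambda>u. D z v *v (l u *s (B *v y)) + dD z v u *v y)) (at z)"
      using bounded_bilinear.FDERIV[OF bounded_bilinear_matrix_vector dD_has_derivative[OF z] s_deriv]
      by (simp add: l0 sz)
    have "cov_deriv D (\<sigma> y) z (t *s v) = (2 * t) *s (C *v y) + (D z v *v (t *s (B *v y)) + dD z v (t *s v) *v y)"
      unfolding cov_deriv_def \<sigma>z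
      using frechet_derivative_eqI[OF has_derivative_add[OF 1 2]] by (simp add: \<sigma>_def[abs_def] lv)
    also have "\<dots> = - (cnj t *s curv_op D z v v y)"
    proof -
      have alg: "2 * t * ((1/4) * (\<i> * b - a) + (1/2) * q) + (- (t * q) + (of_real (Re t) * a + of_real (Im t) * b))
          = cnj t * ((1/2) * (a + \<i> * b))" for a b q
        by (simp add: complex_eq_iff) algebra
      have Dm: "D z v *v (t *s - w) = - (t *s (D z v *v w))" for w
        using matrix_vector_scale[of "D z v" "- t" w] by simp
      show ?thesis
        unfolding curv_op_eq[OF z] D_complex_line[OF z, of v t v] Cv Bv Dm vec_eq_iff
        by (simp only: vector_add_component vector_smult_component vector_minus_component
            vector_uminus_component alg mult_minus_right minus_minus) blast
    qed
    finally show ?thesis .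
  qed
  \<comment> \<open>The derivative of \<open>\<langle>s_y, s_y'\<rangle>\<close> along \<open>t v\<close> is \<open>t p y y' + \<bar>t \<bar>(p y' y)\<close>.\<close>
  define p where "p y y' x = herm (h x) (\<sigma> y x) (s y' x)" for y y' x
  have p_deriv: "(p y y' has_derivative frechet_derivative (p y y') (at z)) (at z)" for y y'
    unfolding p_def by (intro smooth_on_has_frechet[OF _ z] smooth_on_herm open_S h_smooth \<sigma>_smooth s_smooth)
  have p_val: "frechet_derivative (p y y') (at z) (t *s v) = - cnj t * R z v v y y'" for y y' t
    unfolding p_def
    using D_metric[OF \<sigma>_smooth s_smooth z, of y y' "t *s v"]
    by (simp add: \<sigma>_cov \<sigma>z sz herm_linear)
  show "((\<lambda>t. (herm (h (z + t *s v)) (frame B C t y) (frame B C t y') - herm (h z) y y'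
      + of_real ((norm t)\<^sup>2) * R z v v y y') / of_real ((norm t)\<^sup>2)) \<longlongrightarrow> 0) (at 0)" for y y'
  proof (rule LIM_I)
    fix r :: real assume r: "r > 0"
    define \<eta> where "\<eta> = r / (4 * norm v)"
    have \<eta>: "\<eta> > 0" using r v by (simp add: \<eta>_def)
    obtain d1 where d1: "d1 > 0" "\<And>x. norm x < d1 \<Longrightarrow>
        norm (p y y' (z + x) - p y y' z - frechet_derivative (p y y') (at z) x) \<le> \<eta> * norm x"
      using has_derivative_small_remainder[OF p_deriv[of y y'] \<eta>] by blast
    obtain d2 where d2: "d2 > 0" "\<And>x. norm x < d2 \<Longrightarrow>
        norm (p y' y (z + x) - p y' y z - frechet_derivative (p y' y) (at z) x) \<le> \<eta> * norm x"
      using has_derivative_small_remainder[OF p_deriv[of y' y] \<eta>] by blast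
    obtain d3 where d3: "d3 > 0" "\<And>x. norm x < d3 \<Longrightarrow> z + x \<in> S"
      using open_imp_translate_ball[OF open_S z] by blast
    define \<delta> where "\<delta> = min d1 (min d2 d3) / norm v"
    have \<delta>: "\<delta> > 0" using d1 d2 d3 v by (simp add: \<delta>_def)
    have main: "norm (herm (h (z + t *s v)) (frame B C t y) (frame B C t y') - herm (h z) y y'
      + of_real ((norm t)\<^sup>2) * R z v v y y') \<le> (r / 2) * (norm t)\<^sup>2" if t: "norm t < \<delta>" for t
    proof -
      have tv: "norm (t *s v) = norm t * norm v"
        by (simp add: norm_vec_def L2_set_def norm_mult power_mult_distrib sum_distrib_left[symmetric] real_sqrt_mult)
      have tvl: "norm (t *s v) < d1" "norm (t *s v) < d2" "norm (t *s v) < d3"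
        using t v unfolding tv \<delta>_def by (auto simp: pos_less_divide_eq)
      define \<phi> where "\<phi> x = herm (h x) (s y x) (s y' x)" for x
      have \<phi>s: "smooth_on \<phi> S" unfolding \<phi>_def
        by (intro smooth_on_herm open_S h_smooth s_smooth)
      define g where "g a = \<phi> (z + a *\<^sub>R (t *s v)) + of_real (a\<^sup>2) * (of_real ((norm t)\<^sup>2) * R z v v y y')" for a :: real
      define g' where "g' a = t * p y y' (z + a *\<^sub>R (t *s v)) + cnj t * cnj (p y' y (z + a *\<^sub>R (t *s v)))
         + of_real (2 * a) * (of_real ((norm t)\<^sup>2) * R z v v y y')" for a :: real
      have "norm (g 1 - g 0) \<le> (r / 2) * (norm t)\<^sup>2"
      proof (rule mean_value_bound_01)
        fix a :: real assume a: "0 \<le> a" "a \<le> 1"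
        let ?x = "a *\<^sub>R (t *s v)"
        have xl: "norm ?x \<le> norm (t *s v)" using a by (simp add: mult_left_le_one_le)
        have xS: "z + ?x \<in> S" using xl tvl by (intro d3) linarith
        have "frechet_derivative \<phi> (at (z + ?x)) (t *s v) = t * p y y' (z + ?x) + cnj t * cnj (p y' y (z + ?x))"
          unfolding \<phi>_def D_metric[OF s_smooth s_smooth xS] s_cov[OF xS] p_def
          by (simp add: herm_linear h_sym[OF xS, of "s y (z + ?x)" "\<sigma> y' (z + ?x)"])
        then have "((\<lambda>a. \<phi> (z + a *\<^sub>R (t *s v))) has_vector_derivative
            t * p y y' (z + ?x) + cnj t * cnj (p y' y (z + ?x))) (at a)"
          using has_vector_derivative_along_segment[OF smooth_on_has_frechet[OF \<phi>s xS]] by simp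
        moreover have "((\<lambda>a. complex_of_real (a\<^sup>2)) has_vector_derivative of_real (2 * a)) (at a)"
          by (auto intro!: derivative_eq_intros simp: has_vector_derivative_def scaleR_conv_of_real)
        ultimately show "(g has_vector_derivative g' a) (at a)"
          unfolding g_def g'_def
          by (intro has_vector_derivative_add has_vector_derivative_mult_left)
        have ax: "?x = (of_real a * t) *s v" by (simp add: vec_scaleR_eq)
        have e1: "norm (p y y' (z + ?x) + cnj (of_real a * t) * R z v v y y') \<le> \<eta> * norm ?x"
          using d1(2)[of ?x] xl tvl unfolding ax p_val by (simp add: p_def \<sigma>z)
        have "norm (p y' y (z + ?x) + cnj (of_real a * t) * R z v v y' y) \<le> \<eta> * norm ?x"
          using d2(2)[of ?x] xl tvl unfolding ax p_val by (simp add: p_def \<sigma>z)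
        then have "norm (cnj (p y' y (z + ?x) + cnj (of_real a * t) * R z v v y' y)) \<le> \<eta> * norm ?x"
          by (simp only: complex_mod_cnj)
        then have e2: "norm (cnj (p y' y (z + ?x)) + (of_real a * t) * R z v v y y') \<le> \<eta> * norm ?x"
          using R_hermitian[OF z, of v v y y'] by simp
        have "g' a = t * (p y y' (z + ?x) + cnj (of_real a * t) * R z v v y y')
            + cnj t * (cnj (p y' y (z + ?x)) + (of_real a * t) * R z v v y y')"
          unfolding g'_def complex_norm_square by (simp add: algebra_simps)
        also have "norm \<dots> \<le> norm t * (\<eta> * norm ?x) + norm t * (\<eta> * norm ?x)"
          by (rule norm_triangle_le, unfold norm_mult complex_mod_cnj)
            (intro add_mono mult_left_mono e1 e2 norm_ge_zero)
        also have "\<dots> \<le> norm t * (\<eta> * norm (t *s v)) + norm t * (\<eta> * norm (t *s v))"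
          using xl \<eta> by (intro add_mono mult_left_mono) auto
        also have "\<dots> = (r / 2) * (norm t)\<^sup>2"
          unfolding tv \<eta>_def using v by (simp add: field_simps power2_eq_square)
        finally show "norm (g' a) \<le> (r / 2) * (norm t)\<^sup>2" .
      qed
      then show ?thesis
        unfolding g_def \<phi>_def by (simp add: s_def ls lv l0 frame_def algebra_simps)
    qed
    show "\<exists>s>0. \<forall>t. t \<noteq> 0 \<and> norm (t - 0) < s \<longrightarrow> norm ((herm (h (z + t *s v)) (frame B C t y) (frame B C t y') - herm (h z) y y'
      + of_real ((norm t)\<^sup>2) * R z v v y y') / of_real ((norm t)\<^sup>2) - 0) < r"
    proof (intro exI[of _ \<delta>] conjI allI impI \<delta>)
      fix t :: complex assume t: "t \<noteq> 0 \<and> norm (t - 0) < \<delta>"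
      then have n: "(norm t)\<^sup>2 > 0" by simp
      have "(r / 2) * (norm t)\<^sup>2 < r * (norm t)\<^sup>2" using r n by simp
      with main[of t] t n show "norm ((herm (h (z + t *s v)) (frame B C t y) (frame B C t y') - herm (h z) y y'
      + of_real ((norm t)\<^sup>2) * R z v v y y') / of_real ((norm t)\<^sup>2) - 0) < r"
        by (simp add: norm_divide pos_divide_less_eq norm_power)
    qed
  qed
qed

end

lemma continuous_on_herm [continuous_intros]:
  assumes "continuous_on T G" "continuous_on T s" "continuous_on T t"
  shows "continuous_on T (\<lambda>x. herm (G x) (s x) (t x))"
  unfolding herm_def by (intro continuous_intros assms)

lemma positive_form_lower_bound:
  fixes G :: "complex ^ 'n::finite ^ 'n"
  assumes pos: "\<And>v. v \<noteq> 0 \<Longrightarrow> Re (herm G v v) > 0"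
  shows "\<exists>m>0. \<forall>v. m * (norm v)\<^sup>2 \<le> Re (herm G v v)"
proof -
  have "compact (sphere (0 :: complex ^ 'n) 1)" "sphere (0 :: complex ^ 'n) 1 \<noteq> {}" by auto
  moreover have "continuous_on (sphere (0 :: complex ^ 'n) 1) (\<lambda>v. Re (herm G v v))"
    by (intro continuous_intros)
  ultimately obtain w where w: "w \<in> sphere 0 1" "\<And>v. v \<in> sphere 0 1 \<Longrightarrow> Re (herm G w w) \<le> Re (herm G v v)"
    using continuous_attains_inf[of "sphere (0 :: complex ^ 'n) 1"] by blast
  have "Re (herm G w w) * (norm v)\<^sup>2 \<le> Re (herm G v v)" for v
  proof (cases "v = 0")
    case False
    define u where "u = (1 / norm v) *\<^sub>R v"
    have u: "u \<in> sphere 0 1" using False by (simp add: u_def)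
    have v: "v = complex_of_real (norm v) *s u"
      using False by (simp add: u_def vec_scaleR_eq[symmetric])
    have "Re (herm G v v) = (norm v)\<^sup>2 * Re (herm G u u)"
      by (subst (1 2) v) (simp add: herm_linear power2_eq_square)
    then show ?thesis using w(2)[OF u] by (simp add: mult.commute mult_right_mono)
  qed simp
  moreover have "Re (herm G w w) > 0" using w by (intro pos) auto
  ultimately show ?thesis by blast
qed

lemma norm_herm_le: "norm (herm G v v) \<le> (\<Sum>k\<in>UNIV. \<Sum>l\<in>UNIV. norm (G $ k $ l)) * (norm v)\<^sup>2"
proof -
  have "norm (herm G v v) \<le> (\<Sum>k\<in>UNIV. \<Sum>l\<in>UNIV. norm (G $ k $ l * v $ k * cnj (v $ l)))"
    unfolding herm_def by (intro order_trans[OF norm_sum] sum_mono order_refl)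
  also have "\<dots> \<le> (\<Sum>k\<in>UNIV. \<Sum>l\<in>UNIV. norm (G $ k $ l) * (norm v)\<^sup>2)"
    by (intro sum_mono) (auto simp: norm_mult power2_eq_square mult.assoc
        intro!: mult_left_mono mult_mono component_le_norm_cart Finite_Cartesian_Product.norm_nth_le)
  finally show ?thesis by (simp add: sum_distrib_right)
qed

text \<open>Coefficientwise convergence of hermitian forms is made uniform over all vectors here, relative to a positive
  form: the unit sphere is compact.\<close>
lemma eventually_form_small:
  fixes Z :: "'b \<Rightarrow> complex ^ 'n::finite ^ 'n"
  assumes Z: "\<And>k l. ((\<lambda>t. Z t $ k $ l) \<longlongrightarrow> 0) F"
    and pos: "\<And>v. v \<noteq> 0 \<Longrightarrow> Re (herm G v v) > 0" and \<epsilon>: "\<epsilon> > 0"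
  shows "\<forall>\<^sub>F t in F. \<forall>y. norm (herm (Z t) y y) \<le> \<epsilon> * Re (herm G y y)"
proof -
  obtain m where m: "m > 0" "\<And>v. m * (norm v)\<^sup>2 \<le> Re (herm G v v)"
    using positive_form_lower_bound[OF pos] by blast
  have "((\<lambda>t. \<Sum>k\<in>UNIV. \<Sum>l\<in>UNIV. norm (Z t $ k $ l)) \<longlongrightarrow> (\<Sum>k\<in>(UNIV::'n set). \<Sum>l\<in>(UNIV::'n set). norm (0::complex))) F"
    by (intro tendsto_sum tendsto_norm Z)
  then have "\<forall>\<^sub>F t in F. (\<Sum>k\<in>UNIV. \<Sum>l\<in>UNIV. norm (Z t $ k $ l)) < \<epsilon> * m"
    using m \<epsilon> by (auto elim!: order_tendstoD(2))
  then show ?thesis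
  proof eventually_elim
    case (elim t)
    show ?case
    proof
      fix y
      have "norm (herm (Z t) y y) \<le> (\<epsilon> * m) * (norm y)\<^sup>2"
        using order_trans[OF norm_herm_le mult_right_mono[OF less_imp_le[OF elim]]] by simp
      also have "\<dots> \<le> \<epsilon> * Re (herm G y y)"
        using m(2)[of y] \<epsilon> by (simp add: mult.assoc)
      finally show "norm (herm (Z t) y y) \<le> \<epsilon> * Re (herm G y y)" .
    qed
  qed
qed

lemma vec_axis_expansion: "(y :: complex ^ 'n::finite) = (\<Sum>k\<in>UNIV. y $ k *s axis k 1)"
  by (simp add: vec_eq_iff axis_def if_distrib cong: if_cong)

lemma sesquilinear_expand:
  fixes f :: "complex ^ 'n::finite \<Rightarrow> complex ^ 'n \<Rightarrow> complex"
  assumes "\<And>x x' y. f (x + x') y = f x y + f x' y" "\<And>a x y. f (a *s x) y = a * f x y"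
    and "\<And>x y y'. f x (y + y') = f x y + f x y'" "\<And>a x y. f x (a *s y) = cnj a * f x y"
  shows "f x y = herm (\<chi> k l. f (axis k 1) (axis l 1)) x y"
proof -
  have z1: "f 0 y = 0" for y using assms(2)[of 0 0 y] by simp
  have z2: "f x 0 = 0" for x using assms(4)[of x 0 0] by simp
  have 1: "f (\<Sum>k\<in>A. g k) y = (\<Sum>k\<in>A. f (g k) y)" if "finite A" for A :: "'n set" and g y
    using that by (induction A) (auto simp: z1 assms(1))
  have 2: "f x (\<Sum>k\<in>A. g k) = (\<Sum>k\<in>A. f x (g k))" if "finite A" for A :: "'n set" and g x
    using that by (induction A) (auto simp: z2 assms(3))
  have "f x y = f (\<Sum>k\<in>UNIV. x $ k *s axis k 1) (\<Sum>l\<in>UNIV. y $ l *s axis l 1)"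
    using vec_axis_expansion[of x] vec_axis_expansion[of y] by simp
  also have "\<dots> = herm (\<chi> k l. f (axis k 1) (axis l 1)) x y"
    unfolding 1[OF finite] 2[OF finite] assms(2,4) herm_def
    by (simp add: sum_distrib_left mult_ac) (rule sum.swap)
  finally show ?thesis .
qed

lemma frame_add: "frame B C t (x + y) = frame B C t x + frame B C t y"
  by (simp add: frame_def matrix_vector_right_distrib vec_eq_iff algebra_simps)

lemma frame_scale: "frame B C t (a *s y) = a *s frame B C t y"
  by (simp add: frame_def matrix_vector_scale vec_eq_iff algebra_simps)

lemma frame_0 [simp]: "frame B C 0 y = y"
  by (simp add: frame_def)

lemma frame_linear: "linear (frame B C t)"
  by (auto intro!: linearI simp: frame_add frame_scale vec_scaleR_eq)

lemma tendsto_norm_sq_divide: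
  assumes "(g \<longlongrightarrow> L) (at 0)"
  shows "((\<lambda>t. t ^ 3 * g t / of_real ((norm t)\<^sup>2)) \<longlongrightarrow> 0) (at (0::complex))"
proof (rule Lim_null_comparison)
  show "\<forall>\<^sub>F t in at 0. norm (t ^ 3 * g t / of_real ((norm t)\<^sup>2)) \<le> norm (t * g t)"
    by (intro always_eventually allI)
      (simp add: norm_mult norm_divide norm_power power2_eq_square power3_eq_cube)
  have "((\<lambda>t. t * g t) \<longlongrightarrow> 0 * L) (at 0)"
    by (intro tendsto_mult assms tendsto_ident_at)
  then show "((\<lambda>t. norm (t * g t)) \<longlongrightarrow> 0) (at 0)"
    using tendsto_norm_zero by auto
qed

text \<open>The polynomial \<open>I - t B + t\<^sup>2 (B\<^sup>2 - C)\<close> inverts \<open>I + t B + t\<^sup>2 C\<close> up to \<open>O(t\<^sup>3)\<close>. Covectors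
  transported by it are holomorphic in \<open>t\<close>, and the error is negligible against the terms of order
  \<open>|t|\<^sup>2\<close> that carry the curvature.\<close>
lemma frame_approximate_inverse:
  fixes G B C :: "complex ^ 'n::finite ^ 'n"
  assumes pos: "\<And>v. v \<noteq> 0 \<Longrightarrow> Re (herm G v v) > 0" and \<epsilon>: "\<epsilon> > 0"
  defines "B' \<equiv> - B" and "C' \<equiv> B ** B - C"
  shows "\<forall>\<^sub>F t in at 0. \<forall>y. Re (herm G (frame B' C' t (frame B C t y)) (frame B' C' t (frame B C t y)))
     \<le> exp (\<epsilon> * (norm t)\<^sup>2) * Re (herm G y y)"
proof -
  \<comment> \<open>The composite of the two frames is \<open>y + t\<^sup>3 w t y\<close>.\<close>
  define w where "w t y = (C' *v (B *v y) - B *v (C *v y)) + t *s (C' *v (C *v y))" for t y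
  have B'v: "B' *v y = - (B *v y)" for y
    unfolding B'_def by (simp add: matrix_vector_mult_def vec_eq_iff sum_negf)
  have C'v: "C' *v y = B *v (B *v y) - C *v y" for y
    unfolding C'_def by (simp add: matrix_vector_mul_assoc matrix_vector_mult_diff_rdistrib)
  have AE: "frame B' C' t (frame B C t y) = y + t ^ 3 *s w t y" for t y
    unfolding frame_def w_def matrix_vector_right_distrib matrix_vector_scale B'v C'v
      matrix_vector_mult_diff_distrib
    by (simp add: vec_eq_iff power2_eq_square power3_eq_cube algebra_simps)
  have w_add: "w t (x + y) = w t x + w t y" for t x y
    unfolding w_def by (simp add: matrix_vector_right_distrib vec_eq_iff algebra_simps)
  have w_scale: "w t (a *s x) = a *s w t x" for t x a
    unfolding w_def by (simp add: matrix_vector_scale vec_eq_iff algebra_simps)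
  define f where "f t x y = (t ^ 3 * herm G (w t x) y + cnj (t ^ 3) * herm G x (w t y)
      + t ^ 3 * (cnj (t ^ 3) * herm G (w t x) (w t y))) / of_real ((norm t)\<^sup>2)" for t x y
  define Z where "Z t = (\<chi> k l. f t (axis k 1) (axis l 1))" for t
  have fZ: "f t x y = herm (Z t) x y" for t x y
    unfolding Z_def
    by (rule sesquilinear_expand)
      (simp_all add: f_def w_add w_scale herm_linear add_divide_distrib algebra_simps)
  have "((\<lambda>t. f t x y) \<longlongrightarrow> 0) (at 0)" for x y
  proof -
    have wl: "((\<lambda>t. w t x) \<longlongrightarrow> w 0 x) (at 0)" for x
      unfolding w_def by (intro vec_tendstoI) (auto intro!: tendsto_eq_intros)
    have hl: "((\<lambda>t. herm G (a t) (b t)) \<longlongrightarrow> herm G a0 b0) (at 0)"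
      if "(a \<longlongrightarrow> a0) (at 0)" "(b \<longlongrightarrow> b0) (at 0)" for a b :: "complex \<Rightarrow> complex ^ 'n" and a0 b0
      unfolding herm_def by (intro tendsto_intros that)
    have 1: "((\<lambda>t. t ^ 3 * herm G (w t x) y / of_real ((norm t)\<^sup>2)) \<longlongrightarrow> 0) (at 0)"
      by (rule tendsto_norm_sq_divide[OF hl[OF wl tendsto_const]])
    have "((\<lambda>t. t ^ 3 * cnj (herm G x (w t y)) / of_real ((norm t)\<^sup>2)) \<longlongrightarrow> 0) (at 0)"
      by (rule tendsto_norm_sq_divide[OF tendsto_cnj[OF hl[OF tendsto_const wl]]])
    from tendsto_cnj[OF this]
    have 2: "((\<lambda>t. cnj (t ^ 3) * herm G x (w t y) / of_real ((norm t)\<^sup>2)) \<longlongrightarrow> 0) (at 0)" by simp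
    have 3: "((\<lambda>t. t ^ 3 * (cnj (t ^ 3) * herm G (w t x) (w t y)) / of_real ((norm t)\<^sup>2)) \<longlongrightarrow> 0) (at 0)"
      by (rule tendsto_norm_sq_divide[where L = "cnj (0 ^ 3) * herm G (w 0 x) (w 0 y)"])
        (intro tendsto_intros hl wl)
    show ?thesis
      using tendsto_add[OF tendsto_add[OF 1 2] 3] by (simp add: f_def add_divide_distrib)
  qed
  then have "\<forall>\<^sub>F t in at 0. \<forall>y. norm (herm (Z t) y y) \<le> \<epsilon> * Re (herm G y y)"
    by (intro eventually_form_small pos \<epsilon>) (auto simp: Z_def)
  moreover have "\<forall>\<^sub>F t in at (0::complex). t \<noteq> 0" by (simp add: eventually_at_filter)
  ultimately show ?thesis
  proof eventually_elim
    case (elim t)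
    have n: "(norm t)\<^sup>2 > 0" using elim(2) by simp
    show ?case
    proof
      fix y
      have "herm G (frame B' C' t (frame B C t y)) (frame B' C' t (frame B C t y))
          = herm G y y + of_real ((norm t)\<^sup>2) * f t y y"
      proof -
        have "of_real ((norm t)\<^sup>2) * f t y y = t ^ 3 * herm G (w t y) y + cnj (t ^ 3) * herm G y (w t y)
            + t ^ 3 * (cnj (t ^ 3) * herm G (w t y) (w t y))"
          unfolding f_def using elim(2) by simp
        then show ?thesis unfolding AE by (simp add: herm_linear algebra_simps)
      qed
      then have "Re (herm G (frame B' C' t (frame B C t y)) (frame B' C' t (frame B C t y)))
          = Re (herm G y y) + (norm t)\<^sup>2 * Re (herm (Z t) y y)"
        by (simp add: fZ del: of_real_power)
      also have "\<dots> \<le> Re (herm G y y) + (norm t)\<^sup>2 * (\<epsilon> * Re (herm G y y))"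
        using elim(1) complex_Re_le_cmod[of "herm (Z t) y y"] n
        by (meson add_left_mono mult_left_mono order_trans less_imp_le)
      also have "\<dots> = (1 + \<epsilon> * (norm t)\<^sup>2) * Re (herm G y y)" by (simp add: algebra_simps)
      also have "\<dots> \<le> exp (\<epsilon> * (norm t)\<^sup>2) * Re (herm G y y)"
        by (intro mult_right_mono exp_ge_add_one_self) (cases "y = 0"; use pos[of y] in auto)
      finally show "Re (herm G (frame B' C' t (frame B C t y)) (frame B' C' t (frame B C t y)))
          \<le> exp (\<epsilon> * (norm t)\<^sup>2) * Re (herm G y y)" .
    qed
  qed
qed

text \<open>Exponential bounds are preferred to linear ones because they multiply exactly when several arguments of a
  tensor are estimated at once.\<close>
lemma exp_le_one_minus_small:
  fixes a b :: real
  assumes "a < b"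
  shows "\<forall>\<^sub>F t in at (0::complex). exp (- (b * (norm t)\<^sup>2)) \<le> 1 - a * (norm t)\<^sup>2"
proof -
  have l: "((\<lambda>t::complex. (norm t)\<^sup>2) \<longlongrightarrow> 0) (at 0)"
    by (auto intro!: tendsto_eq_intros)
  have "((\<lambda>t::complex. a * b * (norm t)\<^sup>2) \<longlongrightarrow> a * b * 0) (at 0)"
    "((\<lambda>t::complex. b * (norm t)\<^sup>2) \<longlongrightarrow> b * 0) (at 0)"
    by (intro tendsto_mult l tendsto_const)+
  then have "\<forall>\<^sub>F t in at (0::complex). a * b * (norm t)\<^sup>2 < b - a" "\<forall>\<^sub>F t in at (0::complex). b * (norm t)\<^sup>2 > - 1"
    using assms by (auto elim!: order_tendstoD)
  then show ?thesis
  proof eventually_elim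
    case (elim t)
    define x where "x = (norm t)\<^sup>2"
    have x: "x \<ge> 0" by (simp add: x_def)
    have p: "1 + b * x > 0" using elim(2) by (simp add: x_def)
    have "1 + b * x \<le> exp (b * x)" by simp
    then have "exp (- (b * x)) \<le> 1 / (1 + b * x)"
      using p by (simp add: exp_minus inverse_eq_divide frac_le)
    also have "1 \<le> (1 - a * x) * (1 + b * x)"
    proof -
      have "0 \<le> x * ((b - a) - a * b * x)" using x elim(1) by (simp add: x_def)
      then show ?thesis by (simp add: algebra_simps)
    qed
    then have "1 / (1 + b * x) \<le> 1 - a * x" using p by (simp add: pos_divide_le_eq)
    finally show ?case by (simp add: x_def)
  qed
qed

context chern_chart
begin

lemma h_nonneg: "z \<in> S \<Longrightarrow> Re (herm (h z) y y) \<ge> 0"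
  using h_pos[of z y] by (cases "y = 0") auto

text \<open>The first estimate bounds vectors that are constant in the normal frame. The second one bounds covectors by
  duality: \<open>|\<alpha>(A u)| \<le> |\<alpha>| |A u|\<close>, where \<open>A\<close> is the approximate inverse of the frame. Every
  \<open>u\<close> is of the form \<open>E y\<close> because the lower bound for the metric makes the frame \<open>E\<close> injective.\<close>
lemma pinched_frames:
  assumes z: "z \<in> S" and v: "v \<noteq> 0"
    and lo: "\<And>w. lo * Re (herm (h z) w w) \<le> Re (R z v v w w)"
    and hi: "\<And>w. Re (R z v v w w) \<le> hi * Re (herm (h z) w w)"
    and lt: "lo' < lo" "hi < hi'"
  obtains B C B' C' where
    "\<forall>\<^sub>F t in at 0. z + t *s v \<in> S \<and>
      (\<forall>y. Re (herm (h (z + t *s v)) (frame B C t y) (frame B C t y)) \<le> exp (- (lo' * (norm t)\<^sup>2)) * Re (herm (h z) y y)) \<and>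
      (\<forall>u. Re (herm (h z) (frame B' C' t u) (frame B' C' t u)) \<le> exp (hi' * (norm t)\<^sup>2) * Re (herm (h (z + t *s v)) u u))"
proof -
  \<comment> \<open>On the upper side \<open>\<epsilon>\<close> is spent three times: on the remainder of the metric, on the passage
    to an exponential, and on the approximate inverse.\<close>
  define \<epsilon> where "\<epsilon> = min (lo - lo') ((hi' - hi) / 4)"
  have \<epsilon>: "\<epsilon> > 0" "lo' \<le> lo - \<epsilon>" "hi + 4 * \<epsilon> \<le> hi'" using lt by (auto simp: \<epsilon>_def min_def field_simps)
  from normal_frame[OF z v] obtain B C where BC:
    "\<And>y y'. ((\<lambda>t. (herm (h (z + t *s v)) (frame B C t y) (frame B C t y') - herm (h z) y y'
      + of_real ((norm t)\<^sup>2) * R z v v y y') / of_real ((norm t)\<^sup>2)) \<longlongrightarrow> 0) (at 0)"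
    by blast
  define f where "f t x y = (herm (h (z + t *s v)) (frame B C t x) (frame B C t y) - herm (h z) x y
      + of_real ((norm t)\<^sup>2) * R z v v x y) / of_real ((norm t)\<^sup>2)" for t x y
  define Z where "Z t = (\<chi> k l. f t (axis k 1) (axis l 1))" for t
  have fZ: "f t x y = herm (Z t) x y" for t x y
    unfolding Z_def
    by (rule sesquilinear_expand)
      (simp_all add: f_def frame_add frame_scale herm_linear curv_op_add3[OF z] curv_op_scale3[OF z]
        diff_divide_distrib add_divide_distrib algebra_simps)
  have "\<forall>\<^sub>F t in at 0. \<forall>y. norm (herm (Z t) y y) \<le> \<epsilon> * Re (herm (h z) y y)"
    using BC by (intro eventually_form_small h_pos[OF z] \<epsilon>) (simp add: Z_def f_def)
  moreover have "\<forall>\<^sub>F t in at (0::complex). t \<noteq> 0" by (simp add: eventually_at_filter)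
  moreover have "\<forall>\<^sub>F t in at (0::complex). z + t *s v \<in> S"
  proof -
    have "((\<lambda>t. z + t *s v) \<longlongrightarrow> z + 0 *s v) (at 0)"
      by (intro vec_tendstoI) (auto intro!: tendsto_eq_intros)
    then show ?thesis using topological_tendstoD[OF _ open_S, of _ z] z by simp
  qed
  moreover have "\<forall>\<^sub>F t in at (0::complex). exp (- ((hi + 2 * \<epsilon>) * (norm t)\<^sup>2)) \<le> 1 - (hi + \<epsilon>) * (norm t)\<^sup>2"
    using \<epsilon> by (intro exp_le_one_minus_small) auto
  moreover have "\<forall>\<^sub>F t in at 0. \<forall>y. Re (herm (h z) (frame (- B) (B ** B - C) t (frame B C t y)) (frame (- B) (B ** B - C) t (frame B C t y)))
     \<le> exp (\<epsilon> * (norm t)\<^sup>2) * Re (herm (h z) y y)"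
    by (intro frame_approximate_inverse h_pos z \<epsilon>)
  ultimately have "\<forall>\<^sub>F t in at 0. z + t *s v \<in> S \<and>
      (\<forall>y. Re (herm (h (z + t *s v)) (frame B C t y) (frame B C t y)) \<le> exp (- (lo' * (norm t)\<^sup>2)) * Re (herm (h z) y y)) \<and>
      (\<forall>u. Re (herm (h z) (frame (- B) (B ** B - C) t u) (frame (- B) (B ** B - C) t u)) \<le> exp (hi' * (norm t)\<^sup>2) * Re (herm (h (z + t *s v)) u u))"
  proof eventually_elim
    case (elim t)
    define x where "x = (norm t)\<^sup>2"
    have x: "x > 0" using elim(2) by (simp add: x_def)
    let ?g = "\<lambda>y. Re (herm (h z) y y)" and ?E = "frame B C t" and ?A = "frame (- B) (B ** B - C) t"
    let ?G = "\<lambda>u. Re (herm (h (z + t *s v)) u u)"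
    have id: "?G (?E y) = ?g y - x * Re (R z v v y y) + x * Re (f t y y)" for y
    proof -
      have "herm (h (z + t *s v)) (?E y) (?E y) = herm (h z) y y - of_real x * R z v v y y + of_real x * f t y y"
        unfolding f_def x_def using elim(2) by (simp add: field_simps)
      then show ?thesis by simp
    qed
    have fb: "\<bar>Re (f t y y)\<bar> \<le> \<epsilon> * ?g y" for y
      using elim(1) abs_Re_le_cmod[of "f t y y"] unfolding fZ by (meson order_trans)
    have up: "?G (?E y) \<le> exp (- (lo' * x)) * ?g y" for y
    proof -
      have "x * (lo * ?g y) \<le> x * Re (R z v v y y)" "x * Re (f t y y) \<le> x * (\<epsilon> * ?g y)"
        using lo[of y] fb[of y] x by (auto intro: mult_left_mono)
      then have "?G (?E y) \<le> (1 + - (x * (lo - \<epsilon>))) * ?g y"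
        unfolding id by (simp add: algebra_simps)
      also have "\<dots> \<le> exp (- (x * (lo - \<epsilon>))) * ?g y"
        by (intro mult_right_mono exp_ge_add_one_self h_nonneg z)
      also have "\<dots> \<le> exp (- (lo' * x)) * ?g y"
        using x \<epsilon>(2) by (intro mult_right_mono h_nonneg z) (simp add: mult.commute)
      finally show ?thesis .
    qed
    have down: "exp (- ((hi + 2 * \<epsilon>) * x)) * ?g y \<le> ?G (?E y)" for y
    proof -
      have "x * (- (\<epsilon> * ?g y)) \<le> x * Re (f t y y)" "x * Re (R z v v y y) \<le> x * (hi * ?g y)"
        using hi[of y] fb[of y] x mult_left_mono[of "- (\<epsilon> * ?g y)" "Re (f t y y)" x]
        by (auto intro: mult_left_mono simp: abs_le_iff)
      then have "(1 - (hi + \<epsilon>) * x) * ?g y \<le> ?G (?E y)"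
        unfolding id by (simp add: algebra_simps)
      moreover have "exp (- ((hi + 2 * \<epsilon>) * x)) * ?g y \<le> (1 - (hi + \<epsilon>) * x) * ?g y"
        using elim(4) by (intro mult_right_mono h_nonneg z) (simp add: x_def)
      ultimately show ?thesis by simp
    qed
    have "inj ?E"
    proof (rule linear_injective_0[OF frame_linear, THEN iffD2], intro allI impI)
      fix y assume "?E y = 0"
      then have "exp (- ((hi + 2 * \<epsilon>) * x)) * ?g y \<le> 0" using down[of y] by simp
      then have "?g y \<le> 0" by (simp add: mult_le_0_iff)
      then show "y = 0" using h_pos[OF z, of y] by force
    qed
    then have surj: "surj ?E" by (rule linear_inj_imp_surj[OF frame_linear])
    have "?g (?A u) \<le> exp (hi' * x) * ?G u" for u
    proof -
      obtain y where y: "u = ?E y" using surj by blast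
      have "?g y = exp ((hi + 2 * \<epsilon>) * x) * (exp (- ((hi + 2 * \<epsilon>) * x)) * ?g y)"
        by (simp add: mult_exp_exp flip: mult.assoc)
      also have "\<dots> \<le> exp ((hi + 2 * \<epsilon>) * x) * ?G u"
        using down[of y] by (simp add: y)
      finally have *: "?g y \<le> exp ((hi + 2 * \<epsilon>) * x) * ?G u" .
      have "?g (?A u) \<le> exp (\<epsilon> * x) * ?g y" using elim(5) by (simp add: y x_def)
      also have "\<dots> \<le> exp (\<epsilon> * x) * (exp ((hi + 2 * \<epsilon>) * x) * ?G u)" using * by simp
      also have "\<dots> = exp ((hi + 3 * \<epsilon>) * x) * ?G u"
        by (simp only: mult.assoc[symmetric] mult_exp_exp) (simp add: algebra_simps)
      also have "\<dots> \<le> exp (hi' * x) * ?G u"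
        using \<epsilon> x by (intro mult_right_mono h_nonneg elim(3)) auto
      finally show ?thesis .
    qed
    with up elim(3) show ?case by (simp add: x_def)
  qed
  then show ?thesis by (rule that)
qed

end

section \<open>The operator norm of a tensor\<close>

lemma finite_lists_of_length [simp]: "finite {I :: 'n::finite list. length I = p}"
  using finite_lists_length_eq[of "UNIV :: 'n set" p] by simp

text \<open>Distributivity for multi-indices; it separates the arguments in the evaluation of a tensor.\<close>
lemma sum_lists_prod:
  fixes g :: "nat \<Rightarrow> 'n::finite \<Rightarrow> 'c::comm_semiring_1"
  shows "(\<Sum>I | length I = p. \<Prod>a<p. g a (I ! a)) = (\<Prod>a<p. \<Sum>i\<in>UNIV. g a i)"
proof (induction p)
  case (Suc p)
  have "(\<Sum>I | length I = Suc p. \<Prod>a<Suc p. g a (I ! a)) =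
      (\<Sum>x\<in>{I. length I = p} \<times> UNIV. \<Prod>a<Suc p. g a ((fst x @ [snd x]) ! a))"
    by (rule sum.reindex_bij_witness[of _ "\<lambda>x. fst x @ [snd x]" "\<lambda>I. (butlast I, last I)"])
      (auto simp: append_butlast_last_id length_Suc_conv_rev)
  also have "\<dots> = (\<Sum>I | length I = p. \<Sum>i\<in>UNIV. (\<Prod>a<p. g a (I ! a)) * g p i)"
    unfolding sum.cartesian_product by (rule sum.cong) (auto simp: nth_append)
  also have "\<dots> = (\<Prod>a<Suc p. \<Sum>i\<in>UNIV. g a i)"
    by (simp only: prod.lessThan_Suc Suc.IH[symmetric] sum_product)
  finally show ?case .
qed simp

definition cpair :: "complex ^ 'n \<Rightarrow> complex ^ 'n \<Rightarrow> complex" where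
  "cpair \<alpha> u = (\<Sum>k\<in>UNIV. \<alpha> $ k * u $ k)"

lemma cpair_add_left: "cpair (\<alpha> + \<beta>) u = cpair \<alpha> u + cpair \<beta> u"
  and cpair_add_right: "cpair \<alpha> (u + w) = cpair \<alpha> u + cpair \<alpha> w"
  and cpair_scale_left: "cpair (a *s \<alpha>) u = a * cpair \<alpha> u"
  and cpair_scale_right: "cpair \<alpha> (a *s u) = a * cpair \<alpha> u"
  by (simp_all add: cpair_def algebra_simps sum.distrib sum_distrib_left)

lemma cpair_transpose: "cpair (transpose M *v \<alpha>) u = cpair \<alpha> (M *v u)"
proof -
  have "cpair (transpose M *v \<alpha>) u = (\<Sum>k\<in>UNIV. \<Sum>l\<in>UNIV. M $ l $ k * \<alpha> $ l * u $ k)"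
    by (simp add: cpair_def matrix_vector_mult_def transpose_def sum_distrib_right)
  also have "\<dots> = (\<Sum>l\<in>UNIV. \<Sum>k\<in>UNIV. M $ l $ k * \<alpha> $ l * u $ k)" by (rule sum.swap)
  also have "\<dots> = cpair \<alpha> (M *v u)"
    by (simp add: cpair_def matrix_vector_mult_def sum_distrib_left mult_ac)
  finally show ?thesis .
qed

lemma cpair_frame: "cpair (frame (transpose B) (transpose C) t \<alpha>) u = cpair \<alpha> (frame B C t u)"
  by (simp only: frame_def cpair_add_left cpair_add_right cpair_scale_left cpair_scale_right cpair_transpose)

lemma cpair_axis: "cpair \<alpha> (axis k 1) = \<alpha> $ k"
  by (simp add: cpair_def axis_def if_distrib cong: if_cong)

definition tensor_eval ::
  "nat \<Rightarrow> nat \<Rightarrow> ('n list \<Rightarrow> 'n list \<Rightarrow> complex) \<Rightarrow> (nat \<Rightarrow> complex ^ 'n) \<Rightarrow> (nat \<Rightarrow> complex ^ 'n) \<Rightarrow> complex"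
  where "tensor_eval p q T \<alpha> w =
    (\<Sum>I | length I = p. \<Sum>K | length K = q. (\<Prod>a<p. \<alpha> a $ (I ! a)) * (\<Prod>b<q. w b $ (K ! b)) * T I K)"

text \<open>The condition on the covectors says that their dual norm is at most one. It is described through the values, so
  that the inverse of \<open>G\<close> does not occur.\<close>
definition unit_args :: "nat \<Rightarrow> nat \<Rightarrow> complex ^ 'n ^ 'n \<Rightarrow> (nat \<Rightarrow> complex ^ 'n) \<Rightarrow> (nat \<Rightarrow> complex ^ 'n) \<Rightarrow> bool"
  where "unit_args p q G \<alpha> w \<longleftrightarrow>
    (\<forall>a<p. \<forall>u. (norm (cpair (\<alpha> a) u))\<^sup>2 \<le> Re (herm G u u)) \<and> (\<forall>b<q. Re (herm G (w b) (w b)) \<le> 1)"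

text \<open>The norm of \<open>T\<close> as a multilinear form. It is used in place of the Hilbert-Schmidt norm because it
  reduces every estimate to single vectors and covectors: no metric on the tensor bundle has to be
  differentiated.\<close>
definition tensor_norm :: "nat \<Rightarrow> nat \<Rightarrow> complex ^ 'n ^ 'n \<Rightarrow> ('n list \<Rightarrow> 'n list \<Rightarrow> complex) \<Rightarrow> real"
  where "tensor_norm p q G T = (SUP (\<alpha>, w) \<in> {(\<alpha>, w). unit_args p q G \<alpha> w}. norm (tensor_eval p q T \<alpha> w))"

lemma tensor_eval_scale:
  "tensor_eval p q T (\<lambda>a. c *s \<alpha> a) (\<lambda>b. d *s w b) = c ^ p * d ^ q * tensor_eval p q T \<alpha> w"
  by (simp add: tensor_eval_def prod.distrib sum_distrib_left mult_ac)

lemma tensor_eval_diff: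
  "tensor_eval p q (\<lambda>I K. T I K - T' I K) \<alpha> w = tensor_eval p q T \<alpha> w - tensor_eval p q T' \<alpha> w"
  by (simp add: tensor_eval_def algebra_simps sum_subtractf)

lemma norm_tensor_eval_le:
  fixes \<alpha> w :: "nat \<Rightarrow> complex ^ 'n::finite"
  assumes "\<And>a k. a < p \<Longrightarrow> norm (\<alpha> a $ k) \<le> L" "\<And>b k. b < q \<Longrightarrow> norm (w b $ k) \<le> L"
  shows "norm (tensor_eval p q T \<alpha> w) \<le> L ^ (p + q) * (\<Sum>I | length I = p. \<Sum>K | length K = q. norm (T I K))"
proof -
  have "norm (tensor_eval p q T \<alpha> w) \<le>
      (\<Sum>I | length I = p. \<Sum>K | length K = q. norm ((\<Prod>a<p. \<alpha> a $ (I ! a)) * (\<Prod>b<q. w b $ (K ! b)) * T I K))"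
    unfolding tensor_eval_def by (intro order_trans[OF norm_sum] sum_mono order_refl)
  also have "\<dots> \<le> (\<Sum>I | length I = p. \<Sum>K | length K = q. (L ^ p * L ^ q) * norm (T I K))"
  proof (intro sum_mono)
    fix I K :: "'n list"
    have "norm (\<Prod>a<p. \<alpha> a $ (I ! a)) \<le> (\<Prod>a<p. L)" "norm (\<Prod>b<q. w b $ (K ! b)) \<le> (\<Prod>b<q. L)"
      unfolding prod_norm[symmetric] by (intro prod_mono; use assms in simp)+
    then show "norm ((\<Prod>a<p. \<alpha> a $ (I ! a)) * (\<Prod>b<q. w b $ (K ! b)) * T I K) \<le> (L ^ p * L ^ q) * norm (T I K)"
      unfolding norm_mult by (intro mult_right_mono mult_mono) (auto intro: order_trans[OF norm_ge_zero])
  qed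
  finally show ?thesis by (simp add: power_add sum_distrib_left)
qed

lemma unit_args_bounded:
  fixes G :: "complex ^ 'n::finite ^ 'n"
  assumes pos: "\<And>v. v \<noteq> 0 \<Longrightarrow> Re (herm G v v) > 0"
  obtains L where "L > 0"
    "\<And>p q \<alpha> w a k. unit_args p q G \<alpha> w \<Longrightarrow> a < p \<Longrightarrow> norm (\<alpha> a $ k) \<le> L"
    "\<And>p q \<alpha> w b k. unit_args p q G \<alpha> w \<Longrightarrow> b < q \<Longrightarrow> norm (w b $ k) \<le> L"
proof -
  obtain m where m: "m > 0" "\<And>v. m * (norm v)\<^sup>2 \<le> Re (herm G v v)"
    using positive_form_lower_bound[OF pos] by blast
  define M where "M = (\<Sum>k\<in>(UNIV::'n set). Re (herm G (axis k 1) (axis k 1)))"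
  have ax: "Re (herm G (axis k 1) (axis k 1)) \<ge> 0" for k
    using pos[of "axis k 1"] by (cases "axis k (1::complex) = (0 :: complex ^ 'n)") auto
  have M: "Re (herm G (axis k 1) (axis k 1)) \<le> M" for k
    unfolding M_def by (rule member_le_sum) (use ax in auto)
  have M0: "M \<ge> 0" unfolding M_def by (intro sum_nonneg ax)
  define L where "L = sqrt M + 1 / sqrt m"
  show thesis
  proof
    show "L > 0" unfolding L_def using m M0 by (simp add: add_nonneg_pos)
  next
    fix p q a k and \<alpha> w :: "nat \<Rightarrow> complex ^ 'n"
    assume u: "unit_args p q G \<alpha> w" and a: "a < p"
    have "(norm (\<alpha> a $ k))\<^sup>2 \<le> M"
      using u a M[of k] unfolding unit_args_def by (metis cpair_axis order_trans)
    then have "norm (\<alpha> a $ k) \<le> sqrt M" by (rule real_le_rsqrt)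
    then show "norm (\<alpha> a $ k) \<le> L" unfolding L_def using m by (simp add: add_increasing2)
  next
    fix p q b k and \<alpha> w :: "nat \<Rightarrow> complex ^ 'n"
    assume u: "unit_args p q G \<alpha> w" and b: "b < q"
    have "m * (norm (w b))\<^sup>2 \<le> 1"
      using u b m(2)[of "w b"] unfolding unit_args_def by (meson order_trans)
    then have "(norm (w b))\<^sup>2 \<le> 1 / m" using m by (simp add: field_simps)
    then have "norm (w b) \<le> sqrt (1 / m)" by (rule real_le_rsqrt)
    then have "norm (w b $ k) \<le> 1 / sqrt m"
      using Finite_Cartesian_Product.norm_nth_le[of "w b" k] by (simp add: real_sqrt_divide)
    then show "norm (w b $ k) \<le> L" unfolding L_def using M0 by (simp add: add_increasing)
  qed
qed

lemma unit_args_zero: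
  "(\<And>v. v \<noteq> 0 \<Longrightarrow> Re (herm G v v) > 0) \<Longrightarrow> unit_args p q G (\<lambda>_. 0) (\<lambda>_. 0)"
  unfolding unit_args_def
  by (auto simp: cpair_def) (metis herm_zero(1) less_eq_real_def zero_complex.simps(1))

lemma tensor_eval_le_norm:
  fixes G :: "complex ^ 'n::finite ^ 'n"
  assumes pos: "\<And>v. v \<noteq> 0 \<Longrightarrow> Re (herm G v v) > 0" and u: "unit_args p q G \<alpha> w"
  shows "norm (tensor_eval p q T \<alpha> w) \<le> tensor_norm p q G T"
proof -
  obtain L where L: "L > 0"
    "\<And>p q \<alpha> w a k. unit_args p q G \<alpha> w \<Longrightarrow> a < p \<Longrightarrow> norm (\<alpha> a $ k) \<le> L"
    "\<And>p q \<alpha> w b k. unit_args p q G \<alpha> w \<Longrightarrow> b < q \<Longrightarrow> norm (w b $ k) \<le> L"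
    using unit_args_bounded[OF pos] by blast
  have "norm (tensor_eval p q T \<alpha> w) \<le> L ^ (p + q) * (\<Sum>I | length I = p. \<Sum>K | length K = q. norm (T I K))"
    if "unit_args p q G \<alpha> w" for \<alpha> w
    by (rule norm_tensor_eval_le) (use L that in blast)+
  then have "bdd_above ((\<lambda>(\<alpha>, w). norm (tensor_eval p q T \<alpha> w)) ` {(\<alpha>, w). unit_args p q G \<alpha> w})"
    by (intro bdd_aboveI2) auto
  from cSUP_upper[OF _ this, of "(\<alpha>, w)"] u show ?thesis unfolding tensor_norm_def by simp
qed

lemma tensor_norm_le:
  assumes pos: "\<And>v. v \<noteq> 0 \<Longrightarrow> Re (herm G v v) > 0"
    and "\<And>\<alpha> w. unit_args p q G \<alpha> w \<Longrightarrow> norm (tensor_eval p q T \<alpha> w) \<le> M"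
  shows "tensor_norm p q G T \<le> M"
  unfolding tensor_norm_def
  by (rule cSUP_least) (use unit_args_zero[OF pos] assms(2) in auto)

lemma tensor_norm_nonneg:
  assumes pos: "\<And>v. v \<noteq> 0 \<Longrightarrow> Re (herm G v v) > 0"
  shows "tensor_norm p q G T \<ge> 0"
  using tensor_eval_le_norm[OF pos unit_args_zero[OF pos], of p q T] norm_ge_zero order_trans by blast

lemma tensor_eval_le_scaled:
  fixes G :: "complex ^ 'n::finite ^ 'n"
  assumes pos: "\<And>v. v \<noteq> 0 \<Longrightarrow> Re (herm G v v) > 0" and b: "x > 0" "y > 0"
    and \<alpha>: "\<And>a u. a < p \<Longrightarrow> (norm (cpair (\<alpha> a) u))\<^sup>2 \<le> x\<^sup>2 * Re (herm G u u)"
    and w: "\<And>b. b < q \<Longrightarrow> Re (herm G (w b) (w b)) \<le> y\<^sup>2"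
  shows "norm (tensor_eval p q T \<alpha> w) \<le> x ^ p * y ^ q * tensor_norm p q G T"
proof -
  define \<alpha>' where "\<alpha>' a = complex_of_real (1 / x) *s \<alpha> a" for a
  define w' where "w' a = complex_of_real (1 / y) *s w a" for a
  have "unit_args p q G \<alpha>' w'"
    unfolding unit_args_def
  proof (intro conjI allI impI)
    show "(norm (cpair (\<alpha>' a) u))\<^sup>2 \<le> Re (herm G u u)" if "a < p" for a u
      using \<alpha>[OF that, of u] b
      by (simp add: \<alpha>'_def cpair_scale_left norm_divide power_divide pos_divide_le_eq mult.commute)
    show "Re (herm G (w' a) (w' a)) \<le> 1" if "a < q" for a
      using w[OF that] b
      by (simp add: w'_def herm_linear power2_eq_square pos_divide_le_eq mult.commute)
  qed
  then have "norm (tensor_eval p q T \<alpha>' w') \<le> tensor_norm p q G T"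
    using tensor_eval_le_norm[OF pos] by blast
  moreover have "tensor_eval p q T \<alpha> w = of_real (x ^ p * y ^ q) * tensor_eval p q T \<alpha>' w'"
    unfolding \<alpha>'_def w'_def tensor_eval_scale using b by (simp add: field_simps)
  ultimately show ?thesis using b by (simp add: norm_mult norm_power)
qed

lemma tensor_norm_zero_imp:
  fixes G :: "complex ^ 'n::finite ^ 'n"
  assumes pos: "\<And>v. v \<noteq> 0 \<Longrightarrow> Re (herm G v v) > 0" and 0: "tensor_norm p q G T = 0"
    and len: "length I = p" "length K = q"
  shows "T I K = 0"
proof -
  obtain m where m: "m > 0" "\<And>v. m * (norm v)\<^sup>2 \<le> Re (herm G v v)"
    using positive_form_lower_bound[OF pos] by blast
  define \<alpha> where "\<alpha> a = axis (I ! a) (1::complex)" for a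
  define w where "w b = axis (K ! b) (1::complex)" for b
  \<comment> \<open>Coordinate covectors and coordinate vectors have lengths at most \<open>1 / sqrt m\<close> and \<open>sqrt M\<close>, and on
    them the tensor takes its coefficients as values.\<close>
  define M where "M = 1 + (\<Sum>k\<in>(UNIV::'n set). \<bar>Re (herm G (axis k 1) (axis k 1))\<bar>)"
  have M1: "M \<ge> 1" unfolding M_def by (simp add: sum_nonneg)
  have M: "Re (herm G (axis k 1) (axis k 1)) \<le> M" for k
    unfolding M_def
    using member_le_sum[of k UNIV "\<lambda>k. \<bar>Re (herm G (axis k 1) (axis k 1))\<bar>"] by auto
  have "norm (tensor_eval p q T \<alpha> w) \<le> (1 / sqrt m) ^ p * (sqrt M) ^ q * tensor_norm p q G T"
  proof (rule tensor_eval_le_scaled[OF pos])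
    fix a u
    have "cpair (\<alpha> a) u = u $ (I ! a)"
      by (simp add: \<alpha>_def cpair_def axis_def if_distrib[of "\<lambda>x. x * _"] cong: if_cong)
    then have "(norm (cpair (\<alpha> a) u))\<^sup>2 \<le> (norm u)\<^sup>2"
      by (simp add: Finite_Cartesian_Product.norm_nth_le power_mono)
    also have "\<dots> \<le> (1 / sqrt m)\<^sup>2 * Re (herm G u u)"
      using m(1) m(2)[of u] by (simp add: power_divide field_simps)
    finally show "(norm (cpair (\<alpha> a) u))\<^sup>2 \<le> (1 / sqrt m)\<^sup>2 * Re (herm G u u)" .
  qed (use m M M1 in \<open>auto simp: w_def\<close>)
  then have z: "tensor_eval p q T \<alpha> w = 0" using 0 by simp
  have 1: "(\<Prod>a<p. \<alpha> a $ (J ! a)) = (if J = I then 1 else 0)" if "length J = p" for J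
    using that len by (auto simp: \<alpha>_def axis_def list_eq_iff_nth_eq)
  have 2: "(\<Prod>b<q. w b $ (J ! b)) = (if J = K then 1 else 0)" if "length J = q" for J
    using that len by (auto simp: w_def axis_def list_eq_iff_nth_eq)
  have "tensor_eval p q T \<alpha> w =
      (\<Sum>J | length J = p. \<Sum>L | length L = q. if J = I then (if L = K then T J L else 0) else 0)"
    unfolding tensor_eval_def by (intro sum.cong refl) (simp add: 1 2)
  also have "\<dots> = (\<Sum>J | length J = p. if J = I then T J K else 0)"
    using len by (intro sum.cong refl) (simp add: sum.delta)
  also have "\<dots> = T I K" using len by (simp add: sum.delta)
  finally show ?thesis using z by simp
qed

text \<open>Once \<open>G t\<close> is close to \<open>G0\<close>, arguments of length one for \<open>G t\<close> have length at most
  \<open>\<kappa>\<close> for \<open>G0\<close>, with \<open>\<kappa>\<close> close to one. Hence the norm grows at most by the factor \<open>\<kappa>\<^sup>p\<^sup>+\<^sup>q\<close>, up to the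
  change of the coefficients of \<open>T\<close>.\<close>
lemma tensor_norm_upper_semicontinuous:
  fixes G0 :: "complex ^ 'n::finite ^ 'n"
  assumes pos: "\<And>v. v \<noteq> 0 \<Longrightarrow> Re (herm G0 v v) > 0"
    and G: "(G \<longlongrightarrow> G0) F"
    and T: "\<And>I K. ((\<lambda>t. T t I K) \<longlongrightarrow> T0 I K) F"
    and c: "tensor_norm p q G0 T0 < c"
  shows "\<forall>\<^sub>F t in F. tensor_norm p q (G t) (T t) < c"
proof -
  obtain L where L: "L > 0"
    "\<And>p q \<alpha> w a k. unit_args p q G0 \<alpha> w \<Longrightarrow> a < p \<Longrightarrow> norm (\<alpha> a $ k) \<le> L"
    "\<And>p q \<alpha> w b k. unit_args p q G0 \<alpha> w \<Longrightarrow> b < q \<Longrightarrow> norm (w b $ k) \<le> L"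
    using unit_args_bounded[OF pos] by blast
  define e where "e t = L ^ (p + q) * (\<Sum>I | length I = p. \<Sum>K | length K = q. norm (T t I K - T0 I K))" for t
  let ?N0 = "tensor_norm p q G0 T0"
  obtain \<kappa> where \<kappa>: "\<kappa> > 1" "\<kappa> ^ (p + q) * ?N0 < c"
  proof -
    have "((\<lambda>\<kappa>. \<kappa> ^ (p + q) * ?N0) \<longlongrightarrow> 1 ^ (p + q) * ?N0) (at_right 1)"
      by (intro tendsto_intros)
    then have "\<forall>\<^sub>F \<kappa> in at_right 1. \<kappa> ^ (p + q) * ?N0 < c" using c by (auto elim!: order_tendstoD(2))
    moreover have "\<forall>\<^sub>F \<kappa> in at_right (1::real). \<kappa> > 1" by (simp add: eventually_at_right_less)
    ultimately have "\<forall>\<^sub>F \<kappa> in at_right (1::real). \<kappa> > 1 \<and> \<kappa> ^ (p + q) * ?N0 < c" by eventually_elim simp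
    then show thesis using that eventually_happens' trivial_limit_at_right_real by blast
  qed
  \<comment> \<open>Forms that differ by \<open>\<epsilon>\<close> relative to \<open>G0\<close> bound each other up to the factor
    \<open>\<kappa>\<^sup>2\<close>.\<close>
  define \<epsilon> where "\<epsilon> = min (1 - 1 / \<kappa>\<^sup>2) (\<kappa>\<^sup>2 - 1)"
  have k2: "\<kappa>\<^sup>2 > 1" using \<kappa> by (simp add: one_less_power)
  have "1 / \<kappa>\<^sup>2 < 1" using k2 by (subst divide_less_eq_1_pos) linarith+
  then have \<epsilon>: "\<epsilon> > 0" "1 + \<epsilon> \<le> \<kappa>\<^sup>2"
    using k2 unfolding \<epsilon>_def by auto
  have "\<kappa>\<^sup>2 * (1 / \<kappa>\<^sup>2) \<le> \<kappa>\<^sup>2 * (1 - \<epsilon>)"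
    unfolding \<epsilon>_def by (intro mult_left_mono) auto
  then have \<epsilon>': "1 \<le> \<kappa>\<^sup>2 * (1 - \<epsilon>)" using \<kappa> by simp
  have "((\<lambda>t. (G t - G0) $ k $ l) \<longlongrightarrow> 0) F" for k l
    using tendsto_vec_nth[OF tendsto_vec_nth[OF G, of k], of l]
    by (simp add: LIM_zero)
  then have "\<forall>\<^sub>F t in F. \<forall>y. norm (herm (G t - G0) y y) \<le> \<epsilon> * Re (herm G0 y y)"
    by (rule eventually_form_small[OF _ pos \<epsilon>(1)])
  moreover have "\<forall>\<^sub>F t in F. \<kappa> ^ (p + q) * (?N0 + e t) < c"
  proof -
    have "(e \<longlongrightarrow> L ^ (p + q) * (\<Sum>I | length (I::'n list) = p. \<Sum>K | length (K::'n list) = q. norm (0::complex))) F"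
      unfolding e_def
      by (intro tendsto_mult tendsto_const tendsto_sum tendsto_norm LIM_zero T)
    then have "((\<lambda>t. \<kappa> ^ (p + q) * (?N0 + e t)) \<longlongrightarrow> \<kappa> ^ (p + q) * (?N0 + 0)) F"
      by (intro tendsto_intros) simp
    then show ?thesis using \<kappa>(2) by (auto elim!: order_tendstoD(2))
  qed
  ultimately show ?thesis
  proof eventually_elim
    case (elim t)
    have near: "\<bar>Re (herm (G t) y y) - Re (herm G0 y y)\<bar> \<le> \<epsilon> * Re (herm G0 y y)" for y
      using elim(1)[rule_format, of y] abs_Re_le_cmod[of "herm (G t - G0) y y"] by (simp add: herm_diff_mat)
    have nn: "Re (herm G0 y y) \<ge> 0" for y using pos[of y] by (cases "y = 0") auto
    have up: "Re (herm (G t) y y) \<le> \<kappa>\<^sup>2 * Re (herm G0 y y)" for y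
    proof -
      have "Re (herm (G t) y y) \<le> (1 + \<epsilon>) * Re (herm G0 y y)" using near[of y] by (simp add: algebra_simps)
      also have "\<dots> \<le> \<kappa>\<^sup>2 * Re (herm G0 y y)" by (intro mult_right_mono \<epsilon> nn)
      finally show ?thesis .
    qed
    have down: "Re (herm G0 y y) \<le> \<kappa>\<^sup>2 * Re (herm (G t) y y)" for y
    proof -
      have "Re (herm G0 y y) \<le> \<kappa>\<^sup>2 * (1 - \<epsilon>) * Re (herm G0 y y)"
        using mult_right_mono[OF \<epsilon>' nn[of y]] by simp
      also have "\<dots> \<le> \<kappa>\<^sup>2 * Re (herm (G t) y y)"
        unfolding mult.assoc using near[of y] by (intro mult_left_mono) (auto simp: algebra_simps)
      finally show ?thesis .
    qed
    have post: "Re (herm (G t) v v) > 0" if "v \<noteq> 0" for v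
    proof -
      have "0 < \<kappa>\<^sup>2 * Re (herm (G t) v v)" using pos[OF that] down[of v] by linarith
      then show ?thesis using \<kappa> by (simp add: zero_less_mult_iff)
    qed
    have "tensor_norm p q (G t) (T t) \<le> \<kappa> ^ (p + q) * (?N0 + e t)"
    proof (rule tensor_norm_le[OF post])
      fix \<alpha> w :: "nat \<Rightarrow> complex ^ 'n" assume u: "unit_args p q (G t) \<alpha> w"
      have *: "norm (tensor_eval p q U \<alpha> w) \<le> \<kappa> ^ p * \<kappa> ^ q * tensor_norm p q G0 U" for U
      proof (rule tensor_eval_le_scaled[OF pos])
        show "(norm (cpair (\<alpha> a) y))\<^sup>2 \<le> \<kappa>\<^sup>2 * Re (herm G0 y y)" if "a < p" for a y
          using u that up[of y] unfolding unit_args_def by (meson order_trans)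
        show "Re (herm G0 (w b) (w b)) \<le> \<kappa>\<^sup>2" if "b < q" for b
        proof -
          have "\<kappa>\<^sup>2 * Re (herm (G t) (w b) (w b)) \<le> \<kappa>\<^sup>2 * 1"
            using u that unfolding unit_args_def by (intro mult_left_mono) auto
          then show ?thesis using down[of "w b"] by linarith
        qed
      qed (use \<kappa> in auto)
      have "tensor_norm p q G0 (\<lambda>I K. T t I K - T0 I K) \<le> e t"
        unfolding e_def
        by (rule tensor_norm_le[OF pos]) (assumption, rule norm_tensor_eval_le, (use L in blast)+)
      then have 1: "norm (tensor_eval p q (\<lambda>I K. T t I K - T0 I K) \<alpha> w) \<le> \<kappa> ^ (p + q) * e t"
        using order_trans[OF *] \<kappa> by (simp add: power_add mult_left_mono)
      have eq: "tensor_eval p q (T t) \<alpha> w = tensor_eval p q T0 \<alpha> w + tensor_eval p q (\<lambda>I K. T t I K - T0 I K) \<alpha> w"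
        unfolding tensor_eval_diff by simp
      show "norm (tensor_eval p q (T t) \<alpha> w) \<le> \<kappa> ^ (p + q) * (?N0 + e t)"
        using norm_triangle_ineq[of "tensor_eval p q T0 \<alpha> w" "tensor_eval p q (\<lambda>I K. T t I K - T0 I K) \<alpha> w"]
          1 *[of T0, folded power_add] unfolding eq distrib_left by linarith
    qed
    with elim(2) show ?case by simp
  qed
qed

lemma tensor_eval_transform:
  fixes J J' :: "complex ^ 'n::finite ^ 'n"
  assumes "\<And>I K. length I = p \<Longrightarrow> length K = q \<Longrightarrow> T' I K =
    (\<Sum>I' | length I' = p. \<Sum>K' | length K' = q.
      (\<Prod>a<p. J $ (I ! a) $ (I' ! a)) * (\<Prod>b<q. J' $ (K' ! b) $ (K ! b)) * T I' K')"
  shows "tensor_eval p q T' \<beta> y = tensor_eval p q T (\<lambda>a. transpose J *v \<beta> a) (\<lambda>b. J' *v y b)"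
proof -
  let ?A = "{I :: 'n list. length I = p}" and ?B = "{K :: 'n list. length K = q}"
  have 1: "(\<Prod>a<p. (transpose J *v \<beta> a) $ (I' ! a)) =
      (\<Sum>I\<in>?A. \<Prod>a<p. \<beta> a $ (I ! a) * J $ (I ! a) $ (I' ! a))" for I'
    unfolding sum_lists_prod[where g = "\<lambda>a i. \<beta> a $ i * J $ i $ (I' ! a)"]
    by (simp add: vector_matrix_mult_def mult.commute)
  have 2: "(\<Prod>b<q. (J' *v y b) $ (K' ! b)) =
      (\<Sum>K\<in>?B. \<Prod>b<q. y b $ (K ! b) * J' $ (K' ! b) $ (K ! b))" for K'
    unfolding sum_lists_prod[where g = "\<lambda>b i. y b $ i * J' $ (K' ! b) $ i"]
    by (simp add: matrix_vector_mult_def mult.commute)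
  define F where "F I K I' K' = (\<Prod>a<p. \<beta> a $ (I ! a) * J $ (I ! a) $ (I' ! a)) *
      (\<Prod>b<q. y b $ (K ! b) * J' $ (K' ! b) $ (K ! b)) * T I' K'" for I K I' K'
  have "tensor_eval p q T' \<beta> y = (\<Sum>I\<in>?A. \<Sum>K\<in>?B. \<Sum>I'\<in>?A. \<Sum>K'\<in>?B. F I K I' K')"
    unfolding tensor_eval_def F_def
    by (intro sum.cong refl)
      (simp only: assms mem_Collect_eq sum_distrib_left prod.distrib, simp only: mult_ac)
  also have "\<dots> = (\<Sum>I\<in>?A. \<Sum>I'\<in>?A. \<Sum>K\<in>?B. \<Sum>K'\<in>?B. F I K I' K')"
    by (rule sum.cong[OF refl], rule sum.swap)
  also have "\<dots> = (\<Sum>I'\<in>?A. \<Sum>I\<in>?A. \<Sum>K'\<in>?B. \<Sum>K\<in>?B. F I K I' K')"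
    by (rule trans[OF sum.swap], rule sum.cong[OF refl], rule sum.cong[OF refl], rule sum.swap)
  also have "\<dots> = (\<Sum>I'\<in>?A. \<Sum>K'\<in>?B. \<Sum>I\<in>?A. \<Sum>K\<in>?B. F I K I' K')"
    by (rule sum.cong[OF refl], rule sum.swap)
  also have "\<dots> = tensor_eval p q T (\<lambda>a. transpose J *v \<beta> a) (\<lambda>b. J' *v y b)"
    unfolding tensor_eval_def 1 2 F_def sum_product
    by (intro sum.cong refl) (simp add: sum_distrib_right)
  finally show ?thesis .
qed

text \<open>Under a change of coordinates vectors are mapped by \<open>J'\<close>, covectors by the transpose of \<open>J\<close>, and
  both maps preserve lengths. The same statement for the inverse change of coordinates gives equality.\<close>
lemma tensor_norm_transform_le:
  fixes J J' G G' :: "complex ^ 'n::finite ^ 'n"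
  assumes pos: "\<And>v. v \<noteq> 0 \<Longrightarrow> Re (herm G v v) > 0" "\<And>v. v \<noteq> 0 \<Longrightarrow> Re (herm G' v v) > 0"
    and J: "\<And>u. Re (herm G' (J *v u) (J *v u)) = Re (herm G u u)"
    and J': "\<And>y. Re (herm G (J' *v y) (J' *v y)) = Re (herm G' y y)"
    and T: "\<And>I K. length I = p \<Longrightarrow> length K = q \<Longrightarrow> T' I K =
    (\<Sum>I' | length I' = p. \<Sum>K' | length K' = q.
      (\<Prod>a<p. J $ (I ! a) $ (I' ! a)) * (\<Prod>b<q. J' $ (K' ! b) $ (K ! b)) * T I' K')"
  shows "tensor_norm p q G' T' \<le> tensor_norm p q G T"
proof (rule tensor_norm_le)
  fix \<beta> y :: "nat \<Rightarrow> complex ^ 'n" assume u: "unit_args p q G' \<beta> y"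
  have "unit_args p q G (\<lambda>a. transpose J *v \<beta> a) (\<lambda>b. J' *v y b)"
    unfolding unit_args_def cpair_transpose
  proof (intro conjI allI impI)
    show "(norm (cpair (\<beta> a) (J *v v)))\<^sup>2 \<le> Re (herm G v v)" if "a < p" for a v
      using u that J[of v] unfolding unit_args_def by metis
    show "Re (herm G (J' *v y b) (J' *v y b)) \<le> 1" if "b < q" for b
      using u that J'[of "y b"] unfolding unit_args_def by metis
  qed
  from tensor_eval_le_norm[OF pos(1) this]
  show "norm (tensor_eval p q T' \<beta> y) \<le> tensor_norm p q G T"
    using tensor_eval_transform[where T = T and T' = T', OF T] by metis
qed (use pos in auto)

section \<open>The maximum principle\<close>

lemma mv_holomorphic_along_line:
  assumes "mv_holomorphic_on f S"
  shows "(\<lambda>t. f (z + t *s v)) holomorphic_on {t. z + t *s v \<in> S}"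
  unfolding holomorphic_on_def
proof
  fix t assume "t \<in> {t. z + t *s v \<in> S}"
  then obtain f' where f': "(f has_derivative f') (at (z + t *s v))" "\<And>a w. f' (a *s w) = a * f' w"
    using assms unfolding mv_holomorphic_on_def by blast
  have "((\<lambda>t. z + t *s v) has_derivative (\<lambda>a. 0 + a *s v)) (at t)"
    using bounded_bilinear.FDERIV[OF bounded_bilinear_scale has_derivative_ident has_derivative_const[of v]]
    by (intro has_derivative_add has_derivative_const) simp
  from has_derivative_compose[OF this f'(1)]
  have "((\<lambda>t. f (z + t *s v)) has_derivative (*) (f' v)) (at t)"
    by (simp add: f'(2) mult.commute[of _ "f' v"] cong: if_cong)
  then show "(\<lambda>t. f (z + t *s v)) field_differentiable at t within {t. z + t *s v \<in> S}"
    unfolding field_differentiable_def has_field_derivative_def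
    using has_derivative_at_withinI by blast
qed

lemma frame_holomorphic: "(\<lambda>t. frame B C t y $ k) holomorphic_on U"
  unfolding frame_def by (auto intro!: holomorphic_intros)

context chern_chart
begin

text \<open>For arguments \<open>\<alpha>\<close>, \<open>w\<close> of length at most one at \<open>z\<close>, transported along the line by
  \<open>pinched_frames\<close>, the value \<open>F(t)\<close> of the tensor is holomorphic. On \<open>|t| = r\<close> it is at most
  \<open>\<rho> N\<close>, where \<open>N\<close> is the maximal norm and \<open>\<rho> < 1\<close> does not depend on the arguments; so
  \<open>|F(0)| \<le> \<rho> N\<close>, and the supremum over the arguments gives \<open>N \<le> \<rho> N\<close>.\<close>
lemma no_interior_maximum:
  assumes z: "z \<in> S" and v: "v \<noteq> 0"
    and lo: "\<And>w. lo * Re (herm (h z) w w) \<le> Re (R z v v w w)"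
    and hi: "\<And>w. Re (R z v v w w) \<le> hi * Re (herm (h z) w w)"
    and pq: "real p * hi < real q * lo"
    and T: "\<And>I K. mv_holomorphic_on (\<lambda>x. T x I K) S"
    and max: "\<And>x. x \<in> S \<Longrightarrow> tensor_norm p q (h x) (T x) \<le> tensor_norm p q (h z) (T z)"
  shows "tensor_norm p q (h z) (T z) = 0"
proof -
  let ?N = "tensor_norm p q (h z) (T z)"
  \<comment> \<open>The bounds can be relaxed by \<open>\<eta>\<close> without losing \<open>p hi < q lo\<close>.\<close>
  define \<eta> where "\<eta> = (real q * lo - real p * hi) / (real p + real q + 1)"
  have \<eta>: "\<eta> > 0" "(real p + real q) * \<eta> < real q * lo - real p * hi"
  proof -
    show "\<eta> > 0" using pq by (simp add: \<eta>_def)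
    have "(real p + real q + 1) * \<eta> = real q * lo - real p * hi" by (simp add: \<eta>_def)
    then show "(real p + real q) * \<eta> < real q * lo - real p * hi"
      using \<open>\<eta> > 0\<close> by (simp add: algebra_simps)
  qed
  define lo' hi' where "lo' = lo - \<eta>" and "hi' = hi + \<eta>"
  have lt: "lo' < lo" "hi < hi'" and pq': "real p * hi' < real q * lo'"
    using \<eta> by (auto simp: lo'_def hi'_def algebra_simps)
  obtain B C B' C' where ev: "\<forall>\<^sub>F t in at 0. z + t *s v \<in> S \<and>
      (\<forall>y. Re (herm (h (z + t *s v)) (frame B C t y) (frame B C t y)) \<le> exp (- (lo' * (norm t)\<^sup>2)) * Re (herm (h z) y y)) \<and>
      (\<forall>u. Re (herm (h z) (frame B' C' t u) (frame B' C' t u)) \<le> exp (hi' * (norm t)\<^sup>2) * Re (herm (h (z + t *s v)) u u))"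
    using pinched_frames[OF z v lo hi lt] by blast
  obtain d where d: "d > 0" and fr: "\<And>t. t \<noteq> 0 \<Longrightarrow> norm t < d \<Longrightarrow> z + t *s v \<in> S \<and>
      (\<forall>y. Re (herm (h (z + t *s v)) (frame B C t y) (frame B C t y)) \<le> exp (- (lo' * (norm t)\<^sup>2)) * Re (herm (h z) y y)) \<and>
      (\<forall>u. Re (herm (h z) (frame B' C' t u) (frame B' C' t u)) \<le> exp (hi' * (norm t)\<^sup>2) * Re (herm (h (z + t *s v)) u u))"
    using ev unfolding eventually_at by (auto simp: dist_norm)
  define r where "r = d / 2"
  have r: "0 < r" "r < d" using d by (auto simp: r_def)
  define \<rho> where "\<rho> = exp ((real p * hi' - real q * lo') * r\<^sup>2 / 2)"
  have \<rho>: "\<rho> < 1" using pq' r by (simp add: \<rho>_def mult_neg_pos)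
  have inS: "z + t *s v \<in> S" if "norm t < d" for t
    using fr[of t] z that by (cases "t = 0") auto
  have "?N \<le> \<rho> * ?N"
  proof (rule tensor_norm_le)
    show "\<And>y. y \<noteq> 0 \<Longrightarrow> Re (herm (h z) y y) > 0" by (rule h_pos[OF z])
    fix \<alpha> w assume u: "unit_args p q (h z) \<alpha> w"
    define F where "F t = tensor_eval p q (T (z + t *s v))
        (\<lambda>a. frame (transpose B') (transpose C') t (\<alpha> a)) (\<lambda>b. frame B C t (w b))" for t
    have hol: "F holomorphic_on ball 0 d"
    proof -
      have "(\<lambda>t. T (z + t *s v) I K) holomorphic_on ball 0 d" for I K
        by (rule holomorphic_on_subset[OF mv_holomorphic_along_line[OF T]]) (auto intro!: inS)
      then show ?thesis
        unfolding F_def tensor_eval_def by (intro holomorphic_intros frame_holomorphic)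
    qed
    have "norm (F 0) \<le> \<rho> * ?N"
    proof (rule maximum_modulus_frontier[of F "ball 0 r"])
      show "F holomorphic_on interior (ball 0 r)"
        by (rule holomorphic_on_subset[OF hol]) (use r in auto)
      show "continuous_on (closure (ball 0 r)) F"
        by (rule continuous_on_subset[OF holomorphic_on_imp_continuous_on[OF hol]]) (use r in auto)
      fix t :: complex assume "t \<in> frontier (ball 0 r)"
      then have t: "norm t = r" using r by simp
      then have t': "t \<noteq> 0" "norm t < d" using r by auto
      note f = fr[OF t']
      have "norm (F t) \<le> exp (hi' * r\<^sup>2 / 2) ^ p * exp (- (lo' * r\<^sup>2) / 2) ^ q *
          tensor_norm p q (h (z + t *s v)) (T (z + t *s v))"
        unfolding F_def
      proof (rule tensor_eval_le_scaled)
        show "\<And>y. y \<noteq> 0 \<Longrightarrow> Re (herm (h (z + t *s v)) y y) > 0" using h_pos f by blast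
        show "(norm (cpair (frame (transpose B') (transpose C') t (\<alpha> a)) x))\<^sup>2
            \<le> (exp (hi' * r\<^sup>2 / 2))\<^sup>2 * Re (herm (h (z + t *s v)) x x)" if "a < p" for a x
        proof -
          have "(norm (cpair (\<alpha> a) (frame B' C' t x)))\<^sup>2 \<le> Re (herm (h z) (frame B' C' t x) (frame B' C' t x))"
            using u that unfolding unit_args_def by blast
          also have "\<dots> \<le> exp (hi' * r\<^sup>2) * Re (herm (h (z + t *s v)) x x)"
            using f t by auto
          finally show ?thesis unfolding cpair_frame by (simp flip: exp_double)
        qed
        show "Re (herm (h (z + t *s v)) (frame B C t (w b)) (frame B C t (w b))) \<le> (exp (- (lo' * r\<^sup>2) / 2))\<^sup>2"
          if "b < q" for b
        proof -
          have "Re (herm (h (z + t *s v)) (frame B C t (w b)) (frame B C t (w b))) \<le> exp (- (lo' * r\<^sup>2)) * Re (herm (h z) (w b) (w b))"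
            using f t by auto
          also have "\<dots> \<le> exp (- (lo' * r\<^sup>2)) * 1"
            using u that unfolding unit_args_def by (intro mult_left_mono) auto
          finally show ?thesis by (simp flip: exp_double)
        qed
      qed auto
      also have "exp (hi' * r\<^sup>2 / 2) ^ p * exp (- (lo' * r\<^sup>2) / 2) ^ q = \<rho>"
        unfolding \<rho>_def exp_of_nat_mult[symmetric] mult_exp_exp by (simp add: algebra_simps diff_divide_distrib)
      also have "\<rho> * tensor_norm p q (h (z + t *s v)) (T (z + t *s v)) \<le> \<rho> * ?N"
        by (intro mult_left_mono max) (use f in \<open>auto simp: \<rho>_def\<close>)
      finally show "norm (F t) \<le> \<rho> * ?N" .
    qed (use r in auto)
    then show "norm (tensor_eval p q (T z) \<alpha> w) \<le> \<rho> * ?N" by (simp add: F_def)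
  qed
  moreover have "?N \<ge> 0" by (intro tensor_norm_nonneg h_pos[OF z])
  ultimately show ?thesis using \<rho> by (smt (verit) mult_le_cancel_right1)
qed

section \<open>Pinching of the curvature\<close>

lemma R_add:
  assumes "z \<in> S"
  shows "R z (x + x') y v w = R z x y v w + R z x' y v w" "R z x (y + y') v w = R z x y v w + R z x y' v w"
    "R z x y (v + v') w = R z x y v w + R z x y v' w" "R z x y v (w + w') = R z x y v w + R z x y v w'"
  by (simp_all add: curv_op_add1[OF assms] curv_op_add2[OF assms] curv_op_add3[OF assms] herm_linear)

lemma R_scale:
  assumes "z \<in> S"
  shows "R z (a *s x) y v w = a * R z x y v w" "R z x (a *s y) v w = cnj a * R z x y v w"
    "R z x y (a *s v) w = a * R z x y v w" "R z x y v (a *s w) = cnj a * R z x y v w"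
  by (simp_all add: curv_op_scale1[OF assms] curv_op_scale2[OF assms] curv_op_scale3[OF assms] herm_linear)

text \<open>Compare \<open>v\<close> with \<open>v + a w\<close> for the four values \<open>a = \<plusminus>s, \<plusminus>\<i> s\<close>. Averaging over them
  leaves in \<open>R(v + a w, \<dots>)\<close> only the terms with equally many factors \<open>a\<close> and \<open>\<bar>a\<close>; by the
  Kaehler symmetries all four terms of order \<open>s\<^sup>2\<close> have the same real part
  \<open>R(v, \<bar>v, w, \<bar>w)\<close>. Dividing the extremality inequality by \<open>s\<^sup>2\<close> and letting
  \<open>s\<close> tend to \<open>0\<close> gives the bound. The sign of the curvature is carried by \<open>\<sigma>\<close>.\<close>
lemma extremal_direction_pinching:
  assumes z: "z \<in> S" and ckl: "\<And>x y v w. R z x y v w = R z v y x w"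
    and \<mu>: "\<And>u. \<mu> * (Re (herm (h z) u u))\<^sup>2 \<le> \<sigma> * Re (R z u u u u)" "\<mu> > 0"
    and v: "Re (herm (h z) v v) = 1" "\<sigma> * Re (R z v v v v) = \<mu>"
  shows "\<mu> / 2 * Re (herm (h z) w w) \<le> \<sigma> * Re (R z v v w w)"
proof -
  let ?h = "\<lambda>x y. herm (h z) x y" and ?R = "\<lambda>x y v w. R z x y v w"
  have sym: "Re (?R w w v v) = Re (?R v v w w)" "Re (?R w v v w) = Re (?R v v w w)" "Re (?R v w w v) = Re (?R v v w w)"
  proof -
    show "Re (?R w v v w) = Re (?R v v w w)" using ckl[of w v v w] by simp
    moreover have "Re (?R v w w v) = Re (?R w v v w)" using R_hermitian[OF z, of v w w v] by simp
    ultimately show "Re (?R v w w v) = Re (?R v v w w)" by simp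
    then show "Re (?R w w v v) = Re (?R v v w w)" using ckl[of w w v v] by simp
  qed
  have "2 * \<mu> * Re (?h w w) \<le> 4 * (\<sigma> * Re (?R v v w w)) + s\<^sup>2 * (\<sigma> * Re (?R w w w w))" if s: "s > 0" for s :: real
  proof -
    define f where "f a = v + a *s w" for a
    define r where "r a = Re (?R (f a) (f a) (f a) (f a))" for a
    define g where "g a = Re (?h (f a) (f a))" for a
    let ?s = "complex_of_real s"
    have rsum: "r ?s + r (- ?s) + r (\<i> * ?s) + r (- \<i> * ?s) =
        4 * Re (?R v v v v) + 16 * s\<^sup>2 * Re (?R v v w w) + 4 * s ^ 4 * Re (?R w w w w)"
    proof -
      have "?R (f ?s) (f ?s) (f ?s) (f ?s) + ?R (f (- ?s)) (f (- ?s)) (f (- ?s)) (f (- ?s))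
          + ?R (f (\<i> * ?s)) (f (\<i> * ?s)) (f (\<i> * ?s)) (f (\<i> * ?s))
          + ?R (f (- \<i> * ?s)) (f (- \<i> * ?s)) (f (- \<i> * ?s)) (f (- \<i> * ?s)) =
          4 * ?R v v v v + 4 * of_real (s\<^sup>2) * (?R w w v v + ?R w v v w + ?R v w w v + ?R v v w w)
            + 4 * of_real (s ^ 4) * ?R w w w w"
        unfolding f_def R_add[OF z] R_scale[OF z]
        by (simp add: algebra_simps power2_eq_square power4_eq_xxxx)
      from arg_cong[OF this, of Re] show ?thesis unfolding r_def by (simp add: sym algebra_simps)
    qed
    have gsum: "4 * (1 + 2 * s\<^sup>2 * Re (?h w w)) \<le> (g ?s)\<^sup>2 + (g (- ?s))\<^sup>2 + (g (\<i> * ?s))\<^sup>2 + (g (- \<i> * ?s))\<^sup>2"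
    proof -
      \<comment> \<open>\<open>|v + a w|\<^sup>2\<close> is \<open>A\<close> plus a term that is odd in \<open>a\<close>, so the squares add up to at least
        \<open>4 A\<^sup>2\<close>.\<close>
      define A where "A = 1 + s\<^sup>2 * Re (?h w w)"
      define x y where "x = s * (Re (?h v w) + Re (?h w v))" and "y = s * (Im (?h v w) - Im (?h w v))"
      have g4: "g ?s = A + x" "g (- ?s) = A - x" "g (\<i> * ?s) = A + y" "g (- \<i> * ?s) = A - y"
        unfolding g_def f_def A_def x_def y_def herm_linear using v(1)
        by (simp_all add: power2_eq_square algebra_simps)
      have "(g ?s)\<^sup>2 + (g (- ?s))\<^sup>2 + (g (\<i> * ?s))\<^sup>2 + (g (- \<i> * ?s))\<^sup>2 = 4 * A\<^sup>2 + 2 * x\<^sup>2 + 2 * y\<^sup>2"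
        unfolding g4 by (simp add: power2_eq_square algebra_simps)
      moreover have "A\<^sup>2 = 1 + 2 * s\<^sup>2 * Re (?h w w) + (s\<^sup>2 * Re (?h w w))\<^sup>2"
        unfolding A_def by (simp add: power2_eq_square algebra_simps)
      ultimately show ?thesis by (smt (verit) zero_le_power2)
    qed
    have "\<mu> * (4 * (1 + 2 * s\<^sup>2 * Re (?h w w))) \<le> \<mu> * ((g ?s)\<^sup>2 + (g (- ?s))\<^sup>2 + (g (\<i> * ?s))\<^sup>2 + (g (- \<i> * ?s))\<^sup>2)"
      using gsum \<mu>(2) by (intro mult_left_mono) auto
    also have "\<dots> \<le> \<sigma> * (r ?s + r (- ?s) + r (\<i> * ?s) + r (- \<i> * ?s))"
      unfolding distrib_left g_def r_def by (intro add_mono \<mu>(1))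
    also have "\<dots> = 4 * \<mu> + s\<^sup>2 * (16 * (\<sigma> * Re (?R v v w w)) + 4 * s\<^sup>2 * (\<sigma> * Re (?R w w w w)))"
      unfolding rsum using v(2) by (simp add: algebra_simps power2_eq_square power4_eq_xxxx)
    finally have "s\<^sup>2 * (8 * \<mu> * Re (?h w w)) \<le> s\<^sup>2 * (16 * (\<sigma> * Re (?R v v w w)) + 4 * s\<^sup>2 * (\<sigma> * Re (?R w w w w)))"
      by (simp add: algebra_simps)
    then have "8 * \<mu> * Re (?h w w) \<le> 16 * (\<sigma> * Re (?R v v w w)) + 4 * s\<^sup>2 * (\<sigma> * Re (?R w w w w))"
      using s by simp
    then show ?thesis by linarith
  qed
  from le_of_quadratic_perturbation[OF this] show ?thesis by simp
qed

end

lemma unit_vector_decomposition: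
  assumes "(w :: complex ^ 'n::finite) \<noteq> 0"
  obtains u where "norm u = 1" "w = complex_of_real (norm w) *s u"
proof
  let ?u = "(1 / norm w) *\<^sub>R w"
  show "norm ?u = 1" using assms by simp
  show "w = complex_of_real (norm w) *s ?u" using assms by (simp flip: vec_scaleR_eq)
qed

text \<open>Linear and conjugate linear maps are treated together, with \<open>g\<close> the identity or complex conjugation.\<close>
lemma complex_linear_axis_expansion:
  fixes f :: "complex ^ 'n::finite \<Rightarrow> complex ^ 'm"
  assumes "\<And>x y. f (x + y) = f x + f y" "\<And>a x. f (a *s x) = g a *s f x" "g 0 = 0"
  shows "f x = (\<Sum>i\<in>UNIV. g (x $ i) *s f (axis i 1))"
proof -
  have z: "f 0 = 0" using assms(2)[of 0 0] assms(3) by simp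
  have *: "f (\<Sum>k\<in>A. e k) = (\<Sum>k\<in>A. f (e k))" if "finite A" for A :: "'n set" and e
    using that by (induction A) (auto simp: z assms(1))
  have "f x = f (\<Sum>i\<in>UNIV. x $ i *s axis i 1)" using vec_axis_expansion[of x] by simp
  then show ?thesis by (simp add: * assms(2))
qed

context chern_chart
begin

lemma curv_op_continuous: "continuous_on S (\<lambda>z. curv_op D z x y e)"
proof -
  have "smooth_on (\<lambda>z. dD z x u *v e) S" for u
    by (rule smooth_on_bilinear[OF bounded_bilinear_matrix_vector open_S smooth_on_frechet[OF D_smooth] smooth_on_const])
  then have c: "continuous_on S (\<lambda>z. dD z x u *v e)" for u by (rule smooth_on_continuous)
  have s: "continuous_on S (\<lambda>z. a *s g z)" if "continuous_on S g" for a and g :: "complex ^ 'n \<Rightarrow> complex ^ 'n"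
    by (rule bounded_bilinear.continuous_on[OF bounded_bilinear_scale continuous_on_const that])
  have "continuous_on S (\<lambda>z. - ((1/2) *s (dD z x y *v e + \<i> *s (dD z x (\<i> *s y) *v e))))"
    by (intro continuous_on_minus s continuous_on_add c)
  then show ?thesis by (rule continuous_on_eq) (simp add: curv_op_eq)
qed

lemma continuous_on_R:
  assumes f: "continuous_on Q f" "f ` Q \<subseteq> S"
    and abcd: "continuous_on Q a" "continuous_on Q b" "continuous_on Q c" "continuous_on Q d"
  shows "continuous_on Q (\<lambda>q. R (f q) (a q) (b q) (c q) (d q))"
proof -
  have eq: "curv_op D z x y e = (\<Sum>i\<in>UNIV. x $ i *s (\<Sum>j\<in>UNIV. cnj (y $ j) *s (\<Sum>k\<in>UNIV. e $ k *s
      curv_op D z (axis i 1) (axis j 1) (axis k 1))))" if z: "z \<in> S" for z x y e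
  proof -
    have e1: "curv_op D z x y e = (\<Sum>i\<in>UNIV. x $ i *s curv_op D z (axis i 1) y e)"
      by (rule complex_linear_axis_expansion[where g = "\<lambda>a. a"])
        (simp_all add: curv_op_add1[OF z] curv_op_scale1[OF z])
    have e2: "curv_op D z x y e = (\<Sum>j\<in>UNIV. cnj (y $ j) *s curv_op D z x (axis j 1) e)" for x
      by (rule complex_linear_axis_expansion[where g = cnj])
        (simp_all add: curv_op_add2[OF z] curv_op_scale2[OF z])
    have e3: "curv_op D z x y e = (\<Sum>k\<in>UNIV. e $ k *s curv_op D z x y (axis k 1))" for x y
      by (rule complex_linear_axis_expansion[where g = "\<lambda>a. a"])
        (simp_all add: curv_op_add3[OF z] curv_op_scale3[OF z])
    show ?thesis unfolding e1 e2[of "axis _ 1"] e3[of "axis _ 1" "axis _ 1"] ..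
  qed
  have s: "continuous_on Q (\<lambda>z. \<alpha> z *s g z)"
    if "continuous_on Q \<alpha>" "continuous_on Q g" for \<alpha> and g :: "_ \<Rightarrow> complex ^ 'n"
    by (rule bounded_bilinear.continuous_on[OF bounded_bilinear_scale that])
  have "continuous_on Q (\<lambda>q. \<Sum>i\<in>UNIV. a q $ i *s (\<Sum>j\<in>UNIV. cnj (b q $ j) *s (\<Sum>k\<in>UNIV. c q $ k *s
      curv_op D (f q) (axis i 1) (axis j 1) (axis k 1))))"
    by (intro continuous_on_sum s continuous_on_cnj continuous_on_component abcd
        continuous_on_compose2[OF curv_op_continuous f])
  then have "continuous_on Q (\<lambda>q. curv_op D (f q) (a q) (b q) (c q))"
    by (rule continuous_on_eq) (use f in \<open>auto simp: eq[symmetric]\<close>)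
  then show ?thesis
    by (intro continuous_on_herm abcd continuous_on_compose2[OF smooth_on_continuous[OF h_smooth] f])
qed

text \<open>The direction \<open>v\<close> is the minimiser of the normalised sectional curvature on the unit sphere at \<open>z\<close>. It need
  not depend continuously on \<open>z\<close>; only the bounds are uniform, as extrema of continuous functions over the
  compact set of unit vectors at the points of a closed ball.\<close>
lemma locally_uniform_pinching:
  assumes z0: "z0 \<in> S"
    and ckl: "\<And>z x y v w. z \<in> S \<Longrightarrow> R z x y v w = R z v y x w"
    and sgn: "\<And>z v. z \<in> S \<Longrightarrow> v \<noteq> 0 \<Longrightarrow> \<sigma> * Re (R z v v v v) > 0"
  obtains U lo hi where "open U" "z0 \<in> U" "U \<subseteq> S" "lo > 0" "hi > 0"
    "\<And>z. z \<in> U \<Longrightarrow> \<exists>v. v \<noteq> 0 \<and> (\<forall>w. lo * Re (herm (h z) w w) \<le> \<sigma> * Re (R z v v w w) \<and>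
       \<sigma> * Re (R z v v w w) \<le> hi * Re (herm (h z) w w))"
proof -
  obtain r where r: "r > 0" "cball z0 r \<subseteq> S" using open_S z0 open_contains_cball by blast
  let ?K = "cball z0 r" and ?Sp = "sphere (0 :: complex ^ 'n) 1"
  define \<Phi> where "\<Phi> q = \<sigma> * Re (R (fst q) (snd q) (snd q) (snd q) (snd q)) / (Re (herm (h (fst q)) (snd q) (snd q)))\<^sup>2" for q
  define \<Psi> where "\<Psi> q = \<sigma> * Re (R (fst q) (fst (snd q)) (fst (snd q)) (snd (snd q)) (snd (snd q))) /
     (Re (herm (h (fst q)) (fst (snd q)) (fst (snd q))) * Re (herm (h (fst q)) (snd (snd q)) (snd (snd q))))" for q
  have Kne: "?K \<times> ?Sp \<noteq> {}" "?K \<times> ?Sp \<times> ?Sp \<noteq> {}" "?Sp \<noteq> {}" using r by auto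
  have cK: "compact (?K \<times> ?Sp)" "compact (?K \<times> ?Sp \<times> ?Sp)" by (intro compact_Times compact_cball compact_sphere)+
  have hc: "continuous_on Q (\<lambda>q. herm (h (f q)) (a q) (a q))"
    if "continuous_on Q f" "f ` Q \<subseteq> S" "continuous_on Q a" for Q :: "'q::topological_space set" and f a
    by (intro continuous_on_herm that continuous_on_compose2[OF smooth_on_continuous[OF h_smooth] that(1,2)])
  have hp: "Re (herm (h z) u u) > 0" if "z \<in> ?K" "u \<in> ?Sp" for z u
  proof -
    have "u \<noteq> 0" using that by auto
    then show ?thesis using h_pos that r by blast
  qed
  have c1: "continuous_on (?K \<times> ?Sp) \<Phi>"
    unfolding \<Phi>_def
    by (intro continuous_on_divide continuous_on_mult_left continuous_on_Re continuous_on_power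
        continuous_on_R hc continuous_on_fst continuous_on_snd continuous_on_id)
      (use r hp in \<open>auto simp: less_imp_neq[symmetric]\<close>)
  have c2: "continuous_on (?K \<times> ?Sp \<times> ?Sp) \<Psi>"
    unfolding \<Psi>_def
    by (intro continuous_on_divide continuous_on_mult_left continuous_on_mult continuous_on_Re
        continuous_on_R hc continuous_on_fst continuous_on_snd continuous_on_id)
      (use r hp in \<open>auto simp: less_imp_neq[symmetric]\<close>)
  obtain q1 where q1: "q1 \<in> ?K \<times> ?Sp" "\<And>q. q \<in> ?K \<times> ?Sp \<Longrightarrow> \<Phi> q1 \<le> \<Phi> q"
    using continuous_attains_inf[OF cK(1) Kne(1) c1] by blast
  obtain q2 where q2: "\<And>q. q \<in> ?K \<times> ?Sp \<times> ?Sp \<Longrightarrow> \<Psi> q \<le> \<Psi> q2"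
    using continuous_attains_sup[OF cK(2) Kne(2) c2] by blast
  have \<Phi>pos: "\<Phi> q > 0" if "q \<in> ?K \<times> ?Sp" for q
  proof -
    have "snd q \<noteq> 0" "fst q \<in> S" using that r by auto
    moreover have "(Re (herm (h (fst q)) (snd q) (snd q)))\<^sup>2 > 0"
      using hp[of "fst q" "snd q"] that by (intro zero_less_power) auto
    ultimately show ?thesis using sgn unfolding \<Phi>_def by (intro divide_pos_pos)
  qed
  define lo where "lo = \<Phi> q1 / 2"
  \<comment> \<open>The summand \<open>1\<close> gives \<open>hi > 0\<close> without a discussion of the sign of the supremum.\<close>
  define hi where "hi = \<bar>\<Psi> q2\<bar> + 1"
  show thesis
  proof (rule that[of "ball z0 r" lo hi])
    show "lo > 0" "hi > 0" using \<Phi>pos q1 by (auto simp: lo_def hi_def)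
    show "ball z0 r \<subseteq> S" using r by auto
    fix z assume "z \<in> ball z0 r"
    then have zK: "z \<in> ?K" and zS: "z \<in> S" using r by auto
    have "continuous_on ?Sp (\<lambda>u. \<Phi> (z, u))"
      by (rule continuous_on_compose2[OF c1]) (use zK in \<open>auto intro!: continuous_intros\<close>)
    then obtain u0 where u0: "u0 \<in> ?Sp" "\<And>u. u \<in> ?Sp \<Longrightarrow> \<Phi> (z, u0) \<le> \<Phi> (z, u)"
      using continuous_attains_inf[of ?Sp] Kne(3) compact_sphere by metis
    define \<mu> where "\<mu> = \<Phi> (z, u0)"
    have \<mu>: "\<mu> > 0" "\<Phi> q1 \<le> \<mu>" using \<Phi>pos q1(2) u0 zK by (auto simp: \<mu>_def)
    define k where "k = Re (herm (h z) u0 u0)"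
    have k: "k > 0" using hp zK u0 by (simp add: k_def)
    \<comment> \<open>The minimiser, rescaled to unit length for the metric.\<close>
    define v where "v = complex_of_real (1 / sqrt k) *s u0"
    have sk: "complex_of_real (1 / sqrt k) * complex_of_real (1 / sqrt k) = complex_of_real (1 / k)"
      using k by (simp only: of_real_mult[symmetric]) simp
    have hv: "Re (herm (h z) v v) = 1"
      using k unfolding v_def herm_linear complex_cnj_complex_of_real mult.assoc[symmetric] sk
      by (simp add: k_def)
    have Rv: "\<sigma> * Re (R z v v w w) = \<sigma> * Re (R z u0 u0 w w) / k" for w
    proof -
      have "R z v v w w = of_real (1 / k) * R z u0 u0 w w"
        unfolding v_def R_scale[OF zS] complex_cnj_complex_of_real mult.assoc[symmetric] sk ..
      then show ?thesis by simp
    qed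
    have Rvv: "\<sigma> * Re (R z v v v v) = \<mu>"
    proof -
      have "R z u0 u0 v v = of_real (1 / k) * R z u0 u0 u0 u0"
        unfolding v_def R_scale[OF zS] complex_cnj_complex_of_real mult.assoc[symmetric] sk ..
      then show ?thesis unfolding Rv \<mu>_def \<Phi>_def by (simp add: k_def power2_eq_square)
    qed
    have low: "\<mu> * (Re (herm (h z) u u))\<^sup>2 \<le> \<sigma> * Re (R z u u u u)" for u
    proof (cases "u = 0")
      case True
      then show ?thesis using R_scale(4)[OF zS, of 0 0 0 0 0] by simp
    next
      case False
      then obtain e where e: "norm e = 1" "u = complex_of_real (norm u) *s e" by (rule unit_vector_decomposition)
      have eS: "e \<in> ?Sp" using e by simp
      have "\<mu> * (Re (herm (h z) e e))\<^sup>2 \<le> \<sigma> * Re (R z e e e e)"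
        using u0(2)[OF eS] hp[OF zK eS] unfolding \<mu>_def[symmetric] unfolding \<Phi>_def
        by (simp add: pos_le_divide_eq)
      moreover have "herm (h z) u u = of_real ((norm u)\<^sup>2) * herm (h z) e e"
        by (subst (1 2) e(2)) (simp add: herm_linear power2_eq_square)
      moreover have "R z u u u u = of_real ((norm u) ^ 4) * R z e e e e"
        by (subst (1 2 3 4) e(2)) (simp add: R_scale[OF zS] power4_eq_xxxx)
      ultimately show ?thesis
        using mult_left_mono[of "\<mu> * (Re (herm (h z) e e))\<^sup>2" "\<sigma> * Re (R z e e e e)" "norm u ^ 4"]
        by (simp add: power_mult_distrib mult_ac)
    qed
    have "lo * Re (herm (h z) w w) \<le> \<sigma> * Re (R z v v w w)" for w
    proof -
      have "\<mu> / 2 * Re (herm (h z) w w) \<le> \<sigma> * Re (R z v v w w)"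
        by (rule extremal_direction_pinching[OF zS ckl[OF zS] low \<mu>(1) hv Rvv])
      moreover have "lo * Re (herm (h z) w w) \<le> \<mu> / 2 * Re (herm (h z) w w)"
        using \<mu>(2) by (intro mult_right_mono h_nonneg zS) (simp add: lo_def)
      ultimately show ?thesis by simp
    qed
    moreover have "\<sigma> * Re (R z v v w w) \<le> hi * Re (herm (h z) w w)" for w
    proof (cases "w = 0")
      case True
      then show ?thesis using R_scale(4)[OF zS, of v v 0 0 0] by simp
    next
      case False
      then obtain e where e: "norm e = 1" "w = complex_of_real (norm w) *s e" by (rule unit_vector_decomposition)
      have eS: "e \<in> ?Sp" using e by simp
      have "\<Psi> (z, u0, e) \<le> hi" using q2[of "(z, u0, e)"] zK u0 eS by (simp add: hi_def)
      then have "\<sigma> * Re (R z u0 u0 e e) \<le> hi * (k * Re (herm (h z) e e))"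
        using k hp[OF zK eS] unfolding \<Psi>_def by (simp add: k_def[symmetric] pos_divide_le_eq)
      then have "\<sigma> * Re (R z v v e e) \<le> hi * Re (herm (h z) e e)"
        unfolding Rv using k by (simp add: pos_divide_le_eq mult_ac)
      moreover have "herm (h z) w w = of_real ((norm w)\<^sup>2) * herm (h z) e e"
        by (subst (1 2) e(2)) (simp add: herm_linear power2_eq_square)
      moreover have "R z v v w w = of_real ((norm w)\<^sup>2) * R z v v e e"
        by (subst (1 2) e(2)) (simp add: R_scale[OF zS] power2_eq_square)
      ultimately show ?thesis
        using mult_left_mono[of "\<sigma> * Re (R z v v e e)" "hi * Re (herm (h z) e e)" "(norm w)\<^sup>2"]
        by (simp add: mult_ac)
    qed
    moreover have "v \<noteq> 0" using hv by auto
    ultimately show "\<exists>v. v \<noteq> 0 \<and> (\<forall>w. lo * Re (herm (h z) w w) \<le> \<sigma> * Re (R z v v w w) \<and>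
       \<sigma> * Re (R z v v w w) \<le> hi * Re (herm (h z) w w))" by blast
  qed (use r in auto)
qed

end

section \<open>Vanishing theorem\<close>

lemma compact_space_pointwise_cover:
  assumes "compact_space X" and U: "\<And>x. x \<in> topspace X \<Longrightarrow> openin X (U x) \<and> x \<in> U x"
  obtains F where "finite F" "F \<subseteq> topspace X" "topspace X \<subseteq> \<Union>(U ` F)"
proof -
  have "\<exists>\<F>. finite \<F> \<and> \<F> \<subseteq> U ` topspace X \<and> topspace X \<subseteq> \<Union>\<F>"
    by (rule assms(1)[unfolded compact_space_alt, rule_format]) (use U in blast)+
  then show thesis using that by (metis finite_subset_image)
qed

text \<open>If the supremum is not attained, each \<open>x\<close> has some \<open>g x\<close> with larger value, and the open sets
  \<open>{y. f y < f (g x)}\<close> cover the space. In a finite subcover, the point \<open>g x\<close> with the largest value is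
  missed.\<close>
lemma compact_space_attains_sup_usc:
  fixes f :: "'a \<Rightarrow> real"
  assumes "compact_space X" "topspace X \<noteq> {}"
    and usc: "\<And>x a. x \<in> topspace X \<Longrightarrow> f x < a \<Longrightarrow> \<exists>U. openin X U \<and> x \<in> U \<and> (\<forall>y\<in>U. f y < a)"
  obtains x where "x \<in> topspace X" "\<And>y. y \<in> topspace X \<Longrightarrow> f y \<le> f x"
proof (rule ccontr)
  assume "\<not> thesis"
  then have "\<forall>x\<in>topspace X. \<exists>y\<in>topspace X. f x < f y" using that by (metis not_le)
  then obtain g where g: "\<And>x. x \<in> topspace X \<Longrightarrow> g x \<in> topspace X \<and> f x < f (g x)" by metis
  then have "\<forall>x\<in>topspace X. \<exists>U. openin X U \<and> x \<in> U \<and> (\<forall>y\<in>U. f y < f (g x))" using usc by blast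
  then obtain U where U: "\<And>x. x \<in> topspace X \<Longrightarrow> openin X (U x) \<and> x \<in> U x \<and> (\<forall>y\<in>U x. f y < f (g x))" by metis
  obtain F where F: "finite F" "F \<subseteq> topspace X" "topspace X \<subseteq> \<Union>(U ` F)"
    using compact_space_pointwise_cover[OF assms(1), of U] U by blast
  then have "F \<noteq> {}" using assms(2) by auto
  then have "Max ((\<lambda>x. f (g x)) ` F) \<in> (\<lambda>x. f (g x)) ` F" using F(1) by (intro Max_in) auto
  then obtain x where x: "x \<in> F" "Max ((\<lambda>x. f (g x)) ` F) = f (g x)" by blast
  have x_max: "f (g y) \<le> f (g x)" if "y \<in> F" for y
    using Max_ge[of "(\<lambda>x. f (g x)) ` F" "f (g y)"] F(1) that x(2) by auto
  have "g x \<in> topspace X" using g F(2) x(1) by blast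
  then obtain y where "y \<in> F" "g x \<in> U y" using F(3) by blast
  then have "f (g x) < f (g y)" using U F(2) by blast
  with x_max[OF \<open>y \<in> F\<close>] show False by simp
qed

lemma manifold_chart:
  assumes "complex_manifold X A" "c \<in> A"
  shows "openin X (fst c)" "open (coord_dom c)" "inj_on (snd c) (fst c)"
    "homeomorphic_map (subtopology X (fst c)) (top_of_set (coord_dom c)) (snd c)"
proof -
  show 1: "openin X (fst c)" and "open (coord_dom c)"
    and 2: "homeomorphic_map (subtopology X (fst c)) (top_of_set (coord_dom c)) (snd c)"
    using assms unfolding complex_manifold_def by blast+
  have "topspace (subtopology X (fst c)) = fst c"
    using openin_subset[OF 1] by auto
  with homeomorphic_imp_injective_map[OF 2] show "inj_on (snd c) (fst c)" by simp
qed

lemma openin_chart_preimage: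
  assumes "complex_manifold X A" "c \<in> A" "open V"
  shows "openin X {x \<in> fst c. snd c x \<in> V}"
proof -
  note c = manifold_chart[OF assms(1,2)]
  have top: "topspace (subtopology X (fst c)) = fst c"
    using openin_subset[OF c(1)] by auto
  have "openin (top_of_set (coord_dom c)) (coord_dom c \<inter> V)" using assms(3) by auto
  from openin_continuous_map_preimage[OF homeomorphic_imp_continuous_map[OF c(4)] this]
  have "openin (subtopology X (fst c)) {x \<in> fst c. snd c x \<in> coord_dom c \<inter> V}"
    unfolding top .
  then have "openin X {x \<in> fst c. snd c x \<in> coord_dom c \<inter> V}"
    using openin_trans_full c(1) by blast
  moreover have "{x \<in> fst c. snd c x \<in> coord_dom c \<inter> V} = {x \<in> fst c. snd c x \<in> V}"
    by (auto simp: coord_dom_def)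
  ultimately show ?thesis by simp
qed

lemma transition_at: "inj_on (snd c) (fst c) \<Longrightarrow> x \<in> fst c \<Longrightarrow> transition c d (snd c x) = snd d x"
  by (simp add: transition_def the_inv_into_f_f)

lemma chart_exists:
  assumes "complex_manifold X A" "x \<in> topspace X"
  obtains c where "c \<in> A" "x \<in> fst c"
  using assms unfolding complex_manifold_def by blast

lemma chern_chart_of_manifold:
  assumes "complex_manifold X A" "hermitian_metric A H" "chern_connection A H \<theta>" "c \<in> A"
  shows "chern_chart (coord_dom c) (H c) (\<theta> c)"
proof (rule chern_chart.intro)
  show "open (coord_dom c)" using manifold_chart[OF assms(1,4)] by blast
  show "smooth_on (H c) (coord_dom c)"
    "\<And>z w v. z \<in> coord_dom c \<Longrightarrow> herm (H c z) w v = cnj (herm (H c z) v w)"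
    "\<And>z v. z \<in> coord_dom c \<Longrightarrow> v \<noteq> 0 \<Longrightarrow> Re (herm (H c z) v v) > 0"
    using assms(2,4) unfolding hermitian_metric_def by blast+
  have "connection A \<theta>" using assms(3) unfolding chern_connection_def by blast
  with assms(4) show "\<And>u. smooth_on (\<lambda>z. \<theta> c z u) (coord_dom c)"
    "\<And>z. z \<in> coord_dom c \<Longrightarrow> linear (\<theta> c z)"
    unfolding connection_def by blast+
  show "at_01 (cov_deriv (\<theta> c) s z) v = at_01 (frechet_derivative s (at z)) v"
    if "smooth_on s (coord_dom c)" "z \<in> coord_dom c" for s z v
    using assms(3,4) that unfolding chern_connection_def by blast
  show "frechet_derivative (\<lambda>y. herm (H c y) (s y) (t y)) (at z) u =
      herm (H c z) (cov_deriv (\<theta> c) s z u) (t z) + herm (H c z) (s z) (cov_deriv (\<theta> c) t z u)"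
    if "smooth_on s (coord_dom c)" "smooth_on t (coord_dom c)" "z \<in> coord_dom c" for s t z u
    using assms(3,4) that unfolding chern_connection_def by blast
qed

definition chart_tensor_norm :: "('a, 'n::finite) metric \<Rightarrow> nat \<Rightarrow> nat \<Rightarrow> ('a, 'n) tensor_field \<Rightarrow> ('a, 'n) chart \<Rightarrow> 'a \<Rightarrow> real"
  where "chart_tensor_norm H p q T c x = tensor_norm p q (H c (snd c x)) (T c (snd c x))"

text \<open>By symmetry in \<open>c\<close> and \<open>d\<close> the norm is a function on the manifold.\<close>
lemma chart_tensor_norm_le:
  assumes "complex_manifold X A" and H: "hermitian_metric A H" and T: "T \<in> holo_tensors A p q"
    and cd: "c \<in> A" "d \<in> A" and x: "x \<in> fst c" "x \<in> fst d"
  shows "chart_tensor_norm H p q T d x \<le> chart_tensor_norm H p q T c x"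
proof -
  note c = manifold_chart(3)[OF assms(1) cd(1)] and d = manifold_chart(3)[OF assms(1) cd(2)]
  have tr: "transition c d (snd c x) = snd d x" "transition d c (snd d x) = snd c x"
    using transition_at[OF c x(1)] transition_at[OF d x(2)] by auto
  have ov: "snd c x \<in> overlap c d" "snd d x \<in> overlap d c" using x by (auto simp: overlap_def)
  have dom: "snd c x \<in> coord_dom c" "snd d x \<in> coord_dom d" using x by (auto simp: coord_dom_def)
  show ?thesis
    unfolding chart_tensor_norm_def
  proof (rule tensor_norm_transform_le[where J = "jac c d (snd c x)" and J' = "jac d c (snd d x)"])
    show "Re (herm (H c (snd c x)) v v) > 0" if "v \<noteq> 0" for v
      using H cd dom that unfolding hermitian_metric_def by blast
    show "Re (herm (H d (snd d x)) v v) > 0" if "v \<noteq> 0" for v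
      using H cd dom that unfolding hermitian_metric_def by blast
    have "herm (H d (transition c d (snd c x))) (jac c d (snd c x) *v u) (jac c d (snd c x) *v u) = herm (H c (snd c x)) u u" for u
      using H cd ov unfolding hermitian_metric_def by blast
    then show "Re (herm (H d (snd d x)) (jac c d (snd c x) *v u) (jac c d (snd c x) *v u)) = Re (herm (H c (snd c x)) u u)" for u
      by (simp add: tr)
    have "herm (H c (transition d c (snd d x))) (jac d c (snd d x) *v u) (jac d c (snd d x) *v u) = herm (H d (snd d x)) u u" for u
      using H cd ov unfolding hermitian_metric_def by blast
    then show "Re (herm (H c (snd c x)) (jac d c (snd d x) *v u) (jac d c (snd d x) *v u)) = Re (herm (H d (snd d x)) u u)" for u
      by (simp add: tr)
    fix I K :: "'b list" assume "length I = p" "length K = q"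
    moreover have "\<forall>c\<in>A. \<forall>d\<in>A. \<forall>z\<in>overlap c d. \<forall>I K. length I = p \<longrightarrow> length K = q \<longrightarrow>
        T d (transition c d z) I K =
          (\<Sum>I'\<in>{I'. length I' = p}. \<Sum>K'\<in>{K'. length K' = q}.
             (\<Prod>a<p. jac c d z $ (I ! a) $ (I' ! a)) *
             (\<Prod>b<q. jac d c (transition c d z) $ (K' ! b) $ (K ! b)) * T c z I' K')"
      using T unfolding holo_tensors_def by blast
    ultimately have "T d (transition c d (snd c x)) I K =
          (\<Sum>I'\<in>{I'. length I' = p}. \<Sum>K'\<in>{K'. length K' = q}.
             (\<Prod>a<p. jac c d (snd c x) $ (I ! a) $ (I' ! a)) *
             (\<Prod>b<q. jac d c (transition c d (snd c x)) $ (K' ! b) $ (K ! b)) * T c (snd c x) I' K')"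
      using cd ov by blast
    then show "T d (snd d x) I K = (\<Sum>I' | length I' = p. \<Sum>K' | length K' = q.
             (\<Prod>a<p. jac c d (snd c x) $ (I ! a) $ (I' ! a)) *
             (\<Prod>b<q. jac d c (snd d x) $ (K' ! b) $ (K ! b)) * T c (snd c x) I' K')"
      unfolding tr .
  qed
qed

lemma zero_in_holo_tensors: "0 \<in> holo_tensors A p q"
  by (auto simp: holo_tensors_def mv_holomorphic_on_def intro!: exI[of _ "\<lambda>_. 0"])

text \<open>The norm of a tensor field attains its maximum on the compact manifold. In a chart around such a point the
  curvature bounds exclude a positive maximum, and a tensor of norm zero has no coefficients.\<close>
lemma holo_tensors_vanish:
  assumes M: "complex_manifold X A" "compact_space X"
    and H: "hermitian_metric A H" and \<theta>: "chern_connection A H \<theta>"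
    and pinch: "\<And>x. x \<in> topspace X \<Longrightarrow> \<exists>c\<in>A. x \<in> fst c \<and> (\<exists>v lo hi. v \<noteq> 0 \<and> real p * hi < real q * lo \<and>
      (\<forall>w. lo * Re (herm (H c (snd c x)) w w) \<le> Re (curv_tensor H \<theta> c (snd c x) v v w w) \<and>
        Re (curv_tensor H \<theta> c (snd c x) v v w w) \<le> hi * Re (herm (H c (snd c x)) w w)))"
  shows "holo_tensors A p q = {0}"
proof (rule antisym)
  show "{0} \<subseteq> holo_tensors A p q" using zero_in_holo_tensors by auto
  show "holo_tensors A p q \<subseteq> {0}"
  proof
    fix T assume T: "T \<in> holo_tensors A p q"
    let ?n = "chart_tensor_norm H p q T"
    have hol: "mv_holomorphic_on (\<lambda>z. T c z I K) (coord_dom c)" if "c \<in> A" for c I K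
      using T that unfolding holo_tensors_def by blast
    have supp: "T c z I K = 0" if "\<not> (c \<in> A \<and> z \<in> coord_dom c \<and> length I = p \<and> length K = q)" for c z I K
      using T that unfolding holo_tensors_def by blast
    have pos: "Re (herm (H c z) v v) > 0" if "c \<in> A" "z \<in> coord_dom c" "v \<noteq> 0" for c z v
      using H that unfolding hermitian_metric_def by blast
    \<comment> \<open>Any chart around \<open>x\<close> gives the same value.\<close>
    define N where "N x = ?n (SOME c. c \<in> A \<and> x \<in> fst c) x" for x
    have N: "N x = ?n c x" if "c \<in> A" "x \<in> fst c" for c x
    proof -
      have "(SOME c. c \<in> A \<and> x \<in> fst c) \<in> A \<and> x \<in> fst (SOME c. c \<in> A \<and> x \<in> fst c)"
        by (rule someI[of _ c]) (use that in simp)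
      then show ?thesis unfolding N_def
        by (intro antisym chart_tensor_norm_le[OF M(1) H T]) (use that in auto)
    qed
    have "T c z I K = 0" for c z I K
    proof (cases "c \<in> A \<and> z \<in> coord_dom c \<and> length I = p \<and> length K = q")
      case True
      then obtain x0 where x0: "x0 \<in> fst c" "z = snd c x0" by (auto simp: coord_dom_def)
      then have ne: "topspace X \<noteq> {}" using M(1) True unfolding complex_manifold_def by blast
      have usc: "\<exists>U. openin X U \<and> x \<in> U \<and> (\<forall>y\<in>U. N y < a)" if x: "x \<in> topspace X" "N x < a" for x a
      proof -
        obtain d where d: "d \<in> A" "x \<in> fst d" using chart_exists[OF M(1) x(1)] .
        interpret chern_chart "coord_dom d" "H d" "\<theta> d"
          by (rule chern_chart_of_manifold[OF M(1) H \<theta> d(1)])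
        have zd: "snd d x \<in> coord_dom d" using d by (auto simp: coord_dom_def)
        have "tensor_norm p q (H d (snd d x)) (T d (snd d x)) < a"
          using x(2) N[OF d] by (simp add: chart_tensor_norm_def)
        moreover have "(H d \<longlongrightarrow> H d (snd d x)) (nhds (snd d x))"
          using smooth_on_continuous[OF h_smooth] zd open_S
          by (simp add: continuous_on_eq_continuous_at isCont_def tendsto_at_iff_tendsto_nhds)
        moreover have "((\<lambda>z. T d z I K) \<longlongrightarrow> T d (snd d x) I K) (nhds (snd d x))" for I K
        proof -
          have "isCont (\<lambda>z. T d z I K) (snd d x)"
            using hol[OF d(1), of I K] zd unfolding mv_holomorphic_on_def
            by (metis has_derivative_continuous)
          then show ?thesis
            using tendsto_at_iff_tendsto_nhds[of "\<lambda>z. T d z I K"] by (simp add: isCont_def)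
        qed
        ultimately have "\<forall>\<^sub>F z in nhds (snd d x). tensor_norm p q (H d z) (T d z) < a"
          by (intro tensor_norm_upper_semicontinuous[where ?G0.0 = "H d (snd d x)" and ?T0.0 = "T d (snd d x)"])
            (use h_pos zd in auto)
        then obtain V where V: "open V" "snd d x \<in> V" "\<And>z. z \<in> V \<Longrightarrow> tensor_norm p q (H d z) (T d z) < a"
          unfolding eventually_nhds by blast
        show ?thesis
        proof (intro exI conjI ballI)
          show "openin X {y \<in> fst d. snd d y \<in> V}" by (rule openin_chart_preimage[OF M(1) d(1) V(1)])
          show "x \<in> {y \<in> fst d. snd d y \<in> V}" using d V by simp
          fix y assume "y \<in> {y \<in> fst d. snd d y \<in> V}"
          then show "N y < a" using N[OF d(1), of y] V(3) by (simp add: chart_tensor_norm_def)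
        qed
      qed
      obtain x where x: "x \<in> topspace X" "\<And>y. y \<in> topspace X \<Longrightarrow> N y \<le> N x"
        using compact_space_attains_sup_usc[OF M(2) ne usc] by blast
      obtain d v lo hi where d: "d \<in> A" "x \<in> fst d" and v: "v \<noteq> 0" "real p * hi < real q * lo"
        and lo: "\<And>w. lo * Re (herm (H d (snd d x)) w w) \<le> Re (curv_tensor H \<theta> d (snd d x) v v w w)"
        and hi: "\<And>w. Re (curv_tensor H \<theta> d (snd d x) v v w w) \<le> hi * Re (herm (H d (snd d x)) w w)"
        using pinch[OF x(1)] by blast
      interpret chern_chart "coord_dom d" "H d" "\<theta> d"
        by (rule chern_chart_of_manifold[OF M(1) H \<theta> d(1)])
      have zd: "snd d x \<in> coord_dom d" using d by (auto simp: coord_dom_def)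
      have "tensor_norm p q (H d (snd d x)) (T d (snd d x)) = 0"
      proof (rule no_interior_maximum[OF zd v(1) lo[unfolded curv_tensor_def] hi[unfolded curv_tensor_def] v(2) hol[OF d(1)]])
        fix z' assume "z' \<in> coord_dom d"
        then obtain y where y: "y \<in> fst d" "z' = snd d y" by (auto simp: coord_dom_def)
        then have "y \<in> topspace X" using openin_subset[OF manifold_chart(1)[OF M(1) d(1)]] by blast
        then show "tensor_norm p q (H d z') (T d z') \<le> tensor_norm p q (H d (snd d x)) (T d (snd d x))"
          using x(2)[of y] N[OF d] N[OF d(1) y(1)] y by (simp add: chart_tensor_norm_def)
      qed
      then have "N x = 0" using N[OF d] by (simp add: chart_tensor_norm_def)
      moreover have "x0 \<in> topspace X" using openin_subset[OF manifold_chart(1)[OF M(1), of c]] True x0 by blast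
      ultimately have "tensor_norm p q (H c z) (T c z) \<le> 0"
        using x(2)[of x0] N[of c x0] True x0 by (simp add: chart_tensor_norm_def)
      moreover have "tensor_norm p q (H c z) (T c z) \<ge> 0"
        by (rule tensor_norm_nonneg) (use pos True in blast)
      ultimately show ?thesis
        by (intro tensor_norm_zero_imp[of "H c z" p q "T c z"]) (use pos True in auto)
    qed (rule supp)
    then show "T \<in> {0}" by (auto simp: fun_eq_iff)
  qed
qed

text \<open>The local constants are combined by a finite subcover; the property becomes weaker when \<open>C\<close> grows, so
  one constant above all of them serves for every point.\<close>
lemma uniform_pinching:
  assumes M: "complex_manifold X A" "compact_space X"
    and H: "hermitian_metric A H" and \<theta>: "chern_connection A H \<theta>"
    and ckl: "chern_kahler_like A H \<theta>"
    and sgn: "\<And>c z v. c \<in> A \<Longrightarrow> z \<in> coord_dom c \<Longrightarrow> v \<noteq> 0 \<Longrightarrow> \<sigma> * Re (curv_tensor H \<theta> c z v v v v) > 0"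
  obtains C where "C > 0"
    "\<And>x. x \<in> topspace X \<Longrightarrow> \<exists>c\<in>A. x \<in> fst c \<and> (\<exists>v lo. v \<noteq> 0 \<and> lo > 0 \<and>
      (\<forall>w. lo * Re (herm (H c (snd c x)) w w) \<le> \<sigma> * Re (curv_tensor H \<theta> c (snd c x) v v w w) \<and>
        \<sigma> * Re (curv_tensor H \<theta> c (snd c x) v v w w) \<le> (C * lo) * Re (herm (H c (snd c x)) w w)))"
proof -
  define P where "P C x \<longleftrightarrow> (\<exists>c\<in>A. x \<in> fst c \<and> (\<exists>v lo. v \<noteq> 0 \<and> lo > 0 \<and>
      (\<forall>w. lo * Re (herm (H c (snd c x)) w w) \<le> \<sigma> * Re (curv_tensor H \<theta> c (snd c x) v v w w) \<and>
        \<sigma> * Re (curv_tensor H \<theta> c (snd c x) v v w w) \<le> (C * lo) * Re (herm (H c (snd c x)) w w))))" for C x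
  have mono: "P C' x" if "P C x" "C \<le> C'" for C C' x
  proof -
    from that(1) obtain c v lo where c: "c \<in> A" "x \<in> fst c" "v \<noteq> 0" "lo > 0"
      and b: "\<And>w. lo * Re (herm (H c (snd c x)) w w) \<le> \<sigma> * Re (curv_tensor H \<theta> c (snd c x) v v w w)"
        "\<And>w. \<sigma> * Re (curv_tensor H \<theta> c (snd c x) v v w w) \<le> (C * lo) * Re (herm (H c (snd c x)) w w)"
      unfolding P_def by blast
    interpret chern_chart "coord_dom c" "H c" "\<theta> c"
      by (rule chern_chart_of_manifold[OF M(1) H \<theta> c(1)])
    have "(C * lo) * Re (herm (H c (snd c x)) w w) \<le> (C' * lo) * Re (herm (H c (snd c x)) w w)" for w
      using c that(2) by (intro mult_right_mono h_nonneg) (auto simp: coord_dom_def)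
    with b c show ?thesis unfolding P_def by (meson order_trans)
  qed
  have loc: "\<exists>C U. C > 0 \<and> openin X U \<and> x \<in> U \<and> (\<forall>y\<in>U. P C y)" if x: "x \<in> topspace X" for x
  proof -
    obtain c where c: "c \<in> A" "x \<in> fst c" using chart_exists[OF M(1) x] .
    interpret chern_chart "coord_dom c" "H c" "\<theta> c"
      by (rule chern_chart_of_manifold[OF M(1) H \<theta> c(1)])
    have zc: "snd c x \<in> coord_dom c" using c by (auto simp: coord_dom_def)
    have k: "R z x y v w = R z v y x w" if "z \<in> coord_dom c" for z x y v w
      using ckl c(1) that unfolding chern_kahler_like_def curv_tensor_def by blast
    have s: "\<sigma> * Re (R z v v v v) > 0" if "z \<in> coord_dom c" "v \<noteq> 0" for z v
      using sgn[OF c(1) that] unfolding curv_tensor_def .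
    obtain V lo hi where V: "open V" "snd c x \<in> V" "V \<subseteq> coord_dom c" "lo > 0" "hi > 0"
      "\<And>z. z \<in> V \<Longrightarrow> \<exists>v. v \<noteq> 0 \<and> (\<forall>w. lo * Re (herm (H c z) w w) \<le> \<sigma> * Re (R z v v w w) \<and>
       \<sigma> * Re (R z v v w w) \<le> hi * Re (herm (H c z) w w))"
      by (rule locally_uniform_pinching[OF zc k s]) blast+
    have "P (hi / lo) y" if "y \<in> {y \<in> fst c. snd c y \<in> V}" for y
    proof -
      have hl: "hi / lo * lo = hi" using V(4) by simp
      show ?thesis
        unfolding P_def curv_tensor_def
        using V(6)[of "snd c y"] that c(1) V(4) hl by (metis (mono_tags, lifting) mem_Collect_eq)
    qed
    moreover have "openin X {y \<in> fst c. snd c y \<in> V}" by (rule openin_chart_preimage[OF M(1) c(1) V(1)])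
    moreover have "x \<in> {y \<in> fst c. snd c y \<in> V}" using c V by simp
    moreover have "hi / lo > 0" using V by simp
    ultimately show ?thesis by blast
  qed
  then obtain C U where CU: "\<And>x. x \<in> topspace X \<Longrightarrow> C x > (0::real) \<and> openin X (U x) \<and> x \<in> U x \<and> (\<forall>y\<in>U x. P (C x) y)"
    by metis
  obtain F where F: "finite F" "F \<subseteq> topspace X" "topspace X \<subseteq> \<Union>(U ` F)"
    using compact_space_pointwise_cover[OF M(2), of U] CU by blast
  \<comment> \<open>The summand \<open>1\<close> makes the constant positive even for an empty cover.\<close>
  define C0 where "C0 = 1 + (\<Sum>x\<in>F. C x)"
  have Cnn: "C x \<ge> 0" if "x \<in> F" for x using CU F(2) that by (meson less_imp_le subsetD)
  show thesis
  proof (rule that[of C0])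
    show "C0 > 0" unfolding C0_def using sum_nonneg[of F C] Cnn by fastforce
    fix x assume "x \<in> topspace X"
    then obtain y where y: "y \<in> F" "x \<in> U y" using F(3) by blast
    have "C y \<le> (\<Sum>x\<in>F. C x)" using F(1) y Cnn by (intro member_le_sum) auto
    then have "P C0 x" using mono[of "C y" x C0] CU F(2) y by (auto simp: C0_def)
    then show "\<exists>c\<in>A. x \<in> fst c \<and> (\<exists>v lo. v \<noteq> 0 \<and> lo > 0 \<and>
      (\<forall>w. lo * Re (herm (H c (snd c x)) w w) \<le> \<sigma> * Re (curv_tensor H \<theta> c (snd c x) v v w w) \<and>
        \<sigma> * Re (curv_tensor H \<theta> c (snd c x) v v w w) \<le> (C0 * lo) * Re (herm (H c (snd c x)) w w)))"
      unfolding P_def .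
  qed
qed

lemma hol_sect_curv_sign:
  assumes "hermitian_metric A H" "c \<in> A" "z \<in> coord_dom c" "v \<noteq> 0"
  shows "hol_sect_curv H \<theta> c z v > 0 \<longleftrightarrow> Re (curv_tensor H \<theta> c z v v v v) > 0"
    and "hol_sect_curv H \<theta> c z v < 0 \<longleftrightarrow> Re (curv_tensor H \<theta> c z v v v v) < 0"
proof -
  have "Re (herm (H c z) v v) > 0" using assms unfolding hermitian_metric_def by blast
  then have "herm_norm (H c z) v ^ 4 > 0" unfolding herm_norm_def by simp
  then show "hol_sect_curv H \<theta> c z v > 0 \<longleftrightarrow> Re (curv_tensor H \<theta> c z v v v v) > 0"
    "hol_sect_curv H \<theta> c z v < 0 \<longleftrightarrow> Re (curv_tensor H \<theta> c z v v v v) < 0"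
    unfolding hol_sect_curv_def by (simp_all add: zero_less_divide_iff divide_less_0_iff)
qed

lemma hodge_q0_eq_0:
  assumes "holo_tensors A 0 q = {0}"
  shows "hodge_q0 A q = 0"
proof -
  interpret vector_space tensor_scale by (rule vector_space_tensor_scale)
  have "holo_forms A q \<subseteq> {0}" using assms by (auto simp: holo_forms_def)
  then have "span (holo_forms A q) = span {}"
    using span_mono[of "holo_forms A q" "{0}"] span_zero by auto
  then have "dim (holo_forms A q) = card ({} :: ('a, 'b) tensor_field set)"
    by (intro dim_eq_card independent_empty) simp
  then show ?thesis unfolding hodge_q0_def by simp
qed

text \<open>The curvature bounds of \<open>uniform_pinching\<close> are \<open>lo\<close> and \<open>C lo\<close> for \<open>\<sigma> = 1\<close>, and
  \<open>- C lo\<close> and \<open>- lo\<close> for \<open>\<sigma> = -1\<close>. For \<open>p = 0\<close> the condition \<open>q > C p\<close> holds for all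
  \<open>q \<ge> 1\<close>, whatever \<open>C\<close> is, and likewise for \<open>q = 0\<close>.\<close>
theorem theorem1p5:
  fixes X :: "'a topology" and A :: "('a, 'n::finite) chart set"
    and H :: "('a, 'n) metric" and \<theta> :: "('a, 'n) connection"
  assumes "complex_manifold X A" and "compact_space X" and "connected_space X"
    and "CARD('n) \<ge> 2"
    and "hermitian_metric A H"
    and "chern_connection A H \<theta>"
    and "chern_kahler_like A H \<theta>"
  shows "(HSC_pos A H \<theta> \<longrightarrow>
            (\<exists>C>0. \<forall>p q :: nat. real q > C * real p \<longrightarrow> holo_tensors A p q = {0}) \<and>
            (\<forall>q\<ge>1. holo_tensors A 0 q = {0}) \<and>
            (\<forall>q. 1 \<le> q \<and> q \<le> CARD('n) \<longrightarrow> hodge_q0 A q = 0)) \<and>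
         (HSC_neg A H \<theta> \<longrightarrow>
            (\<exists>C>0. \<forall>p q :: nat. real p > C * real q \<longrightarrow> holo_tensors A p q = {0}) \<and>
            (\<forall>p\<ge>1. holo_tensors A p 0 = {0}))"
proof (intro conjI impI)
  note geom = assms(1,2,5,6)
  have positive: "\<exists>C>0. \<forall>p q :: nat. real q > C * real p \<longrightarrow> holo_tensors A p q = {0}" if "HSC_pos A H \<theta>"
  proof -
    have "1 * Re (curv_tensor H \<theta> c z v v v v) > 0" if "c \<in> A" "z \<in> coord_dom c" "v \<noteq> 0" for c z v
      using \<open>HSC_pos A H \<theta>\<close> that hol_sect_curv_sign(1)[OF assms(5) that, of \<theta>] unfolding HSC_pos_def by simp
    from uniform_pinching[OF geom assms(7) this]
    obtain C where C: "C > 0" "\<And>x. x \<in> topspace X \<Longrightarrow> \<exists>c\<in>A. x \<in> fst c \<and> (\<exists>v lo. v \<noteq> 0 \<and> lo > 0 \<and>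
      (\<forall>w. lo * Re (herm (H c (snd c x)) w w) \<le> 1 * Re (curv_tensor H \<theta> c (snd c x) v v w w) \<and>
        1 * Re (curv_tensor H \<theta> c (snd c x) v v w w) \<le> (C * lo) * Re (herm (H c (snd c x)) w w)))"
      by blast
    have "holo_tensors A p q = {0}" if pq: "real q > C * real p" for p q
    proof (rule holo_tensors_vanish[OF geom])
      fix x assume "x \<in> topspace X"
      then obtain c v lo where c: "c \<in> A" "x \<in> fst c" "v \<noteq> 0" "lo > 0"
        "\<forall>w. lo * Re (herm (H c (snd c x)) w w) \<le> Re (curv_tensor H \<theta> c (snd c x) v v w w) \<and>
        Re (curv_tensor H \<theta> c (snd c x) v v w w) \<le> (C * lo) * Re (herm (H c (snd c x)) w w)"
        using C(2)[of x] by auto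
      moreover have "real p * (C * lo) < real q * lo"
        using mult_strict_right_mono[OF pq c(4)] by (simp add: mult_ac)
      ultimately show "\<exists>c\<in>A. x \<in> fst c \<and> (\<exists>v lo hi. v \<noteq> 0 \<and> real p * hi < real q * lo \<and>
        (\<forall>w. lo * Re (herm (H c (snd c x)) w w) \<le> Re (curv_tensor H \<theta> c (snd c x) v v w w) \<and>
        Re (curv_tensor H \<theta> c (snd c x) v v w w) \<le> hi * Re (herm (H c (snd c x)) w w)))"
        by blast
    qed
    with C(1) show ?thesis by blast
  qed
  have negative: "\<exists>C>0. \<forall>p q :: nat. real p > C * real q \<longrightarrow> holo_tensors A p q = {0}" if "HSC_neg A H \<theta>"
  proof -
    have "- 1 * Re (curv_tensor H \<theta> c z v v v v) > 0" if "c \<in> A" "z \<in> coord_dom c" "v \<noteq> 0" for c z v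
      using \<open>HSC_neg A H \<theta>\<close> that hol_sect_curv_sign(2)[OF assms(5) that, of \<theta>] unfolding HSC_neg_def by simp
    from uniform_pinching[OF geom assms(7) this]
    obtain C where C: "C > 0" "\<And>x. x \<in> topspace X \<Longrightarrow> \<exists>c\<in>A. x \<in> fst c \<and> (\<exists>v lo. v \<noteq> 0 \<and> lo > 0 \<and>
      (\<forall>w. lo * Re (herm (H c (snd c x)) w w) \<le> - 1 * Re (curv_tensor H \<theta> c (snd c x) v v w w) \<and>
        - 1 * Re (curv_tensor H \<theta> c (snd c x) v v w w) \<le> (C * lo) * Re (herm (H c (snd c x)) w w)))"
      by blast
    have "holo_tensors A p q = {0}" if pq: "real p > C * real q" for p q
    proof (rule holo_tensors_vanish[OF geom])
      fix x assume "x \<in> topspace X"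
      then obtain c v lo where c: "c \<in> A" "x \<in> fst c" "v \<noteq> 0" "lo > 0"
        and b: "\<And>w. lo * Re (herm (H c (snd c x)) w w) \<le> - Re (curv_tensor H \<theta> c (snd c x) v v w w)"
        "\<And>w. - Re (curv_tensor H \<theta> c (snd c x) v v w w) \<le> (C * lo) * Re (herm (H c (snd c x)) w w)"
        using C(2)[of x] by auto
      have "\<forall>w. - (C * lo) * Re (herm (H c (snd c x)) w w) \<le> Re (curv_tensor H \<theta> c (snd c x) v v w w) \<and>
        Re (curv_tensor H \<theta> c (snd c x) v v w w) \<le> - lo * Re (herm (H c (snd c x)) w w)"
      proof
        fix w
        show "- (C * lo) * Re (herm (H c (snd c x)) w w) \<le> Re (curv_tensor H \<theta> c (snd c x) v v w w) \<and>
          Re (curv_tensor H \<theta> c (snd c x) v v w w) \<le> - lo * Re (herm (H c (snd c x)) w w)"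
          using b(1)[of w] b(2)[of w] unfolding mult_minus_left by linarith
      qed
      moreover have "real p * - lo < real q * - (C * lo)"
        using mult_strict_right_mono[OF pq c(4)] by (simp add: mult_ac)
      ultimately show "\<exists>c\<in>A. x \<in> fst c \<and> (\<exists>v lo hi. v \<noteq> 0 \<and> real p * hi < real q * lo \<and>
        (\<forall>w. lo * Re (herm (H c (snd c x)) w w) \<le> Re (curv_tensor H \<theta> c (snd c x) v v w w) \<and>
        Re (curv_tensor H \<theta> c (snd c x) v v w w) \<le> hi * Re (herm (H c (snd c x)) w w)))"
        using c(1,2,3) by blast
    qed
    with C(1) show ?thesis by blast
  qed
  have forms: "holo_tensors A 0 q = {0}" if "HSC_pos A H \<theta>" "q \<ge> 1" for q
    using positive[OF that(1)] that(2) by force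
  show "\<exists>C>0. \<forall>p q :: nat. real q > C * real p \<longrightarrow> holo_tensors A p q = {0}" if "HSC_pos A H \<theta>"
    by (rule positive[OF that])
  show "\<exists>C>0. \<forall>p q :: nat. real p > C * real q \<longrightarrow> holo_tensors A p q = {0}" if "HSC_neg A H \<theta>"
    by (rule negative[OF that])
  show "\<forall>q\<ge>1. holo_tensors A 0 q = {0}" if "HSC_pos A H \<theta>" using forms[OF that] by blast
  show "\<forall>p\<ge>1. holo_tensors A p 0 = {0}" if "HSC_neg A H \<theta>"
    using negative[OF that] by force
  show "\<forall>q. 1 \<le> q \<and> q \<le> CARD('n) \<longrightarrow> hodge_q0 A q = 0" if "HSC_pos A H \<theta>"
    using forms[OF that] hodge_q0_eq_0 by blast
qed

end
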